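(* Let $(K,v)$ be a henselian subfield of a power series field $k((G))$ such that $v$ is the restriction of the canonical valuation of $k((G))$. Suppose that $K$ contains all monomials of the form $ct^\gamma$ for $c\in Kv\subseteq k$ and $\gamma\in vK\subseteq G$. Consider a power series $$z=\sum_{i\in\mathbb{N}}c_it^{\gamma_i}$$ where $(\gamma_i)_{i\in\mathbb{N}}$ is a strictly increasing sequence in $G$, all $c_i\in k$ are separable-algebraic over $Kv$, and for each $i$ there is an integer $e_i>0$ prime to the characteristic of $Kv$ and such that $e_i\gamma_i\in vK$. Then, upon taking the henselization of $K(z)$ in $k((G))$, we obtain that $K(c_it^{\gamma_i}\mid i\in\mathbb{N})\subseteq K(z)^h$. Consequently, $vK(z)$ contains all $\gamma_i$, and if $\gamma_i\in vK$ for all $i\in\mathbb{N}$, then $K(z)v$ contains all $c_i$. If $(vK+\sum_{i=1}^{\infty}\mathbb{Z}\gamma_i)/vK$ or $Kv(c_i\mid i\in\mathbb{N})|Kv$ is infinite, then $z$ is transcendental over $K$, we have $\mathrm{IC}(K(z)|K,v)=K(c_it^{\gamma_i}\mid i\in\mathbb{N})$, and a) $vK(z)$ is the group generated over $vK$ by the elements $\gamma_i$, b) if $\gamma_i\in vK$ for all $i\in\mathbb{N}$, then $K(z)v=Kv(c_i\mid i\in\mathbb{N})$.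
   Context: Here $k$ is a field, $G$ is an ordered abelian group, and $k((G))$ denotes the field of power series $\sum_{g\in G}c_gt^g$ with coefficients $c_g\in k$, exponents in $G$ and well-ordered support; its canonical valuation sends a nonzero series to the minimum of its support, with value group $G$ and residue field $k$ (the residue map is the identity on $k$). For a valued field $(L,v)$, $vL$ and $Lv$ denote its value group and residue field, and $L^h$ its henselization. $\mathrm{IC}(K(z)|K,v)$, the implicit constant field, is the relative algebraic closure of $K$ in the henselization $K(z)^h$. If the characteristic of $Kv$ is $0$, the condition that $e_i$ be prime to it is void. "Infinite" means an infinite group, respectively a field extension of infinite degree.
   Formalization: All coefficients c_i are assumed to be nonzero; with zero coefficients allowed the claim fails, e.g. for z = 0 with γ_i outside vK, where vK(z) does not contain the γ_i and z is not transcendental. *)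

theory Defs
  imports
    "HOL-Algebra.Algebraic_Closure_Type"
    "HOL-Algebra.Generated_Fields"
    "HOL-Computational_Algebra.Group_Closure"
    "HOL-Library.Set_Algebras"
begin

text \<open>
  \<open>k\<close> and \<open>G\<close> are types (of class \<open>field\<close> and \<open>linordered_ab_group_add\<close>), and \<open>k((G))\<close> is made
  an instance of class \<open>field\<close>. Subfields of \<open>k\<close> and of \<open>k((G))\<close> are sets, and the notions for
  them (subfield, generated subfield, algebraic, degree) are those of HOL-Algebra, applied to
  \<open>ring_of_type_algebra\<close>, the ring record of a type.
\<close>

section \<open>The power series field \<open>k((G))\<close>\<close>

subsection \<open>Well-ordered subsets of an ordered abelian group\<close>

lemma wo_incseq_subseq:
  fixes s :: "nat \<Rightarrow> 'a::linorder"
  assumes wo: "wfp_on A (<)" and s: "\<And>n. s n \<in> A"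
  obtains r where "strict_mono r" "incseq (s \<circ> r)"
proof -
  obtain r :: "nat \<Rightarrow> nat" where r: "strict_mono r" "monoseq (\<lambda>n. s (r n))"
    using seq_monosub by blast
  show thesis
  proof (cases "incseq (\<lambda>n. s (r n))")
    case True
    then show ?thesis using r that by (auto simp: o_def)
  next
    case False
    then have dec: "decseq (\<lambda>n. s (r n))"
      using r(2) monoseq_iff by blast
    have "range (\<lambda>n. s (r n)) \<subseteq> A" "range (\<lambda>n. s (r n)) \<noteq> {}" using s by auto
    then obtain m where m: "m \<in> range (\<lambda>n. s (r n))" "\<forall>y. y < m \<longrightarrow> y \<notin> range (\<lambda>n. s (r n))"
      using wo unfolding wfp_on_iff_ex_minimal by metis
    obtain N where N: "m = s (r N)" using m(1) by auto
    have const: "s (r (N + n)) = m" for n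
      using m(2) decseqD[OF dec, of N "N + n"] N by (metis le_add1 order_le_less rangeI)
    show ?thesis
    proof (rule that[of "\<lambda>n. r (N + n)"])
      show "strict_mono (\<lambda>n. r (N + n))"
        using r(1) by (simp add: strict_mono_def)
      show "incseq (s \<circ> (\<lambda>n. r (N + n)))"
        by (simp add: incseq_def const)
    qed
  qed
qed

lemma not_wo_decreasing_seq:
  fixes A :: "'a::linorder set"
  assumes "\<not> wfp_on A (<)"
  obtains s :: "nat \<Rightarrow> 'a" where "\<forall>n. s n \<in> A" "\<forall>m n. m < n \<longrightarrow> s n < s m"
proof -
  obtain B where B: "B \<subseteq> A" "B \<noteq> {}" "\<forall>z\<in>B. \<exists>y. y < z \<and> y \<in> B"
    using assms unfolding wfp_on_iff_ex_minimal by auto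
  have "\<exists>s. \<forall>n. s n \<in> B \<and> s (Suc n) < s n"
  proof (rule dependent_nat_choice)
    show "\<exists>x. x \<in> B" using B(2) by blast
    show "\<exists>y. y \<in> B \<and> y < x" if "x \<in> B" for x and n :: nat
      using B(3) that by blast
  qed
  then obtain s where s: "\<And>n. s n \<in> B" "\<And>n. s (Suc n) < s n" by blast
  have "s n < s m" if "m < n" for m n
    using that
  proof (induction n)
    case (Suc n)
    then show ?case using s(2)[of n] less_trans[of "s (Suc n)" "s n" "s m"]
      by (cases "m = n") auto
  qed simp
  then show thesis using that[of s] s B(1) by blast
qed


lemma wo_subset: "wfp_on B (<) \<Longrightarrow> A \<subseteq> B \<Longrightarrow> wfp_on A (<)"
  for A B :: "'a::linorder set"
  using wfp_on_subset by blast

lemma wo_Un: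
  fixes A B :: "'a::linorder set"
  assumes A: "wfp_on A (<)" and B: "wfp_on B (<)"
  shows "wfp_on (A \<union> B) (<)"
  unfolding wfp_on_iff_ex_minimal
proof (intro allI impI)
  fix C assume C: "C \<subseteq> A \<union> B" "C \<noteq> {}"
  have min: "\<exists>z\<in>D. \<forall>y\<in>D. z \<le> y" if "D \<subseteq> E" "wfp_on E (<)" "D \<noteq> {}" for D E :: "'a set"
    using that unfolding wfp_on_iff_ex_minimal by (meson not_le)
  consider "C \<inter> A = {}" | "C \<inter> B = {}" | "C \<inter> A \<noteq> {}" "C \<inter> B \<noteq> {}" by blast
  then have "\<exists>z\<in>C. \<forall>y\<in>C. z \<le> y"
  proof cases
    case 1
    then show ?thesis using min[OF _ B, of C] C by blast
  next
    case 2
    then show ?thesis using min[OF _ A, of C] C by blast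
  next
    case 3
    obtain a where a: "a \<in> C \<inter> A" "\<forall>y\<in>C \<inter> A. a \<le> y" using min[OF _ A, of "C \<inter> A"] 3 by blast
    obtain b where b: "b \<in> C \<inter> B" "\<forall>y\<in>C \<inter> B. b \<le> y" using min[OF _ B, of "C \<inter> B"] 3 by blast
    have "min a b \<in> C" using a(1) b(1) by (simp add: min_def)
    moreover have "\<forall>y\<in>C. min a b \<le> y" using a(2) b(2) C(1) by (auto simp: min_le_iff_disj)
    ultimately show ?thesis by blast
  qed
  then show "\<exists>z\<in>C. \<forall>y. y < z \<longrightarrow> y \<notin> C" by (meson not_le)
qed

lemma wo_sumset:
  fixes A B :: "'a::linordered_ab_group_add set"
  assumes A: "wfp_on A (<)" and B: "wfp_on B (<)"
  shows "wfp_on (A + B) (<)"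
proof (rule ccontr)
  assume not_wo: "\<not> ?thesis"
  obtain s :: "nat \<Rightarrow> 'a" where s: "\<forall>n. s n \<in> A + B" "\<forall>m n. m < n \<longrightarrow> s n < s m"
    by (rule not_wo_decreasing_seq[OF not_wo])
  have "\<forall>n. \<exists>a b. a \<in> A \<and> b \<in> B \<and> s n = a + b"
    using s(1) unfolding set_plus_def by blast
  then obtain a b where ab: "\<And>n. a n \<in> A" "\<And>n. b n \<in> B" "\<And>n. s n = a n + b n"
    by metis
  obtain r where r: "strict_mono r" "incseq (a \<circ> r)"
    by (rule wo_incseq_subseq[OF A ab(1)])
  obtain q where q: "strict_mono q" "incseq ((\<lambda>n. b (r n)) \<circ> q)"
    by (rule wo_incseq_subseq[OF B ab(2)])
  have "a (r (q 0)) \<le> a (r (q 1))"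
    using incseqD[OF r(2), of "q 0" "q 1"] q(1) by (simp add: strict_mono_less_eq)
  moreover have "b (r (q 0)) \<le> b (r (q 1))"
    using incseqD[OF q(2), of 0 1] by simp
  ultimately have "s (r (q 0)) \<le> s (r (q 1))"
    unfolding ab(3) by (rule add_mono)
  moreover have "r (q 0) < r (q 1)"
    using r(1) q(1) by (simp add: strict_mono_less)
  ultimately show False using s(2) leD by blast
qed

lemma wo_finite_fibre:
  fixes A B :: "'a::linordered_ab_group_add set"
  assumes A: "wfp_on A (<)" and B: "wfp_on B (<)"
  shows "finite {a \<in> A. x - a \<in> B}"
proof (rule ccontr)
  assume "infinite {a \<in> A. x - a \<in> B}"
  then obtain s :: "nat \<Rightarrow> 'a" where s: "inj s" "range s \<subseteq> {a \<in> A. x - a \<in> B}"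
    using infinite_countable_subset by blast
  have sA: "s n \<in> A" and sB: "x - s n \<in> B" for n
    using s(2) by auto
  obtain r where r: "strict_mono r" "incseq (s \<circ> r)"
    by (rule wo_incseq_subseq[OF A sA])
  obtain q where q: "strict_mono q" "incseq ((\<lambda>n. x - s (r n)) \<circ> q)"
    by (rule wo_incseq_subseq[OF B sB])
  have "s (r (q 0)) \<le> s (r (q 1))"
    using incseqD[OF r(2), of "q 0" "q 1"] q(1) by (simp add: strict_mono_less_eq)
  moreover have "x - s (r (q 0)) \<le> x - s (r (q 1))"
    using incseqD[OF q(2), of 0 1] by simp
  ultimately have "s (r (q 0)) = s (r (q 1))" by simp
  then have "r (q 0) = r (q 1)" using s(1) by (simp add: inj_eq)
  then show False using r(1) q(1) by (simp add: strict_mono_eq)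
qed

subsection \<open>The type of power series\<close>

typedef (overloaded) ('g, 'k) hahn_series =
  "{f :: 'g::linordered_ab_group_add \<Rightarrow> 'k::field. wfp_on {g. f g \<noteq> 0} (<)}"
  morphisms hcoeff Abs_hahn_series
  by (rule exI[of _ "\<lambda>_. 0"]) (simp add: wfp_on_iff_ex_minimal)

setup_lifting type_definition_hahn_series

definition supp :: "('g::linordered_ab_group_add, 'k::field) hahn_series \<Rightarrow> 'g set" where
  "supp f = {g. hcoeff f g \<noteq> 0}"

lemma supp_wo: "wfp_on (supp f) (<)"
  unfolding supp_def using hcoeff[of f] by simp

lemma hcoeff_Abs:
  "wfp_on {g. f g \<noteq> 0} (<) \<Longrightarrow> hcoeff (Abs_hahn_series f) = f"
  by (rule Abs_hahn_series_inverse) simp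

lemma hahn_eqI: "(\<And>g. hcoeff f g = hcoeff h g) \<Longrightarrow> f = h"
  by (simp add: hcoeff_inject[symmetric] fun_eq_iff)

text \<open>\<open>monomial c g\<close> is the series \<open>c t^g\<close>.\<close>

lift_definition monomial :: "'k::field \<Rightarrow> 'g::linordered_ab_group_add \<Rightarrow> ('g, 'k) hahn_series"
  is "\<lambda>c g h. if h = g then c else 0"
proof -
  fix c :: 'k and g :: 'g
  show "wfp_on {h. (if h = g then c else 0) \<noteq> 0} (<)"
    by (rule wo_subset[of "{g}"]) (auto simp: wfp_on_iff_ex_minimal)
qed

instantiation hahn_series :: (linordered_ab_group_add, field) comm_ring_1
begin

lift_definition zero_hahn_series :: "('a, 'b) hahn_series" is "\<lambda>_. 0"
  by (simp add: wfp_on_iff_ex_minimal)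

definition one_hahn_series :: "('a, 'b) hahn_series" where
  "1 = monomial 1 0"

lift_definition plus_hahn_series ::
  "('a, 'b) hahn_series \<Rightarrow> ('a, 'b) hahn_series \<Rightarrow> ('a, 'b) hahn_series"
  is "\<lambda>f h g. f g + h g"
proof -
  fix f h :: "'a \<Rightarrow> 'b"
  assume "wfp_on {g. f g \<noteq> 0} (<)" "wfp_on {g. h g \<noteq> 0} (<)"
  from wo_Un[OF this] show "wfp_on {g. f g + h g \<noteq> 0} (<)"
    by (rule wo_subset) auto
qed

lift_definition uminus_hahn_series :: "('a, 'b) hahn_series \<Rightarrow> ('a, 'b) hahn_series"
  is "\<lambda>f g. - f g"
  by simp

lift_definition minus_hahn_series ::
  "('a, 'b) hahn_series \<Rightarrow> ('a, 'b) hahn_series \<Rightarrow> ('a, 'b) hahn_series"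
  is "\<lambda>f h g. f g - h g"
proof -
  fix f h :: "'a \<Rightarrow> 'b"
  assume "wfp_on {g. f g \<noteq> 0} (<)" "wfp_on {g. h g \<noteq> 0} (<)"
  from wo_Un[OF this] show "wfp_on {g. f g - h g \<noteq> 0} (<)"
    by (rule wo_subset) auto
qed

text \<open>The index set of the sum is finite, see \<open>wo_finite_fibre\<close>.\<close>

definition times_hahn_series ::
  "('a, 'b) hahn_series \<Rightarrow> ('a, 'b) hahn_series \<Rightarrow> ('a, 'b) hahn_series" where
  "f * h = Abs_hahn_series (\<lambda>g. \<Sum>a | a \<in> supp f \<and> g - a \<in> supp h.
    hcoeff f a * hcoeff h (g - a))"

lemma supp_times_aux:
  fixes f h :: "('a, 'b) hahn_series"
  shows "{g. (\<Sum>a | a \<in> supp f \<and> g - a \<in> supp h. hcoeff f a * hcoeff h (g - a)) \<noteq> 0}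
    \<subseteq> supp f + supp h"
proof
  fix g
  assume "g \<in> {g. (\<Sum>a | a \<in> supp f \<and> g - a \<in> supp h. hcoeff f a * hcoeff h (g - a)) \<noteq> 0}"
  then have "(\<Sum>a | a \<in> supp f \<and> g - a \<in> supp h. hcoeff f a * hcoeff h (g - a)) \<noteq> 0" by blast
  from sum.not_neutral_contains_not_neutral[OF this]
  obtain a where "a \<in> supp f" "g - a \<in> supp h" by blast
  then have "a + (g - a) \<in> supp f + supp h" by (rule set_plus_intro)
  moreover have "a + (g - a) = g" by (rule add_diff_eq[THEN trans]) (rule add_diff_cancel_left')
  ultimately show "g \<in> supp f + supp h" by (rule back_subst)
qed

lemma hcoeff_times_eq:
  "hcoeff (f * h :: ('a, 'b) hahn_series) g =
    (\<Sum>a | a \<in> supp f \<and> g - a \<in> supp h. hcoeff f a * hcoeff h (g - a))"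
  unfolding times_hahn_series_def
  by (subst hcoeff_Abs) (rule wo_subset[OF wo_sumset[OF supp_wo supp_wo] supp_times_aux], rule refl)

lemma supp_times: "supp (f * h :: ('a, 'b) hahn_series) \<subseteq> supp f + supp h"
  using supp_times_aux[of f h] by (simp add: supp_def[of "f * h"] hcoeff_times_eq)

lemma hcoeff_simps:
  "hcoeff (0 :: ('a, 'b) hahn_series) g = 0"
  "hcoeff (1 :: ('a, 'b) hahn_series) g = (if g = 0 then 1 else 0)"
  "hcoeff (f + h :: ('a, 'b) hahn_series) g = hcoeff f g + hcoeff h g"
  "hcoeff (f - h :: ('a, 'b) hahn_series) g = hcoeff f g - hcoeff h g"
  "hcoeff (- f :: ('a, 'b) hahn_series) g = - hcoeff f g"
  unfolding one_hahn_series_def zero_hahn_series.rep_eq monomial.rep_eq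
    plus_hahn_series.rep_eq minus_hahn_series.rep_eq uminus_hahn_series.rep_eq by (rule refl)+

lemma hcoeff_times:
  assumes "finite S" "{a \<in> supp f. g - a \<in> supp h} \<subseteq> S"
  shows "hcoeff (f * h :: ('a, 'b) hahn_series) g = (\<Sum>a\<in>S. hcoeff f a * hcoeff h (g - a))"
  unfolding hcoeff_times_eq
proof (rule sum.mono_neutral_left)
  show "finite S" by fact
  show "{a. a \<in> supp f \<and> g - a \<in> supp h} \<subseteq> S" by fact
  show "\<forall>a\<in>S - {a. a \<in> supp f \<and> g - a \<in> supp h}. hcoeff f a * hcoeff h (g - a) = 0"
    by (simp add: supp_def)
qed

lemma hcoeff_monomial_times:
  "hcoeff (monomial c b * f :: ('a, 'b) hahn_series) g = c * hcoeff f (g - b)"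
proof -
  have "{a \<in> supp (monomial c b). g - a \<in> supp f} \<subseteq> {b}"
    by (simp add: supp_def monomial.rep_eq subset_iff)
  then have "hcoeff (monomial c b * f) g = (\<Sum>a\<in>{b}. hcoeff (monomial c b) a * hcoeff f (g - a))"
    by (intro hcoeff_times) simp_all
  then show ?thesis by (simp add: monomial.rep_eq)
qed

lemma times_comm: "f * h = (h * f :: ('a, 'b) hahn_series)"
proof (rule hahn_eqI)
  fix g
  have "hcoeff (f * h) g = (\<Sum>a | a \<in> supp f \<and> g - a \<in> supp h. hcoeff f a * hcoeff h (g - a))"
    by (rule hcoeff_times) (use wo_finite_fibre[OF supp_wo supp_wo] in auto)
  also have "\<dots> = (\<Sum>b | b \<in> supp h \<and> g - b \<in> supp f. hcoeff h b * hcoeff f (g - b))"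
    by (rule sum.reindex_bij_witness[of _ "\<lambda>b. g - b" "\<lambda>b. g - b"]) (auto simp: mult.commute)
  also have "\<dots> = hcoeff (h * f) g"
    by (rule hcoeff_times[symmetric]) (use wo_finite_fibre[OF supp_wo supp_wo] in auto)
  finally show "hcoeff (f * h) g = hcoeff (h * f) g" .
qed

lemma times_assoc: "f * h * k = f * (h * k :: ('a, 'b) hahn_series)"
proof (rule hahn_eqI)
  fix x
  let ?f = "hcoeff f" and ?h = "hcoeff h" and ?k = "hcoeff k"
  have wo: "wfp_on (supp f + supp h) (<)" "wfp_on (supp h + supp k) (<)"
    by (intro wo_sumset supp_wo)+
  define D where "D = {d \<in> supp f + supp h. x - d \<in> supp k}"
  define A where "A = {a \<in> supp f. x - a \<in> supp h + supp k}"
  have fin: "finite D" "finite A"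
    unfolding A_def D_def by (intro wo_finite_fibre wo supp_wo)+
  have "hcoeff (f * h * k) x = (\<Sum>d\<in>D. hcoeff (f * h) d * ?k (x - d))"
    by (rule hcoeff_times[OF fin(1)]) (use supp_times in \<open>auto simp: D_def\<close>)
  also have "\<dots> = (\<Sum>d\<in>D. (\<Sum>a\<in>{a \<in> supp f. d - a \<in> supp h}. ?f a * ?h (d - a) * ?k (x - d)))"
    by (rule sum.cong[OF refl], subst hcoeff_times[OF wo_finite_fibre[OF supp_wo supp_wo] order_refl])
      (simp add: sum_distrib_right)
  also have "\<dots> = (\<Sum>(d, a)\<in>Sigma D (\<lambda>d. {a \<in> supp f. d - a \<in> supp h}).
      ?f a * ?h (d - a) * ?k (x - d))"
    by (rule sum.Sigma) (use fin wo_finite_fibre[OF supp_wo supp_wo] in auto)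
  also have "\<dots> = (\<Sum>(a, b)\<in>Sigma A (\<lambda>a. {b \<in> supp h. x - a - b \<in> supp k}).
      ?f a * (?h b * ?k (x - a - b)))"
  proof (rule sum.reindex_bij_witness[of _ "\<lambda>(a, b). (a + b, a)" "\<lambda>(d, a). (a, d - a)"])
    fix p assume "p \<in> Sigma A (\<lambda>a. {b \<in> supp h. x - a - b \<in> supp k})"
    then show "(case p of (a, b) \<Rightarrow> (a + b, a)) \<in> Sigma D (\<lambda>d. {a \<in> supp f. d - a \<in> supp h})"
      by (auto simp: A_def D_def diff_diff_eq intro: set_plus_intro)
  next
    fix p assume p: "p \<in> Sigma D (\<lambda>d. {a \<in> supp f. d - a \<in> supp h})"
    obtain d a where [simp]: "p = (d, a)" by (cases p)
    have "d - a \<in> supp h" "x - d \<in> supp k" "a \<in> supp f" using p by (auto simp: D_def)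
    from this set_plus_intro[OF this(1,2)]
    show "(case p of (d, a) \<Rightarrow> (a, d - a)) \<in> Sigma A (\<lambda>a. {b \<in> supp h. x - a - b \<in> supp k})"
      by (auto simp: A_def algebra_simps)
  qed (auto simp: algebra_simps)
  also have "\<dots> = (\<Sum>a\<in>A. (\<Sum>b\<in>{b \<in> supp h. x - a - b \<in> supp k}. ?f a * (?h b * ?k (x - a - b))))"
    by (rule sum.Sigma[symmetric]) (use fin wo_finite_fibre[OF supp_wo supp_wo] in auto)
  also have "\<dots> = (\<Sum>a\<in>A. ?f a * hcoeff (h * k) (x - a))"
    by (rule sum.cong[OF refl], subst hcoeff_times[OF wo_finite_fibre[OF supp_wo supp_wo] order_refl])
      (simp add: sum_distrib_left)
  also have "\<dots> = hcoeff (f * (h * k)) x"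
    by (rule hcoeff_times[symmetric, OF fin(2)]) (use supp_times in \<open>auto simp: A_def\<close>)
  finally show "hcoeff (f * h * k) x = hcoeff (f * (h * k)) x" .
qed

instance
proof
  fix f h k :: "('a, 'b) hahn_series"
  show "f * h * k = f * (h * k)" by (rule times_assoc)
  show "f * h = h * f" by (rule times_comm)
  show "1 * f = f"
    by (rule hahn_eqI) (simp add: one_hahn_series_def hcoeff_monomial_times)
  show "(f + h) * k = f * k + h * k"
  proof (rule hahn_eqI)
    fix g
    define S where "S = {a \<in> supp f \<union> supp h. g - a \<in> supp k}"
    have fin: "finite S"
      unfolding S_def by (intro wo_finite_fibre wo_Un supp_wo)
    have sub: "{a \<in> supp u. g - a \<in> supp k} \<subseteq> S" if "supp u \<subseteq> supp f \<union> supp h" for u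
      using that by (auto simp: S_def)
    have "supp (f + h) \<subseteq> supp f \<union> supp h"
      by (auto simp: supp_def hcoeff_simps)
    then show "hcoeff ((f + h) * k) g = hcoeff (f * k + h * k) g"
      by (simp add: hcoeff_simps hcoeff_times[OF fin sub] algebra_simps sum.distrib)
  qed
  show "(0 :: ('a, 'b) hahn_series) \<noteq> 1"
    by (metis hcoeff_simps(1,2) zero_neq_one)
qed (rule hahn_eqI, simp add: hcoeff_simps algebra_simps)+

end


subsection \<open>Inverses\<close>

text \<open>
  To invert \<open>f\<close>, take an end-extension-maximal \<open>g\<close> such that \<open>f * g\<close> agrees with \<open>1\<close> in all
  exponents up to \<open>v f + s\<close> for all \<open>s\<close> in the support of \<open>g\<close>.
\<close>

lemma supp_minimum:
  assumes "f \<noteq> 0"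
  obtains m where "m \<in> supp f" "\<forall>g\<in>supp f. m \<le> g"
proof -
  have "supp f \<noteq> {}"
  proof
    assume "supp f = {}"
    then have "f = 0" by (intro hahn_eqI) (auto simp: supp_def hcoeff_simps)
    then show False using assms by simp
  qed
  then obtain m where "m \<in> supp f" "\<forall>y. y < m \<longrightarrow> y \<notin> supp f"
    using supp_wo[of f] unfolding wfp_on_iff_ex_minimal by blast
  then show thesis using that[of m] by (meson not_le)
qed

lemma hahn_right_inverse:
  fixes f :: "('g::linordered_ab_group_add, 'k::field) hahn_series"
  assumes "f \<noteq> 0"
  shows "\<exists>g. f * g = 1"
proof -
  obtain v where v: "v \<in> supp f" "\<forall>g\<in>supp f. v \<le> g"
    by (rule supp_minimum[OF assms])
  define P :: "('g, 'k) hahn_series set" where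
    "P = {g. \<forall>s\<in>supp g. \<forall>y\<le>v + s. hcoeff (f * g) y = hcoeff 1 y}"
  define le :: "('g, 'k) hahn_series \<Rightarrow> ('g, 'k) hahn_series \<Rightarrow> bool" where
    "le g h \<longleftrightarrow> (\<forall>s\<in>supp g. \<forall>x\<le>s. hcoeff h x = hcoeff g x)" for g h
  have leD: "hcoeff h x = hcoeff g x" if "le g h" "s \<in> supp g" "x \<le> s" for g h s x
    using that unfolding le_def by blast
  have le_supp: "s \<in> supp h" if "le g h" "s \<in> supp g" for g h s
    using leD[OF that order_refl] that(2) by (simp add: supp_def)
  have times_cong: "hcoeff (f * g) y = hcoeff (f * h) y"
    if "\<And>x. x \<le> s \<Longrightarrow> hcoeff g x = hcoeff h x" "y \<le> v + s" for g h s y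
  proof -
    define S where "S = {a \<in> supp f. y - a \<in> supp g \<union> supp h}"
    have fin: "finite S" unfolding S_def by (intro wo_finite_fibre wo_Un supp_wo)
    have 1: "hcoeff (f * g) y = (\<Sum>a\<in>S. hcoeff f a * hcoeff g (y - a))"
      by (rule hcoeff_times[OF fin]) (auto simp: S_def)
    have 2: "hcoeff (f * h) y = (\<Sum>a\<in>S. hcoeff f a * hcoeff h (y - a))"
      by (rule hcoeff_times[OF fin]) (auto simp: S_def)
    have "hcoeff g (y - a) = hcoeff h (y - a)" if "a \<in> S" for a
    proof -
      have "v \<le> a" using that v(2) by (simp add: S_def)
      then have "y \<le> a + s" using \<open>y \<le> v + s\<close> by (meson add_right_mono order_trans)
      then have "y - a \<le> s" by (simp add: diff_le_eq add.commute)
      then show ?thesis using \<open>\<And>x. x \<le> s \<Longrightarrow> hcoeff g x = hcoeff h x\<close> by blast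
    qed
    then show ?thesis unfolding 1 2 by (intro sum.cong) simp_all
  qed
  have po: "partial_order_on P (relation_of le P)"
  proof (rule partial_order_on_relation_ofI)
    show "le g g" for g by (simp add: le_def)
    show "le g k" if "le g h" "le h k" for g h k
      unfolding le_def
    proof (intro ballI allI impI)
      fix s x assume "s \<in> supp g" "x \<le> s"
      then show "hcoeff k x = hcoeff g x"
        using leD[OF \<open>le g h\<close>, of s x] leD[OF \<open>le h k\<close>, of s x] le_supp[OF \<open>le g h\<close>, of s] by simp
    qed
    show "g = h" if "le g h" "le h g" for g h
    proof (rule hahn_eqI)
      fix x show "hcoeff g x = hcoeff h x"
      proof (cases "x \<in> supp g \<or> x \<in> supp h")
        case True
        then show ?thesis using leD[OF that(1) _ order_refl] leD[OF that(2) _ order_refl]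
          by metis
      next
        case False
        then show ?thesis by (simp add: supp_def)
      qed
    qed
  qed
  have ub: "\<exists>u\<in>P. \<forall>g\<in>C. le g u" if C: "C \<in> Chains (relation_of le P)" for C
  proof -
    have CP: "C \<subseteq> P"
      using Chains_relation_of[OF C] .
    have tot: "le g h \<or> le h g" if "g \<in> C" "h \<in> C" for g h
    proof -
      have "(g, h) \<in> relation_of le P \<or> (h, g) \<in> relation_of le P"
        using C that unfolding Chains_def by blast
      then show ?thesis unfolding relation_of_def by blast
    qed
    define u0 where "u0 x = (if \<exists>g\<in>C. hcoeff g x \<noteq> 0
      then hcoeff (SOME g. g \<in> C \<and> hcoeff g x \<noteq> 0) x else 0)" for x
    have u0: "u0 x = hcoeff g x" if g: "g \<in> C" and s: "s \<in> supp g" "x \<le> s" for g s x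
    proof (cases "\<exists>h\<in>C. hcoeff h x \<noteq> 0")
      case True
      define h where "h = (SOME h. h \<in> C \<and> hcoeff h x \<noteq> 0)"
      have h: "h \<in> C" "hcoeff h x \<noteq> 0"
        using someI_ex[of "\<lambda>h. h \<in> C \<and> hcoeff h x \<noteq> 0"] True unfolding h_def by blast+
      have "u0 x = hcoeff h x" using True by (simp add: u0_def h_def)
      moreover have "hcoeff h x = hcoeff g x"
        using tot[OF g h(1)]
      proof
        assume "le g h"
        then show ?thesis using leD s by blast
      next
        assume "le h g"
        moreover have "x \<in> supp h" using h(2) by (simp add: supp_def)
        ultimately show ?thesis using leD[of h g x x] by simp
      qed
      ultimately show ?thesis by simp
    next
      case False
      then show ?thesis using g by (auto simp: u0_def)
    qed
    have ex: "\<exists>g\<in>C. x \<in> supp g" if "u0 x \<noteq> 0" for x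
      using that by (auto simp: u0_def supp_def split: if_splits)
    have wo: "wfp_on {x. u0 x \<noteq> 0} (<)"
      unfolding wfp_on_iff_ex_minimal
    proof (intro allI impI)
      fix B assume B: "B \<subseteq> {x. u0 x \<noteq> 0}" "B \<noteq> {}"
      then obtain b where b: "b \<in> B" "u0 b \<noteq> 0" by blast
      obtain g where g: "g \<in> C" "b \<in> supp g" using ex[OF b(2)] by blast
      have "B \<inter> supp g \<subseteq> supp g" "B \<inter> supp g \<noteq> {}" using b g by auto
      then obtain m where m: "m \<in> B \<inter> supp g" "\<forall>y. y < m \<longrightarrow> y \<notin> B \<inter> supp g"
        using supp_wo[of g] unfolding wfp_on_iff_ex_minimal by metis
      have "y \<notin> B" if "y < m" for y
      proof
        assume "y \<in> B"
        then have "u0 y \<noteq> 0" using B(1) by blast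
        then have "y \<in> supp g" using u0[OF g(1), of m y] m(1) \<open>y < m\<close> by (simp add: supp_def)
        then show False using m(2) \<open>y \<in> B\<close> \<open>y < m\<close> by blast
      qed
      then show "\<exists>z\<in>B. \<forall>y. y < z \<longrightarrow> y \<notin> B" using m(1) by blast
    qed
    define u :: "('g, 'k) hahn_series" where "u = Abs_hahn_series u0"
    have u: "hcoeff u = u0" unfolding u_def by (rule hcoeff_Abs[OF wo])
    have "u \<in> P"
      unfolding P_def
    proof (intro CollectI ballI allI impI)
      fix s y assume s: "s \<in> supp u" "y \<le> v + s"
      then obtain g where g: "g \<in> C" "s \<in> supp g"
        using ex[of s] u by (auto simp: supp_def)
      have "hcoeff (f * u) y = hcoeff (f * g) y"
        by (rule times_cong[OF _ s(2)]) (use u0[OF g] u in simp)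
      also have "\<dots> = hcoeff 1 y" using g CP s(2) unfolding P_def by blast
      finally show "hcoeff (f * u) y = hcoeff 1 y" .
    qed
    moreover have "\<forall>g\<in>C. le g u" using u0 u by (simp add: le_def)
    ultimately show ?thesis by blast
  qed
  obtain g where g: "g \<in> P" and gmax: "\<And>h. h \<in> P \<Longrightarrow> le g h \<Longrightarrow> h = g"
    using predicate_Zorn[OF po ub] by blast
  have "f * g = 1"
  proof (rule ccontr)
    assume "f * g \<noteq> 1"
    then have "1 - f * g \<noteq> 0" by simp
    then obtain r where r: "r \<in> supp (1 - f * g)" "\<forall>x\<in>supp (1 - f * g). r \<le> x"
      by (rule supp_minimum)
    have below: "hcoeff (f * g) y = hcoeff 1 y" if "y < r" for y
    proof -
      have "y \<notin> supp (1 - f * g)" using r(2) that by (meson not_le)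
      then show ?thesis by (simp add: supp_def hcoeff_simps(4))
    qed
    have above: "v + s < r" if "s \<in> supp g" for s
    proof (rule ccontr)
      assume "\<not> v + s < r"
      then have "hcoeff (f * g) r = hcoeff 1 r" using g that unfolding P_def by auto
      then show False using r(1) by (simp add: supp_def hcoeff_simps(4))
    qed
    define q where "q = hcoeff (1 - f * g) r / hcoeff f v"
    have q: "q \<noteq> 0" "q * hcoeff f v = hcoeff (1 - f * g) r"
      using r(1) v(1) by (simp_all add: q_def supp_def)
    define h where "h = g + monomial q (r - v)"
    have hc: "hcoeff h x = hcoeff g x + (if x = r - v then q else 0)" for x
      by (simp add: h_def hcoeff_simps monomial.rep_eq)
    have below_g: "s < r - v" if "s \<in> supp g" for s
      using above[OF that] by (simp add: less_diff_eq add.commute)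
    have h_le: "le g h"
      unfolding le_def
    proof (intro ballI allI impI)
      fix s x assume "s \<in> supp g" "x \<le> s"
      then show "hcoeff h x = hcoeff g x" using below_g[of s] by (auto simp: hc)
    qed
    have fh: "hcoeff (f * h) y = hcoeff 1 y" if "y \<le> r" for y
    proof -
      have "f * h = f * g + monomial q (r - v) * f"
        by (simp add: h_def algebra_simps)
      then have *: "hcoeff (f * h) y = hcoeff (f * g) y + q * hcoeff f (y - (r - v))"
        by (simp add: hcoeff_simps hcoeff_monomial_times)
      show ?thesis
      proof (cases "y = r")
        case True
        then show ?thesis using * q(2) by (simp add: hcoeff_simps(4))
      next
        case False
        then have "y < r" using that by simp
        then have "y - (r - v) < v" by (simp add: algebra_simps)
        then have "y - (r - v) \<notin> supp f" using v(2) by (meson not_le)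
        then have "hcoeff f (y - (r - v)) = 0" by (simp add: supp_def)
        then show ?thesis using * below[OF \<open>y < r\<close>] by simp
      qed
    qed
    have "h \<in> P"
      unfolding P_def
    proof (intro CollectI ballI allI impI)
      fix s y assume s: "s \<in> supp h" and y: "y \<le> v + s"
      have "s \<in> supp g \<or> s = r - v" using s by (auto simp: supp_def hc split: if_splits)
      then have "s \<le> r - v" using below_g[of s] by auto
      then have "v + s \<le> r" by (simp add: le_diff_eq add.commute)
      then show "hcoeff (f * h) y = hcoeff 1 y" using fh[of y] y by (meson order_trans)
    qed
    then have "h = g" using gmax h_le by blast
    then show False using hc[of "r - v"] q(1) by simp
  qed
  then show ?thesis by blast
qed

instantiation hahn_series :: (linordered_ab_group_add, field) field
begin

definition inverse_hahn_series :: "('a, 'b) hahn_series \<Rightarrow> ('a, 'b) hahn_series" where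
  "inverse (f :: ('a, 'b) hahn_series) = (if f = 0 then 0 else (SOME g. f * g = 1))"

definition divide_hahn_series ::
  "('a, 'b) hahn_series \<Rightarrow> ('a, 'b) hahn_series \<Rightarrow> ('a, 'b) hahn_series" where
  "f div (g :: ('a, 'b) hahn_series) = f * inverse g"

instance
proof
  fix f g :: "('a, 'b) hahn_series"
  show "inverse f * f = 1" if "f \<noteq> 0"
    using someI_ex[OF hahn_right_inverse[OF that]] that
    by (simp add: inverse_hahn_series_def mult.commute)
  show "f div g = f * inverse g" by (rule divide_hahn_series_def)
  show "inverse (0 :: ('a, 'b) hahn_series) = 0" by (simp add: inverse_hahn_series_def)
qed

end


section \<open>The canonical valuation and its restrictions to subfields\<close>

text \<open>
  \<open>v 0 = \<infinity>\<close> is not represented: \<open>hval 0\<close> is a junk value, and the definitions below treat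
  \<open>0\<close> separately.
\<close>

definition hval :: "('g::linordered_ab_group_add, 'k::field) hahn_series \<Rightarrow> 'g" where
  "hval f = (LEAST g. g \<in> supp f)"

definition hval_ring :: "('g::linordered_ab_group_add, 'k::field) hahn_series set" where
  "hval_ring = {f. f = 0 \<or> 0 \<le> hval f}"

definition hval_ideal :: "('g::linordered_ab_group_add, 'k::field) hahn_series set" where
  "hval_ideal = {f. f = 0 \<or> 0 < hval f}"

definition value_group :: "('g::linordered_ab_group_add, 'k::field) hahn_series set \<Rightarrow> 'g set" where
  "value_group L = hval ` (L - {0})"

text \<open>The residue map of \<open>k((G))\<close> is \<open>f \<mapsto> hcoeff f 0\<close>.\<close>

definition residue_field :: "('g::linordered_ab_group_add, 'k::field) hahn_series set \<Rightarrow> 'k set" where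
  "residue_field L = (\<lambda>f. hcoeff f 0) ` (L \<inter> hval_ring)"

text \<open>Hensel's Lemma for \<open>L\<close> with the restriction of the canonical valuation.\<close>

definition henselian :: "('g::linordered_ab_group_add, 'k::field) hahn_series set \<Rightarrow> bool" where
  "henselian L \<longleftrightarrow>
    (\<forall>p a. (\<forall>i. Polynomial.coeff p i \<in> L \<inter> hval_ring) \<longrightarrow> a \<in> L \<inter> hval_ring \<longrightarrow>
      poly p a \<in> hval_ideal \<longrightarrow> poly (pderiv p) a \<notin> hval_ideal \<longrightarrow>
      (\<exists>b \<in> L \<inter> hval_ring. poly p b = 0 \<and> b - a \<in> hval_ideal))"

text \<open>
  The henselization of \<open>L\<close> is its minimal henselian extension, taken here inside the henselian
  field \<open>k((G))\<close>: it embeds over \<open>L\<close> into every henselian subfield of \<open>k((G))\<close> containing \<open>L\<close>, and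
  by uniqueness of the embedding into \<open>k((G))\<close> it is contained in all of them.
\<close>

definition henselization :: "('g::linordered_ab_group_add, 'k::field) hahn_series set
    \<Rightarrow> ('g, 'k) hahn_series set" where
  "henselization L = \<Inter>{F. subfield F ring_of_type_algebra \<and> henselian F \<and> L \<subseteq> F}"

definition adjoin :: "'a::field set \<Rightarrow> 'a set \<Rightarrow> 'a set" where
  "adjoin L S = generate_field ring_of_type_algebra (L \<union> S)"

definition implicit_constant_field :: "('g::linordered_ab_group_add, 'k::field) hahn_series set
    \<Rightarrow> ('g, 'k) hahn_series \<Rightarrow> ('g, 'k) hahn_series set" where
  "implicit_constant_field K z =
    {x \<in> henselization (adjoin K {z}). \<not> ring.transcendental ring_of_type_algebra K x}"

text \<open>
  \<open>c\<close> is algebraic over the subfield \<open>F\<close>, and its minimal polynomial \<open>p\<close> over \<open>F\<close> has only simple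
  roots in an algebraic closure.
\<close>

definition separable_algebraic :: "'a::field set \<Rightarrow> 'a \<Rightarrow> bool" where
  "separable_algebraic F c \<longleftrightarrow>
    (\<exists>p. Polynomial.lead_coeff p = 1 \<and> (\<forall>i. Polynomial.coeff p i \<in> F) \<and> poly p c = 0 \<and>
      (\<forall>q. q \<noteq> 0 \<and> (\<forall>i. Polynomial.coeff q i \<in> F) \<and> poly q c = 0 \<longrightarrow>
        Polynomial.degree p \<le> Polynomial.degree q) \<and>
      rsquarefree (map_poly to_ac p))"

end

theory Submission
  imports Defs
begin

text \<open>
  Embed \<open>k((G))\<close> in its algebraic closure \<open>\<Omega>\<close> and fix there a valuation ring \<open>V\<close> extending the one of
  \<open>k((G))\<close>. The terms \<open>x\<^sub>i = c\<^sub>i t^\<gamma>\<^sub>i\<close> are rigid: each is a simple root of a polynomial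
  over \<open>K\<close> no other root \<open>x'\<close> of which is as close to \<open>x\<^sub>i\<close> as \<open>\<bar>x' - x\<^sub>i\<bar> < \<bar>x\<^sub>i\<bar>\<close>. In a henselian field
  \<open>F \<supseteq> K(z)\<close>, where conjugates have the same absolute value, Krasner's Lemma applied successively to the
  approximations \<open>z - x\<^sub>0 - \<dots> - x\<^sub>i\<^sub>-\<^sub>1\<close> of \<open>x\<^sub>i\<close> shows that all \<open>x\<^sub>i\<close> lie in \<open>F\<close>. For values and
  residues in \<open>K(z)\<close> itself, the minimal polynomial over \<open>K\<close> of the partial sum \<open>s\<^sub>n = x\<^sub>0 + \<dots> + x\<^sub>n\<^sub>-\<^sub>1\<close> is
  evaluated at \<open>z\<close>: its leading term is that of \<open>x\<^sub>n\<close> times that of the derivative at \<open>s\<^sub>n\<close>.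

  If the value group or the residue field extension is infinite, no finite extension of \<open>K\<close> contains
  all \<open>x\<^sub>i\<close>. By Krasner's Lemma again, no algebraic \<open>a\<close> satisfies \<open>\<bar>a - s\<^sub>n\<bar> \<le> \<bar>z - s\<^sub>n\<bar>\<close> for all \<open>n\<close>, so
  for every polynomial \<open>f \<noteq> 0\<close> with algebraic coefficients \<open>f(z)\<close> and \<open>f(s\<^sub>n)\<close> have the same leading term
  for large \<open>n\<close>. This gives transcendence, the value group and the residue field. For the implicit constant
  field, let \<open>L = K(x\<^sub>i | i)\<close> and let \<open>y \<notin> L\<close> be algebraic over \<open>K\<close>. If \<open>y\<close> is separable over \<open>L\<close>, then
  replacing it by a conjugate \<open>y'\<close> is an isometry over \<open>L(z)\<close>, since it is one over \<open>L\<close> and \<open>z\<close> can be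
  replaced by \<open>s\<^sub>n \<in> L\<close>. A maximal field over which this still holds is henselian, and it does not contain \<open>y\<close>. The
  inseparable case is similar, with a maximal field not containing \<open>y\<close>. Hence \<open>y\<close> is not in the henselization
  of \<open>K(z)\<close>.
\<close>

section \<open>Subfields and polynomials over them\<close>

text \<open>The henselization enters as an intersection, so membership is proved in an arbitrary
  henselian field \<open>F\<close>, while exclusion needs one henselian field omitting the given
  element; this is why maximal fields take the place of Galois theory. \<open>henselian\<close>
  speaks of approximate roots, whereas Krasner's Lemma needs conjugates of equal absolute value; the
  bridge from \<open>hens\<close> to \<open>uni\<close> isolates a strictly dominant conjugate. Both
  tameness assumptions serve rigidity: with \<open>e\<close> a unit, 1 is the only root of
  \<open>Y^e - 1\<close> in its residue class, and separability does the same for \<open>c^e\<close>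
  as a root of its polynomial over the constants. The field \<open>K(z)\<close> itself need not be
  henselian and need not contain the partial sums, so Krasner's Lemma gives nothing there; leading
  terms do survive, and they carry values and residues together, which matters because
  \<open>c_i\<close> alone need not be a residue when \<open>\<gamma>_i\<close> is outside
  \<open>vK\<close>. In the infinite case a single algebraic element would have to generate all
  terms, against finiteness of value cosets and of residue degree in a finite extension.\<close>

locale subfld =
  fixes F :: "'a::field set"
  assumes one [simp, intro]: "1 \<in> F"
    and diff [simp, intro]: "x \<in> F \<Longrightarrow> y \<in> F \<Longrightarrow> x - y \<in> F"
    and mult [simp, intro]: "x \<in> F \<Longrightarrow> y \<in> F \<Longrightarrow> x * y \<in> F"
    and inv [simp, intro]: "x \<in> F \<Longrightarrow> inverse x \<in> F"
begin

lemma zero [simp, intro]: "0 \<in> F"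
  using diff[OF one one] by simp

lemma uminus [simp, intro]: "x \<in> F \<Longrightarrow> - x \<in> F"
  using diff[OF zero, of x] by simp

lemma add [simp, intro]: "x \<in> F \<Longrightarrow> y \<in> F \<Longrightarrow> x + y \<in> F"
  using diff[of x "- y"] by simp

lemma divide [simp, intro]: "x \<in> F \<Longrightarrow> y \<in> F \<Longrightarrow> x / y \<in> F"
  by (simp add: field_class.field_divide_inverse)

lemma power [simp, intro]: "x \<in> F \<Longrightarrow> x ^ n \<in> F"
  by (induction n) auto

lemma sum [intro]: "(\<And>i. i \<in> A \<Longrightarrow> f i \<in> F) \<Longrightarrow> sum f A \<in> F"
  by (induction A rule: infinite_finite_induct) auto

lemma prod [intro]: "(\<And>i. i \<in> A \<Longrightarrow> f i \<in> F) \<Longrightarrow> prod f A \<in> F"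
  by (induction A rule: infinite_finite_induct) auto

lemma of_nat [simp, intro]: "of_nat n \<in> F"
  by (induction n) auto

end

lemma subfld_Union_chain:
  assumes "C \<noteq> {}" "\<And>F. F \<in> C \<Longrightarrow> subfld F" "\<And>F G. F \<in> C \<Longrightarrow> G \<in> C \<Longrightarrow> F \<subseteq> G \<or> G \<subseteq> F"
  shows "subfld (\<Union>C)"
proof
  show "1 \<in> \<Union>C" using assms(1,2) subfld.one by blast
  fix x y assume "x \<in> \<Union>C" "y \<in> \<Union>C"
  then obtain F where "F \<in> C" "x \<in> F" "y \<in> F" using assms(3) by blast
  then show "x - y \<in> \<Union>C" "x * y \<in> \<Union>C"
    using assms(2) subfld.diff subfld.mult by blast+
next
  show "inverse x \<in> \<Union>C" if "x \<in> \<Union>C" for x using that assms(2) subfld.inv by blast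
qed

definition polys :: "'a::field set \<Rightarrow> 'a poly set" where
  "polys F = {p. \<forall>i. coeff p i \<in> F}"

lemma polysI: "(\<And>i. coeff p i \<in> F) \<Longrightarrow> p \<in> polys F"
  and polysD: "p \<in> polys F \<Longrightarrow> coeff p i \<in> F"
  by (auto simp: polys_def)

lemma polys_mono: "F \<subseteq> G \<Longrightarrow> polys F \<subseteq> polys G"
  by (auto simp: polys_def)

text \<open>Each of the finitely many coefficients lies in some member of the chain, and the largest
  of these members serves for all; this passes conditions on polynomials to unions in Zorn's
  Lemma.\<close>

lemma polys_Union_chain:
  assumes "C \<noteq> {}" "\<And>F G. F \<in> C \<Longrightarrow> G \<in> C \<Longrightarrow> F \<subseteq> G \<or> G \<subseteq> F" "p \<in> polys (\<Union>C)"
    "\<And>F. F \<in> C \<Longrightarrow> 0 \<in> F"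
  shows "\<exists>F\<in>C. p \<in> polys F"
  using assms(3)
proof (induction p)
  case 0
  then show ?case using assms(1,4) by (auto simp: polys_def)
next
  case (pCons a p)
  have "p \<in> polys (\<Union>C)"
    using polysD[OF pCons.prems, of "Suc _"] by (auto intro: polysI)
  then obtain F where F: "F \<in> C" "p \<in> polys F" using pCons.IH by blast
  obtain G where G: "G \<in> C" "a \<in> G" using polysD[OF pCons.prems, of 0] by auto
  obtain M where "M \<in> C" "F \<subseteq> M" "G \<subseteq> M" using assms(2)[OF F(1) G(1)] F(1) G(1) by blast
  then show ?case using F G by (intro bexI[of _ M]) (auto simp: polys_def coeff_pCons split: nat.splits)
qed

context subfld
begin

lemma polys_0 [simp, intro]: "0 \<in> polys F"
  and polys_1 [simp, intro]: "1 \<in> polys F"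
  by (auto simp: polys_def one_pCons coeff_pCons split: nat.splits)

lemma polys_pCons [simp]: "pCons a p \<in> polys F \<longleftrightarrow> a \<in> F \<and> p \<in> polys F"
proof
  assume "pCons a p \<in> polys F"
  then show "a \<in> F \<and> p \<in> polys F"
    using polysD[of "pCons a p" F 0] polysD[of "pCons a p" F "Suc _"] by (auto intro: polysI)
qed (auto simp: polys_def coeff_pCons split: nat.splits)

lemma polys_add [simp, intro]: "p \<in> polys F \<Longrightarrow> q \<in> polys F \<Longrightarrow> p + q \<in> polys F"
  and polys_diff [simp, intro]: "p \<in> polys F \<Longrightarrow> q \<in> polys F \<Longrightarrow> p - q \<in> polys F"
  and polys_uminus [simp, intro]: "p \<in> polys F \<Longrightarrow> - p \<in> polys F"
  and polys_smult [simp, intro]: "a \<in> F \<Longrightarrow> p \<in> polys F \<Longrightarrow> Polynomial.smult a p \<in> polys F"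
  and polys_monom [simp, intro]: "a \<in> F \<Longrightarrow> Polynomial.monom a n \<in> polys F"
  by (auto simp: polys_def)

lemma polys_mult [simp, intro]: "p \<in> polys F \<Longrightarrow> q \<in> polys F \<Longrightarrow> p * q \<in> polys F"
  by (auto simp: polys_def coeff_mult intro!: sum)

lemma polys_sum [intro]: "(\<And>i. i \<in> A \<Longrightarrow> f i \<in> polys F) \<Longrightarrow> sum f A \<in> polys F"
  by (induction A rule: infinite_finite_induct) auto

lemma polys_pderiv [simp, intro]: "p \<in> polys F \<Longrightarrow> pderiv p \<in> polys F"
  by (auto simp: polys_def coeff_pderiv simp del: of_nat_Suc)

lemma polys_pcompose [simp, intro]: "p \<in> polys F \<Longrightarrow> q \<in> polys F \<Longrightarrow> pcompose p q \<in> polys F"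
  by (induction p) (auto simp: pcompose_pCons)

lemma poly_closed [simp, intro]: "p \<in> polys F \<Longrightarrow> x \<in> F \<Longrightarrow> poly p x \<in> F"
  by (induction p) auto

text \<open>Long division performed inside \<open>F\<close>. Since quotient and remainder are
  unique, the ambient \<open>div\<close> and \<open>mod\<close> must then also have coefficients in
  \<open>F\<close>.\<close>

lemma polys_divmod_exists:
  assumes "f \<in> polys F" "g \<in> polys F" "g \<noteq> 0"
  shows "\<exists>q\<in>polys F. \<exists>r\<in>polys F. f = q * g + r \<and> (r = 0 \<or> degree r < degree g)"
  using assms(1)
\<comment> \<open>The zero polynomial and nonzero constants both have \<open>degree\<close> 0; the
  measure separates them, so that cancelling a constant to 0 counts as progress.\<close>
proof (induction "if f = 0 then 0 else Suc (degree f)" arbitrary: f rule: less_induct)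
  case less
  show ?case
  proof (cases "f = 0 \<or> degree f < degree g")
    case True
    then show ?thesis using less.prems by (intro bexI[of _ 0] bexI[of _ f]) auto
  next
    case False
    define m where "m = Polynomial.monom (lead_coeff f / lead_coeff g) (degree f - degree g)"
    have m: "m \<in> polys F" using less.prems assms(2) by (auto simp: m_def polysD)
    have deg: "degree (m * g) = degree f"
    proof -
      have "lead_coeff f / lead_coeff g \<noteq> 0" using False assms(3) by simp
      then have "m \<noteq> 0" "degree m = degree f - degree g"
        unfolding m_def by (simp add: monom_eq_0_iff, rule degree_monom_eq)
      then show ?thesis using False assms(3) by (simp add: degree_mult_eq)
    qed
    have "lead_coeff m = lead_coeff f / lead_coeff g"
      using False assms(3) degree_monom_eq[of "lead_coeff f / lead_coeff g" "degree f - degree g"]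
      by (simp add: m_def)
    then have "lead_coeff (m * g) = lead_coeff f"
      unfolding lead_coeff_mult using assms(3) by simp
    note deg = deg this[unfolded deg]
    have "f - m * g = 0 \<or> degree (f - m * g) < degree f"
    proof (rule disjCI)
      assume *: "\<not> degree (f - m * g) < degree f"
      have "degree (f - m * g) \<le> degree f" by (rule degree_diff_le) (use deg in auto)
      then have **: "degree (f - m * g) = degree f" using * by simp
      have "coeff (f - m * g) (degree f) = 0" using deg by simp
      then show "f - m * g = 0" using ** by (metis leading_coeff_0_iff)
    qed
    then have "(if f - m * g = 0 then 0 else Suc (degree (f - m * g))) < (if f = 0 then 0 else Suc (degree f))"
      using False by auto
    from less.hyps[OF this] obtain q r where
      "q \<in> polys F" "r \<in> polys F" "f - m * g = q * g + r" "r = 0 \<or> degree r < degree g"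
      using less.prems m assms(2) by blast
    then show ?thesis using m
      by (intro bexI[of _ "q + m"] bexI[of _ r]) (auto simp: algebra_simps)
  qed
qed

lemma polys_div [simp, intro]: "f \<in> polys F \<Longrightarrow> g \<in> polys F \<Longrightarrow> f div g \<in> polys F"
  and polys_mod [simp, intro]: "f \<in> polys F \<Longrightarrow> g \<in> polys F \<Longrightarrow> f mod g \<in> polys F"
proof -
  have "f div g \<in> polys F \<and> f mod g \<in> polys F" if fg: "f \<in> polys F" "g \<in> polys F"
  proof (cases "g = 0")
    case False
    obtain q r where qr: "q \<in> polys F" "r \<in> polys F" "f = q * g + r" "r = 0 \<or> degree r < degree g"
      using polys_divmod_exists[OF fg False] by blast
    have "f div g = q" "f mod g = r"
      using qr(3,4) False by (auto simp: div_poly_less mod_poly_less)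
    then show ?thesis using qr by simp
  qed (use fg in auto)
  then show "f \<in> polys F \<Longrightarrow> g \<in> polys F \<Longrightarrow> f div g \<in> polys F"
    "f \<in> polys F \<Longrightarrow> g \<in> polys F \<Longrightarrow> f mod g \<in> polys F" by auto
qed

end

definition alg :: "'a::field set \<Rightarrow> 'a \<Rightarrow> bool" where
  "alg F x \<longleftrightarrow> (\<exists>p\<in>polys F. p \<noteq> 0 \<and> poly p x = 0)"

definition minp :: "'a::field set \<Rightarrow> 'a \<Rightarrow> 'a poly \<Rightarrow> bool" where
  "minp F x q \<longleftrightarrow> q \<in> polys F \<and> lead_coeff q = 1 \<and> poly q x = 0 \<and>
    (\<forall>g\<in>polys F. poly g x = 0 \<longrightarrow> g \<noteq> 0 \<longrightarrow> degree q \<le> degree g)"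

text \<open>Specialization from \<open>x\<close> to \<open>y\<close> over \<open>F\<close>. For
  algebraic \<open>x\<close> this is the usual symmetric conjugacy, and it needs no choice of a
  minimal polynomial.\<close>

definition conj :: "'a::field set \<Rightarrow> 'a \<Rightarrow> 'a \<Rightarrow> bool" where
  "conj F x y \<longleftrightarrow> (\<forall>g\<in>polys F. poly g x = 0 \<longrightarrow> poly g y = 0)"

text \<open>The ring \<open>F[x]\<close>; it is a field only for algebraic \<open>x\<close>.\<close>

definition sext :: "'a::field set \<Rightarrow> 'a \<Rightarrow> 'a set" where
  "sext F x = (\<lambda>g. poly g x) ` polys F"

definition sep :: "'a::field set \<Rightarrow> 'a \<Rightarrow> bool" where
  "sep F x \<longleftrightarrow> (\<exists>p\<in>polys F. poly p x = 0 \<and> poly (pderiv p) x \<noteq> 0)"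

lemma minpD:
  assumes "minp F x q"
  shows "q \<in> polys F" "lead_coeff q = 1" "poly q x = 0" "q \<noteq> 0"
    "\<And>g. g \<in> polys F \<Longrightarrow> poly g x = 0 \<Longrightarrow> g \<noteq> 0 \<Longrightarrow> degree q \<le> degree g"
  using assms by (auto simp: minp_def)

lemma alg_mono: "F \<subseteq> G \<Longrightarrow> alg F x \<Longrightarrow> alg G x"
  using polys_mono unfolding alg_def by blast

lemma conj_mono: "F \<subseteq> G \<Longrightarrow> conj G x y \<Longrightarrow> conj F x y"
  using polys_mono unfolding conj_def by blast

lemma sep_mono: "F \<subseteq> G \<Longrightarrow> sep F x \<Longrightarrow> sep G x"
  using polys_mono unfolding sep_def by blast

lemma sep_alg: "sep F x \<Longrightarrow> alg F x"
  unfolding sep_def alg_def by (metis pderiv_0 poly_0)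

context subfld
begin

lemma alg_mem: "x \<in> F \<Longrightarrow> alg F x"
  unfolding alg_def by (intro bexI[of _ "[:-x, 1:]"]) auto

lemma minp_exists:
  assumes "alg F x"
  obtains q where "minp F x q"
proof -
  obtain p where p: "p \<in> polys F" "p \<noteq> 0" "poly p x = 0"
    and min: "\<And>g. g \<in> polys F \<Longrightarrow> g \<noteq> 0 \<Longrightarrow> poly g x = 0 \<Longrightarrow> degree p \<le> degree g"
    using ex_has_least_nat[of "\<lambda>p. p \<in> polys F \<and> p \<noteq> 0 \<and> poly p x = 0" _ degree] assms
    unfolding alg_def by metis
  define q where "q = Polynomial.smult (inverse (lead_coeff p)) p"
  have "minp F x q"
    using p min unfolding minp_def q_def by (auto simp: polysD)
  then show thesis by (rule that)
qed

lemma minp_dvd: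
  assumes "minp F x q" "g \<in> polys F" "poly g x = 0"
  shows "q dvd g"
proof -
  note q = minpD[OF assms(1)]
  have "poly (g mod q) x = 0" using assms(3) q(3) by (simp add: poly_mod)
  moreover have "g mod q \<in> polys F" using assms(2) q(1) by simp
  moreover have "g mod q = 0 \<or> degree (g mod q) < degree q" using degree_mod_less[OF q(4)] .
  ultimately have "g mod q = 0" using q(5)[of "g mod q"] by fastforce
  then show ?thesis by (simp add: dvd_eq_mod_eq_0)
qed

lemma minp_degree_pos:
  assumes "minp F x q" shows "degree q > 0"
proof (rule ccontr)
  assume "\<not> ?thesis"
  then obtain a where "q = [:a:]" by (metis degree_eq_zeroE gr0I)
  then show False using minpD(2,3)[OF assms] by simp
qed

text \<open>Irreducibility of \<open>q\<close> in disguise. If \<open>q = q' * h\<close> with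
  \<open>q'\<close> minimal for \<open>y\<close>, then \<open>h\<close> has too small a degree to
  vanish at \<open>x\<close>, so \<open>q'\<close> does, and \<open>q'\<close> has full
  degree.\<close>

lemma minp_root:
  assumes q: "minp F x q" and y: "poly q y = 0"
  shows "minp F y q"
proof -
  note qD = minpD[OF q]
  have "alg F y" using qD y unfolding alg_def by blast
  then obtain q' where q': "minp F y q'" by (rule minp_exists)
  note q'D = minpD[OF q']
  obtain h where h: "q = q' * h" using minp_dvd[OF q' qD(1) y] by (auto simp: dvd_def)
  have [simp]: "q \<noteq> 0" "q' \<noteq> 0" "h \<noteq> 0" using qD(4) h by auto
  have hF: "h \<in> polys F"
  proof -
    have "h = q div q'" using h by simp
    then show ?thesis using qD(1) q'D(1) by simp
  qed
  have "degree h < degree q" using h minp_degree_pos[OF q'] by (simp add: degree_mult_eq)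
  then have "poly h x \<noteq> 0" using qD(5)[OF hF] by fastforce
  then have "poly q' x = 0" using qD(3) h by simp
  then have "degree q \<le> degree q'" using qD(5)[OF q'D(1)] by simp
  then have "degree q \<le> degree g" if "g \<in> polys F" "poly g y = 0" "g \<noteq> 0" for g
    using q'D(5)[OF that] by simp
  then show ?thesis using qD(1,2) y unfolding minp_def by blast
qed

lemma minp_conj_iff:
  assumes "minp F x q" shows "conj F x y \<longleftrightarrow> poly q y = 0"
proof
  show "poly q y = 0" if "conj F x y" using that minpD[OF assms] by (auto simp: conj_def)
  show "conj F x y" if "poly q y = 0"
    using minp_dvd[OF assms] that unfolding conj_def by (metis dvd_trans poly_eq_0_iff_dvd)
qed

lemma conj_sym:
  assumes "alg F x" "conj F x y" shows "conj F y x"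
proof -
  obtain q where q: "minp F x q" using minp_exists[OF assms(1)] .
  then have "minp F y q" using assms(2) minp_root minp_conj_iff by blast
  then show ?thesis using minp_conj_iff[of y q x] minpD(3)[OF q] by simp
qed

lemma conj_alg: "alg F x \<Longrightarrow> conj F x y \<Longrightarrow> alg F y"
  unfolding alg_def conj_def by blast

lemma minp_coprime:
  assumes q: "minp F x q" and g: "g \<in> polys F" "poly g x \<noteq> 0" and y: "poly q y = 0"
  shows "poly g y \<noteq> 0"
proof -
  have "alg F x" using minpD[OF q] unfolding alg_def by blast
  then have "conj F y x" using conj_sym minp_conj_iff[OF q] y by blast
  then show ?thesis using g unfolding conj_def by blast
qed

lemma sep_iff_minp:
  assumes q: "minp F x q" shows "sep F x \<longleftrightarrow> poly (pderiv q) x \<noteq> 0"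
proof
  assume "sep F x"
  then obtain p where p: "p \<in> polys F" "poly p x = 0" "poly (pderiv p) x \<noteq> 0" by (auto simp: sep_def)
  obtain h where "p = q * h" using minp_dvd[OF q p(1,2)] by (auto simp: dvd_def)
  then show "poly (pderiv q) x \<noteq> 0" using p minpD(3)[OF q] by (auto simp: pderiv_mult)
qed (use minpD[OF q] in \<open>auto simp: sep_def\<close>)

lemma minp_pderiv_zero:
  assumes q: "minp F x q" "\<not> sep F x" shows "pderiv q = 0"
proof (rule ccontr)
  assume "pderiv q \<noteq> 0"
  moreover have "poly (pderiv q) x = 0" "pderiv q \<in> polys F" using q(2) sep_iff_minp[OF q(1)] minpD(1)[OF q(1)] by auto
  moreover have "degree (pderiv q) < degree q"
  proof (rule le_less_trans[OF degree_le])
    show "\<forall>i>degree q - 1. coeff (pderiv q) i = 0" by (simp add: coeff_pderiv coeff_eq_0)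
  qed (use minp_degree_pos[OF q(1)] in simp)
  ultimately show False using minpD(5)[OF q(1), of "pderiv q"] by linarith
qed

lemma minp_degree_1:
  assumes q: "minp F x q" "degree q = 1" shows "x \<in> F"
proof -
  obtain a b where "q = [:a, b:]" using q(2) degree1_coeffs by metis
  then have q1: "q = [:a, 1:]" "a \<in> F" using minpD(1,2)[OF q(1)] q(2) by (auto split: if_splits)
  then have "x = - a" using minpD(3)[OF q(1)] by (simp add: eq_neg_iff_add_eq_0 add.commute)
  then show ?thesis using \<open>a \<in> F\<close> by simp
qed

lemma sext_incl: "F \<subseteq> sext F x"
proof
  fix a assume "a \<in> F"
  then show "a \<in> sext F x" unfolding sext_def by (intro image_eqI[of _ _ "[:a:]"]) auto
qed

lemma sext_gen: "x \<in> sext F x"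
  unfolding sext_def by (intro image_eqI[of _ _ "[:0, 1:]"]) auto

lemma sext_minimal:
  assumes "subfld E" "F \<subseteq> E" "x \<in> E" shows "sext F x \<subseteq> E"
  using polys_mono[OF assms(2)] subfld.poly_closed[OF assms(1) _ assms(3)] unfolding sext_def by blast

lemma sext_reduced:
  assumes q: "minp F x q" and u: "u \<in> sext F x"
  obtains g where "g \<in> polys F" "u = poly g x" "degree g < degree q"
proof -
  obtain h where h: "h \<in> polys F" "u = poly h x" using u by (auto simp: sext_def)
  have "poly (h mod q) x = u" using h minpD(3)[OF q] by (simp add: poly_mod)
  moreover have "degree (h mod q) < degree q"
    using degree_mod_less[of q h] minp_degree_pos[OF q] by (cases "h mod q = 0") (use minpD(4)[OF q] in auto)
  ultimately show thesis using that[of "h mod q"] h(1) minpD(1)[OF q] by auto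
qed

end

subsection \<open>Comparison with the subfields of HOL-Algebra\<close>

lemma ring_of_type_algebra_sel [simp]:
  "carrier ring_of_type_algebra = UNIV"
  "x \<otimes>\<^bsub>ring_of_type_algebra\<^esub> y = x * y"
  "x \<oplus>\<^bsub>ring_of_type_algebra\<^esub> y = x + y"
  "\<one>\<^bsub>ring_of_type_algebra\<^esub> = 1"
  "\<zero>\<^bsub>ring_of_type_algebra\<^esub> = 0"
  by (simp_all add: ring_of_type_algebra_def)

lemma ring_of_type_algebra_uminus [simp]:
  "\<ominus>\<^bsub>ring_of_type_algebra\<^esub> x = - (x :: 'a::field)"
proof -
  interpret R: field "ring_of_type_algebra :: 'a ring" by (rule field_from_type_algebra)
  show ?thesis by (rule R.minus_equality) simp_all
qed

lemma ring_of_type_algebra_inv [simp]: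
  assumes "x \<noteq> 0" shows "inv\<^bsub>ring_of_type_algebra\<^esub> x = inverse (x :: 'a::field)"
proof -
  interpret R: field "ring_of_type_algebra :: 'a ring" by (rule field_from_type_algebra)
  show ?thesis using assms by (intro R.comm_inv_char) simp_all
qed

lemma subfield_iff_subfld: "subfield F ring_of_type_algebra \<longleftrightarrow> subfld (F :: 'a::field set)"
proof -
  interpret R: field "ring_of_type_algebra :: 'a ring" by (rule field_from_type_algebra)
  show ?thesis
  proof
    assume F: "subfield F ring_of_type_algebra"
    note sr = subfieldE(1)[OF F]
    have *: "inverse x \<in> F" if "x \<in> F" for x
      using R.subfield_m_inv(1)[OF F, of x] that subringE(2)[OF sr] by (cases "x = 0") auto
    have "x - y \<in> F" if "x \<in> F" "y \<in> F" for x y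
      using subringE(7)[OF sr that(1), of "- y"] subringE(5)[OF sr that(2)] by simp
    then show "subfld F" using * subringE(3,6)[OF sr] by unfold_locales auto
  next
    assume "subfld F"
    then interpret subfld F .
    show "subfield F ring_of_type_algebra"
      by (intro R.subfieldI' R.subringI) auto
  qed
qed

lemma subfld_adjoin: "subfld (adjoin F S)"
  and adjoin_incl: "F \<union> S \<subseteq> adjoin F S"
  and adjoin_minimal: "subfld E \<Longrightarrow> F \<subseteq> E \<Longrightarrow> S \<subseteq> E \<Longrightarrow> adjoin F S \<subseteq> E"
proof -
  interpret R: field "ring_of_type_algebra :: 'a ring" by (rule field_from_type_algebra)
  show "subfld (adjoin F S)" "F \<union> S \<subseteq> adjoin F S"
    using R.generate_field_is_subfield[of "F \<union> S"] R.generate_fieldE(2)[of "F \<union> S"]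
    unfolding adjoin_def subfield_iff_subfld by simp_all
  show "subfld E \<Longrightarrow> F \<subseteq> E \<Longrightarrow> S \<subseteq> E \<Longrightarrow> adjoin F S \<subseteq> E"
    using R.generate_field_min_subfield1[of "F \<union> S" E] unfolding adjoin_def subfield_iff_subfld by simp
qed

context subfld
begin

interpretation R: field "ring_of_type_algebra :: 'a ring" by (rule field_from_type_algebra)

lemma eval_ring_of_type_algebra: "R.eval p x = poly (Poly (rev p)) x"
proof -
  have "x [^]\<^bsub>ring_of_type_algebra\<^esub> n = x ^ n" for n :: nat
    by (induction n) (auto simp: mult.commute)
  then show ?thesis
    by (induction p) (auto simp: Poly_append poly_monom)
qed

lemma transcendental_iff: "ring.transcendental ring_of_type_algebra F x \<longleftrightarrow> \<not> alg F x"
proof -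
  have F: "subring F ring_of_type_algebra"
    using subfld_axioms by (simp add: subfieldE(1) flip: subfield_iff_subfld)
  show ?thesis
  proof
    assume tr: "R.transcendental F x"
    have "\<not> (p \<noteq> 0 \<and> poly p x = 0)" if p: "p \<in> polys F" for p
    proof
      assume *: "p \<noteq> 0 \<and> poly p x = 0"
      have "set (coeffs p) \<subseteq> F" using p by (auto simp: coeffs_def polysD)
      moreover have "hd (rev (coeffs p)) \<noteq> 0"
        using * by (simp add: hd_rev last_coeffs_eq_coeff_degree)
      ultimately have "rev (coeffs p) \<in> carrier (univ_poly ring_of_type_algebra F)"
        by (auto simp: univ_poly_def polynomial_def)
      then have "R.algebraic F x"
        using R.algebraicI[of "rev (coeffs p)" F x] * by (simp add: Embedded_Algebras.over_def eval_ring_of_type_algebra)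
      then show False using tr by simp
    qed
    then show "\<not> alg F x" by (auto simp: alg_def)
  next
    assume na: "\<not> alg F x"
    show "R.transcendental F x"
    proof (rule ccontr)
      assume "R.algebraic F x"
      then obtain p where p: "p \<in> carrier (univ_poly ring_of_type_algebra F)" "p \<noteq> []" "R.eval p x = \<zero>\<^bsub>ring_of_type_algebra\<^esub>"
        using R.algebraicE[OF F, of x] by (auto simp: Embedded_Algebras.over_def)
      have set: "set p \<subseteq> F" "hd p \<noteq> 0" using p by (auto simp: univ_poly_def polynomial_def)
      have "Poly (rev p) \<in> polys F"
        using set(1) by (auto intro!: polysI simp: nth_default_def) (metis nth_mem set_rev subsetD length_rev)
      moreover have "Poly (rev p) \<noteq> 0"
      proof -
        have "coeff (Poly (rev p)) (length p - 1) = hd p"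
          using p(2) by (simp add: nth_default_def rev_nth hd_conv_nth)
        then show ?thesis using set(2) by (metis coeff_0)
      qed
      ultimately show False using na p(3) by (auto simp: alg_def eval_ring_of_type_algebra)
    qed
  qed
qed

lemma simple_extension_eq: "R.simple_extension F x = sext F x"
proof
  show "R.simple_extension F x \<subseteq> sext F x"
  proof
    fix a assume "a \<in> R.simple_extension F x"
    then show "a \<in> sext F x"
    proof (induction rule: R.simple_extension.induct)
      case zero
      then show ?case by (auto simp: sext_def intro!: image_eqI[of _ _ 0])
    next
      case (lin k1 k2)
      then obtain g where "g \<in> polys F" "k1 = poly g x" by (auto simp: sext_def)
      then show ?case using lin.hyps
        by (auto simp: sext_def algebra_simps intro!: image_eqI[of _ _ "pCons k2 g"])
    qed
  qed
  have "poly g x \<in> R.simple_extension F x" if "g \<in> polys F" for g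
    using that
  proof (induction g)
    case 0
    then show ?case using R.simple_extension.zero[of F x] by simp
  next
    case (pCons a p)
    then show ?case using R.simple_extension.lin[of "poly p x" F x a] by (simp add: algebra_simps)
  qed
  then show "sext F x \<subseteq> R.simple_extension F x" by (auto simp: sext_def)
qed

lemma subfield: "subfield F ring_of_type_algebra"
  using subfld_axioms by (simp add: subfield_iff_subfld)

lemma sext_subfld: "alg F x \<Longrightarrow> subfld (sext F x)"
  using R.simple_extension_is_subfield[OF subfield, of x]
  by (simp add: Embedded_Algebras.over_def transcendental_iff simple_extension_eq subfield_iff_subfld)

lemma algs_subfld: "subfld {x. alg F x}"
  using R.subfield_of_algebraics[OF subfield]
  by (simp add: Embedded_Algebras.over_def transcendental_iff subfield_iff_subfld)

lemma finite_ext_exists: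
  assumes "\<And>x. x \<in> set xs \<Longrightarrow> alg F x"
  obtains E where "subfld E" "F \<subseteq> E" "set xs \<subseteq> E" "ring.finite_dimension ring_of_type_algebra F E"
    "\<And>x. x \<in> E \<Longrightarrow> alg F x"
proof
  have a: "(R.algebraic over F) x" if "x \<in> set xs" for x
    using assms that by (simp add: Embedded_Algebras.over_def transcendental_iff)
  let ?E = "R.finite_extension F xs"
  show "subfld ?E" using R.finite_extension_is_subfield[OF subfield _ a] by (simp add: subfield_iff_subfld)
  show "F \<subseteq> ?E" using R.finite_extension_incl by simp
  show "set xs \<subseteq> ?E" using R.finite_extension_mem[OF subfieldE(1)[OF subfield]] by simp
  show "R.finite_dimension F ?E" using R.finite_extension_finite_dimension(1)[OF subfield _ a] by simp
  show "alg F x" if "x \<in> ?E" for x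
    using R.finite_extesion_mem_imp_algebraic[OF subfield _ a that]
    by (simp add: Embedded_Algebras.over_def transcendental_iff)
qed

lemma finite_dimension_alg:
  assumes "subfld E" "R.finite_dimension F E" "x \<in> E" shows "alg F x"
  using R.finite_dimension_imp_algebraic[OF subfield subfieldE(1) assms(2,3)] assms(1)
  by (simp add: Embedded_Algebras.over_def transcendental_iff subfield_iff_subfld)

text \<open>The coefficients lie in a finite extension \<open>E\<close> of \<open>F\<close>; since
  \<open>x\<close> is algebraic over \<open>E\<close>, the field \<open>E[x]\<close> is finite over
  \<open>F\<close>.\<close>

lemma alg_trans:
  assumes p: "p \<in> polys {y. alg F y}" "p \<noteq> 0" "poly p x = 0"
  shows "alg F x"
proof -
  have "\<And>y. y \<in> set (coeffs p) \<Longrightarrow> alg F y" using p(1,2) by (auto simp: coeffs_def polys_def)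
  then obtain E where E: "subfld E" "F \<subseteq> E" "set (coeffs p) \<subseteq> E" "R.finite_dimension F E"
    by (rule finite_ext_exists)
  interpret E: subfld E by fact
  have "p \<in> polys E"
    using E(3) by (intro polysI) (metis E.zero coeff_in_coeffs coeff_eq_0 not_le p(2) subsetD)
  then have x: "alg E x" using p by (auto simp: alg_def)
  then have "R.finite_dimension E (sext E x)"
    using R.finite_dimension_simple_extension[OF E.subfield, of x]
    by (simp add: E.simple_extension_eq Embedded_Algebras.over_def E.transcendental_iff)
  then have "R.finite_dimension F (sext E x)"
    using R.telescopic_base_dim(1)[OF subfield E.subfield E(4)] by simp
  then show ?thesis using finite_dimension_alg[OF E.sext_subfld[OF x] _ E.sext_gen] by simp
qed

lemma alg_sext: "alg F x \<Longrightarrow> y \<in> sext F x \<Longrightarrow> alg F y"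
  using sext_minimal[OF algs_subfld, of x] alg_mem by blast

end

section \<open>Separability in prime characteristic\<close>

lemma alg_closed_split:
  fixes p :: "'a::alg_closed_field poly"
  assumes "lead_coeff p = 1"
  obtains A where "size A = degree p" "p = (\<Prod>a\<in>#A. [:- a, 1:])" "set_mset A = {x. poly p x = 0}"
proof -
  have "p \<noteq> 0" using assms by auto
  then obtain A where A: "size A = degree p" "p = (\<Prod>a\<in>#A. [:- a, 1:])"
    using alg_closed_imp_factorization[of p] assms by auto
  have "set_mset A = {x. poly p x = 0}"
    by (subst A(2)) (auto simp: poly_prod_mset prod_mset_zero_iff)
  then show thesis using A that by blast
qed

lemma card_simple_roots:
  fixes p :: "'a::alg_closed_field poly"
  assumes "lead_coeff p = 1" "\<And>x. poly p x = 0 \<Longrightarrow> poly (pderiv p) x \<noteq> 0"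
  shows "card {x. poly p x = 0} = degree p"
proof -
  obtain A where A: "size A = degree p" "p = (\<Prod>a\<in>#A. [:- a, 1:])" "set_mset A = {x. poly p x = 0}"
    by (rule alg_closed_split[OF assms(1)])
  have "count A a = 1" if a: "a \<in># A" for a
  proof (rule ccontr)
    assume c: "count A a \<noteq> 1"
    obtain B where B: "A = add_mset a B" using a by (meson mset_add)
    then have "a \<in># B" using c by (auto simp: not_in_iff)
    then obtain C where C: "B = add_mset a C" by (meson mset_add)
    have *: "poly (pderiv (L * (L * R))) a = 0" if "poly L a = 0" for L R :: "'a poly"
      using that by (simp add: pderiv_mult)
    have "p = [:- a, 1:] * ([:- a, 1:] * (\<Prod>a\<in>#C. [:- a, 1:]))"
      using A(2) unfolding B C by (simp only: image_mset_add_mset prod_mset.add_mset)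
    then have "poly (pderiv p) a = 0" using *[of "[:- a, 1:]"] by simp
    then show False using assms(2)[of a] a A(3) by auto
  qed
  then have "size A = card (set_mset A)" by (simp add: size_multiset_overloaded_eq)
  then show ?thesis using A by simp
qed

lemma coeff_pcompose_monom:
  fixes p :: "'a::field poly"
  assumes "n > 0"
  shows "coeff (pcompose p (Polynomial.monom 1 n)) i = (if n dvd i then coeff p (i div n) else 0)"
proof (induction p arbitrary: i)
  case (pCons a p)
  show ?case
  proof (cases "i < n")
    case True
    then have "n dvd i \<longleftrightarrow> i = 0" using nat_dvd_not_less by fastforce
    then show ?thesis using True assms
      by (auto simp: pcompose_pCons coeff_monom_mult coeff_pCons split: nat.splits)
  next
    case False
    then have "i > 0" using assms by simp
    have "coeff (pcompose (pCons a p) (Polynomial.monom 1 n)) i = coeff (pcompose p (Polynomial.monom 1 n)) (i - n)"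
      using False \<open>i > 0\<close> by (auto simp: pcompose_pCons coeff_monom_mult coeff_pCons split: nat.splits)
    also have "\<dots> = (if n dvd i then coeff p ((i - n) div n) else 0)"
      using False by (simp add: pCons.IH dvd_minus_self)
    also have "\<dots> = (if n dvd i then coeff (pCons a p) (i div n) else 0)"
      using False assms by (auto simp: le_div_geq)
    finally show ?thesis .
  qed
qed simp

text \<open>A vanishing derivative kills every coefficient whose index is not divisible by the
  characteristic \<open>p\<close>, so \<open>q\<close> is a polynomial in
  \<open>X^p\<close>.\<close>

lemma pderiv_zero_pcompose:
  fixes q :: "'a::field poly"
  assumes "pderiv q = 0" "CHAR('a) > 0"
  obtains r where "q = pcompose r (Polynomial.monom 1 CHAR('a))" "\<And>F. 0 \<in> F \<Longrightarrow> q \<in> polys F \<Longrightarrow> r \<in> polys F"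
proof -
  let ?P = "CHAR('a)"
  have 0: "coeff q i = 0" if "\<not> ?P dvd i" for i
  proof -
    have "i \<noteq> 0" using that by (rule contrapos_nn) simp
    then obtain j where j: "i = Suc j" using not0_implies_Suc by blast
    have "of_nat (Suc j) * coeff q (Suc j) = 0"
      using assms(1) coeff_pderiv[of q j] by simp
    moreover have "of_nat (Suc j) \<noteq> (0::'a)"
      using that unfolding j of_nat_eq_0_iff_char_dvd by simp
    ultimately show ?thesis unfolding j by (metis mult_eq_0_iff)
  qed
  define r where "r = (\<Sum>i\<le>degree q. Polynomial.monom (coeff q (i * ?P)) i)"
  have r: "coeff r i = coeff q (i * ?P)" for i
  proof (cases "i \<le> degree q")
    case True
    then show ?thesis by (simp add: r_def coeff_sum)
  next
    case False
    then have "degree q < i * ?P" using assms(2) by (metis le_less_trans mult.right_neutral mult_le_mono2 not_le Suc_leI One_nat_def)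
    then show ?thesis using False by (simp add: r_def coeff_sum coeff_eq_0)
  qed
  show thesis
  proof (rule that)
    show "q = pcompose r (Polynomial.monom 1 ?P)"
      by (rule poly_eqI) (use 0 assms(2) in \<open>auto simp: coeff_pcompose_monom r\<close>)
    show "r \<in> polys F" if "0 \<in> F" "q \<in> polys F" for F
      using that by (auto simp: polys_def r)
  qed
qed

lemma frobenius_diff:
  fixes x y :: "'a::field"
  assumes "CHAR('a) > 0" shows "(x - y) ^ CHAR('a) = x ^ CHAR('a) - y ^ CHAR('a)"
  using freshmans_dream[OF prime_CHAR_semidom[OF assms] refl, of "x - y" y] by (simp add: algebra_simps)

lemma frobenius_poly:
  fixes h :: "'a::field poly"
  assumes "CHAR('a) > 0"
  shows "poly (map_poly (\<lambda>a. a ^ CHAR('a)) h) (x ^ CHAR('a)) = poly h x ^ CHAR('a)"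
  using assms freshmans_dream[OF prime_CHAR_semidom[OF assms] refl]
  by (induction h) (auto simp: map_poly_pCons power_mult_distrib)

text \<open>The \<open>p\<close>-th powers of the distinct roots of the minimal polynomial of \<open>b\<close> are distinct, so \<open>b\<^sup>p\<close> has
  at least the degree of \<open>b\<close>; hence an expression of degree below it in \<open>b\<close> whose \<open>p\<close>-th power
  is in \<open>F\<close> is constant.\<close>

lemma sep_pth_root:
  fixes b :: "'a::alg_closed_field"
  assumes F: "subfld D" and b: "sep D b" and y: "y \<in> sext D b" "y ^ CHAR('a) \<in> D" and P: "CHAR('a) > 0"
  shows "y \<in> D"
proof -
  interpret D: subfld D by fact
  let ?P = "CHAR('a)"
  obtain q where q: "minp D b q" using D.minp_exists sep_alg[OF b] by blast
  note qD = minpD[OF q]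
  obtain h where h: "h \<in> polys D" "y = poly h b" "degree h < degree q"
    by (rule D.sext_reduced[OF q y(1)])
  \<comment> \<open>\<open>M\<close> vanishes at \<open>b^p\<close>, because the polynomial formed
    with the \<open>p\<close>-th powers of the coefficients of \<open>h\<close> takes the value
    \<open>h(b)^p = y^p\<close> there.\<close>
  define M where "M = map_poly (\<lambda>a. a ^ ?P) h - [:y ^ ?P:]"
  have MD: "M \<in> polys D" using h(1) y(2) P by (auto simp: M_def polys_def coeff_map_poly coeff_pCons split: nat.splits)
  have Mb: "poly M (b ^ ?P) = 0" using P by (simp add: M_def frobenius_poly h)
  have degM: "degree M < degree q"
    unfolding M_def by (rule le_less_trans[OF degree_diff_le h(3)]) (auto intro: map_poly_degree_leq)
  have "M = 0"
  proof (rule ccontr)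
    assume "M \<noteq> 0"
    have "poly M (a ^ ?P) = 0" if "poly q a = 0" for a
    proof -
      have "conj D b a" using D.minp_conj_iff[OF q] that by simp
      moreover have "pcompose M (Polynomial.monom 1 ?P) \<in> polys D" using MD by auto
      ultimately show ?thesis using Mb unfolding conj_def by (auto simp: poly_pcompose poly_monom)
    qed
    then have "(\<lambda>a. a ^ ?P) ` {a. poly q a = 0} \<subseteq> {x. poly M x = 0}" by auto
    then have "card ((\<lambda>a. a ^ ?P) ` {a. poly q a = 0}) \<le> card {x. poly M x = 0}"
      using \<open>M \<noteq> 0\<close> by (intro card_mono poly_roots_finite) auto
    also have "\<dots> \<le> degree M" using \<open>M \<noteq> 0\<close> by (rule card_poly_roots_bound)
    also have "card ((\<lambda>a. a ^ ?P) ` {a. poly q a = 0}) = card {a. poly q a = 0}"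
    proof (intro card_image inj_onI)
      fix x y :: 'a assume "x ^ ?P = y ^ ?P"
      then have "(x - y) ^ ?P = 0" using frobenius_diff[OF P] by simp
      then show "x = y" by simp
    qed
    also have "\<dots> = degree q"
    proof (rule card_simple_roots[OF qD(2)])
      show "poly (pderiv q) x \<noteq> 0" if "poly q x = 0" for x
        using D.minp_coprime[OF q _ _ that, of "pderiv q"] D.sep_iff_minp[OF q] b qD(1) by auto
    qed
    finally show False using degM by simp
  qed
  then have "map_poly (\<lambda>a. a ^ ?P) h = [:y ^ ?P:]" by (simp add: M_def)
  then have "coeff (map_poly (\<lambda>a. a ^ ?P) h) (Suc i) = 0" for i by (metis coeff_pCons_Suc coeff_0)
  then have "coeff h (Suc i) = 0" for i using P by (auto simp: coeff_map_poly)
  then have "h = [:coeff h 0:]" by (intro poly_eqI) (auto simp: coeff_pCons split: nat.splits)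
  then have "y = coeff h 0" using h(2) by (metis add.right_neutral mult_zero_right poly_0 poly_pCons)
  then show ?thesis using h(1) by (simp add: polysD)
qed

context subfld
begin

text \<open>An inseparable minimal polynomial has the form \<open>r(X^p)\<close>. Writing
  \<open>y = g(y^p)\<close> with \<open>g\<close> reduced modulo \<open>r\<close> produces
  \<open>g(X^p) - X\<close>, of degree below that of \<open>r(X^p)\<close> and with root
  \<open>y\<close>; it is nonzero, since \<open>p > 1\<close> leaves the coefficient of
  \<open>X\<close> equal to -1. In characteristic 0 the derivative cannot vanish.\<close>

lemma sepI_pth_power:
  assumes y: "alg F y" "CHAR('a) > 0 \<Longrightarrow> y \<in> sext F (y ^ CHAR('a))"
  shows "sep F y"
proof (rule ccontr)
  assume ns: "\<not> sep F y"
  let ?P = "CHAR('a)"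
  obtain q where q: "minp F y q" using minp_exists[OF y(1)] .
  note qD = minpD[OF q]
  have pq: "pderiv q = 0" using minp_pderiv_zero[OF q ns] .
  have P: "?P > 0"
  proof (rule ccontr)
    assume "\<not> ?P > 0"
    then have 0: "of_nat n \<noteq> (0::'a)" if "n > 0" for n using that by (simp add: of_nat_eq_0_iff_char_dvd)
    obtain d where d: "degree q = Suc d" using minp_degree_pos[OF q] by (cases "degree q") auto
    have "coeff (pderiv q) d \<noteq> 0" using 0[of "Suc d"] qD(2) d by (simp add: coeff_pderiv del: of_nat_Suc)
    then show False using pq by simp
  qed
  have P2: "?P > 1" using prime_CHAR_semidom[OF P] by (rule prime_gt_1_nat)
  obtain r where r: "q = pcompose r (Polynomial.monom 1 ?P)" "r \<in> polys F"
    using pderiv_zero_pcompose[OF pq P] qD(1) zero by metis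
  have dq: "degree q = degree r * ?P" by (simp add: r(1) degree_pcompose degree_monom_eq)
  then have dr: "degree r > 0" using minp_degree_pos[OF q] by (cases "degree r") auto
  have ry: "poly r (y ^ ?P) = 0" using qD(3) by (simp add: r(1) poly_pcompose poly_monom)
  obtain g where g: "g \<in> polys F" "y = poly g (y ^ ?P)" using y(2) P by (auto simp: sext_def)
  define G where "G = pcompose (g mod r) (Polynomial.monom 1 ?P) - [:0, 1:]"
  have "degree (g mod r) \<le> degree r - 1"
    using degree_mod_less[of r g] dr by (cases "g mod r = 0"; cases "r = 0") auto
  then have "degree (pcompose (g mod r) (Polynomial.monom 1 ?P)) \<le> (degree r - 1) * ?P"
    by (simp add: degree_pcompose degree_monom_eq)
  moreover have "(degree r - 1) * ?P < degree r * ?P" using dr P by simp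
  moreover have "?P \<le> degree r * ?P" using dr by simp
  ultimately have "degree (pcompose (g mod r) (Polynomial.monom 1 ?P)) < degree q" "1 < degree q"
    using P2 unfolding dq by linarith+
  then have "degree G < degree q"
    unfolding G_def by (intro degree_diff_less) simp_all
  moreover have "G \<in> polys F" using g(1) r(2) by (auto simp: G_def)
  moreover have "poly G y = 0" using g ry by (simp add: G_def poly_pcompose poly_monom poly_mod)
  moreover have "G \<noteq> 0"
  proof -
    have "coeff G 1 = - 1" using P2 P by (simp add: G_def coeff_pcompose_monom)
    then show ?thesis by auto
  qed
  ultimately show False using qD(5)[of G] by simp
qed

end

section \<open>Extension of field homomorphisms\<close>

locale hom_on = subfld F for F :: "'a::field set" +
  fixes \<sigma> :: "'a \<Rightarrow> 'b::field"
  assumes hom_one [simp]: "\<sigma> 1 = 1"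
    and hom_add [simp]: "x \<in> F \<Longrightarrow> y \<in> F \<Longrightarrow> \<sigma> (x + y) = \<sigma> x + \<sigma> y"
    and hom_mult [simp]: "x \<in> F \<Longrightarrow> y \<in> F \<Longrightarrow> \<sigma> (x * y) = \<sigma> x * \<sigma> y"
begin

lemma hom_zero [simp]: "\<sigma> 0 = 0"
proof -
  have "\<sigma> 0 + \<sigma> 0 = \<sigma> 0 + 0" using hom_add[OF zero zero] by (simp only: add_0_right)
  then show ?thesis by (simp only: add_left_cancel)
qed

lemma hom_uminus [simp]: "x \<in> F \<Longrightarrow> \<sigma> (- x) = - \<sigma> x"
  using hom_add[of x "- x"] by (simp add: eq_neg_iff_add_eq_0 add.commute del: hom_add)

lemma hom_diff [simp]: "x \<in> F \<Longrightarrow> y \<in> F \<Longrightarrow> \<sigma> (x - y) = \<sigma> x - \<sigma> y"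
  using hom_add[of x "- y"] by (simp del: hom_add)

lemma hom_inverse [simp]: "x \<in> F \<Longrightarrow> \<sigma> (inverse x) = inverse (\<sigma> x)"
proof (cases "x = 0")
  case False
  assume "x \<in> F"
  then have "\<sigma> x * \<sigma> (inverse x) = 1" using False hom_mult[of x "inverse x"] by (simp del: hom_mult)
  then show ?thesis by (metis inverse_unique)
qed simp

lemma hom_eq_0_iff [simp]: "x \<in> F \<Longrightarrow> \<sigma> x = 0 \<longleftrightarrow> x = 0"
proof
  show "x = 0" if "x \<in> F" "\<sigma> x = 0"
  proof (rule ccontr)
    assume "x \<noteq> 0"
    then have "\<sigma> (x * inverse x) = 1" by simp
    then show False using that by (simp del: right_inverse)
  qed
qed simp

lemma hom_inj: "inj_on \<sigma> F"
  by (rule inj_onI) (metis diff eq_iff_diff_eq_0 hom_diff hom_eq_0_iff)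

lemma hom_sum: "(\<And>i. i \<in> A \<Longrightarrow> f i \<in> F) \<Longrightarrow> \<sigma> (\<Sum>i\<in>A. f i) = (\<Sum>i\<in>A. \<sigma> (f i))"
proof (induction A rule: infinite_finite_induct)
  case (insert a A)
  then have "sum f A \<in> F" by (intro sum) auto
  then show ?case using insert by simp
qed auto

lemma hom_prod: "(\<And>i. i \<in> A \<Longrightarrow> f i \<in> F) \<Longrightarrow> \<sigma> (\<Prod>i\<in>A. f i) = (\<Prod>i\<in>A. \<sigma> (f i))"
proof (induction A rule: infinite_finite_induct)
  case (insert a A)
  then have "prod f A \<in> F" by (intro prod) auto
  then show ?case using insert by simp
qed auto

lemma map_poly_hom_add: "p \<in> polys F \<Longrightarrow> q \<in> polys F \<Longrightarrow> map_poly \<sigma> (p + q) = map_poly \<sigma> p + map_poly \<sigma> q"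
  by (rule poly_eqI) (auto simp: coeff_map_poly polysD)

lemma map_poly_hom_diff: "p \<in> polys F \<Longrightarrow> q \<in> polys F \<Longrightarrow> map_poly \<sigma> (p - q) = map_poly \<sigma> p - map_poly \<sigma> q"
  by (rule poly_eqI) (auto simp: coeff_map_poly polysD)

lemma map_poly_hom_mult: "p \<in> polys F \<Longrightarrow> q \<in> polys F \<Longrightarrow> map_poly \<sigma> (p * q) = map_poly \<sigma> p * map_poly \<sigma> q"
  by (rule poly_eqI) (auto simp: coeff_map_poly polysD coeff_mult hom_sum)

lemma map_poly_hom_dvd:
  assumes "p \<in> polys F" "q \<in> polys F" "p dvd q" shows "map_poly \<sigma> p dvd map_poly \<sigma> q"
proof (cases "p = 0")
  case False
  have "q = p * (q div p)" using assms(3) by simp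
  then have "map_poly \<sigma> q = map_poly \<sigma> p * map_poly \<sigma> (q div p)"
    using map_poly_hom_mult assms(1,2) polys_div by metis
  then show ?thesis by simp
qed (use assms in simp)

lemma poly_map_poly_hom: "p \<in> polys F \<Longrightarrow> x \<in> F \<Longrightarrow> poly (map_poly \<sigma> p) (\<sigma> x) = \<sigma> (poly p x)"
  by (induction p) (auto simp: map_poly_pCons)

text \<open>The value at \<open>poly g y\<close> is that of the image of \<open>g\<close> at
  \<open>y'\<close>; two choices of \<open>g\<close> differ by a multiple of \<open>q\<close>, whose
  image vanishes at \<open>y'\<close>.\<close>

lemma hom_extend:
  assumes q: "minp F y q" and y': "poly (map_poly \<sigma> q) y' = 0"
  obtains \<tau> where "hom_on (sext F y) \<tau>" "\<And>x. x \<in> F \<Longrightarrow> \<tau> x = \<sigma> x" "\<tau> y = y'"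
    "\<And>g. g \<in> polys F \<Longrightarrow> \<tau> (poly g y) = poly (map_poly \<sigma> g) y'"
proof -
  have wd: "poly (map_poly \<sigma> g) y' = poly (map_poly \<sigma> h) y'"
    if "g \<in> polys F" "h \<in> polys F" "poly g y = poly h y" for g h
  proof -
    have "q dvd g - h" using that by (intro minp_dvd[OF q]) auto
    then have "map_poly \<sigma> q dvd map_poly \<sigma> (g - h)" using minpD(1)[OF q] that by (intro map_poly_hom_dvd) auto
    then have "poly (map_poly \<sigma> (g - h)) y' = 0" using y' by (auto simp: dvd_def)
    then show ?thesis using that by (simp add: map_poly_hom_diff)
  qed
  define \<tau> where "\<tau> u = poly (map_poly \<sigma> (SOME g. g \<in> polys F \<and> poly g y = u)) y'" for u
  have \<tau>: "\<tau> (poly g y) = poly (map_poly \<sigma> g) y'" if "g \<in> polys F" for g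
    using someI[of "\<lambda>h. h \<in> polys F \<and> poly h y = poly g y" g] that unfolding \<tau>_def
    by (intro wd) auto
  have alg: "alg F y" using minpD[OF q] by (auto simp: alg_def)
  interpret S: subfld "sext F y" by (rule sext_subfld[OF alg])
  have F: "\<tau> x = \<sigma> x" if "x \<in> F" for x
    using \<tau>[of "[:x:]"] that by (simp add: map_poly_pCons)
  have hom: "hom_on (sext F y) \<tau>"
  proof unfold_locales
    show "\<tau> 1 = 1" using F[of 1] by simp
    fix a b assume "a \<in> sext F y" "b \<in> sext F y"
    then obtain g h where "g \<in> polys F" "h \<in> polys F" "a = poly g y" "b = poly h y"
      by (auto simp: sext_def)
    then show "\<tau> (a + b) = \<tau> a + \<tau> b" "\<tau> (a * b) = \<tau> a * \<tau> b"
      using \<tau>[of "g + h"] \<tau>[of "g * h"] \<tau>[of g] \<tau>[of h] map_poly_hom_add[of g h] map_poly_hom_mult[of g h]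
      by simp_all
  qed
  have "\<tau> y = y'" using \<tau>[of "[:0, 1:]"] by (simp add: map_poly_pCons)
  then show thesis using that[of \<tau>] hom F \<tau> by blast
qed

lemma map_poly_hom_degree: "p \<in> polys F \<Longrightarrow> degree (map_poly \<sigma> p) = degree p"
  by (cases "p = 0") (auto intro!: map_poly_degree_eq simp: polysD)

end

lemma hom_extend_list:
  fixes \<sigma> :: "'a::field \<Rightarrow> 'b::alg_closed_field"
  assumes "hom_on F \<sigma>" "\<And>x. x \<in> set xs \<Longrightarrow> alg F x"
  shows "\<exists>E \<tau>. hom_on E \<tau> \<and> F \<subseteq> E \<and> set xs \<subseteq> E \<and> (\<forall>x\<in>F. \<tau> x = \<sigma> x)"
  using assms
proof (induction xs arbitrary: F \<sigma>)
  case Nil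
  then show ?case by auto
next
  case (Cons y xs)
  interpret hom_on F \<sigma> by fact
  obtain q where q: "minp F y q" using minp_exists Cons.prems(2) by auto
  have "degree (map_poly \<sigma> q) > 0" using minp_degree_pos[OF q] minpD(1)[OF q] by (simp add: map_poly_hom_degree)
  then obtain y' where "poly (map_poly \<sigma> q) y' = 0" using alg_closed_imp_poly_has_root by blast
  from hom_extend[OF q this] obtain \<tau> where \<tau>: "hom_on (sext F y) \<tau>" "\<And>x. x \<in> F \<Longrightarrow> \<tau> x = \<sigma> x"
    by blast
  have "alg (sext F y) x" if "x \<in> set xs" for x
    using Cons.prems(2)[of x] that alg_mono[OF sext_incl] by simp
  from Cons.IH[OF \<tau>(1) this] obtain E \<tau>' where
    "hom_on E \<tau>'" "sext F y \<subseteq> E" "set xs \<subseteq> E" "\<forall>x\<in>sext F y. \<tau>' x = \<tau> x" by blast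
  then show ?case using \<tau>(2) sext_incl[of y] sext_gen[of y]
    by (intro exI[of _ E] exI[of _ \<tau>']) (auto simp: subset_iff)
qed

lemma (in subfld) id_hom_on: "hom_on F id"
  by unfold_locales auto

text \<open>Stands in for an automorphism of the algebraic closure: each application moves only
  finitely many further elements, so a homomorphism defined on a field containing them is
  enough.\<close>

lemma conj_hom_exists:
  fixes x :: "'a::alg_closed_field"
  assumes K: "subfld K" and x: "alg K x" "conj K x x'" and xs: "\<And>y. y \<in> set xs \<Longrightarrow> alg K y"
  obtains E \<tau> where "hom_on E \<tau>" "K \<subseteq> E" "set xs \<subseteq> E" "x \<in> E" "\<And>a. a \<in> K \<Longrightarrow> \<tau> a = a" "\<tau> x = x'"
proof -
  interpret K: subfld K by fact
  obtain q where q: "minp K x q" using K.minp_exists[OF x(1)] .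
  then have "poly (map_poly id q) x' = 0" using x(2) K.minp_conj_iff by simp
  from hom_on.hom_extend[OF K.id_hom_on q this]
  obtain \<tau>0 where \<tau>0: "hom_on (sext K x) \<tau>0" "\<And>a. a \<in> K \<Longrightarrow> \<tau>0 a = a" "\<tau>0 x = x'" by auto
  have "alg (sext K x) y" if "y \<in> set xs" for y using alg_mono[OF K.sext_incl xs[OF that]] .
  from hom_extend_list[OF \<tau>0(1) this] obtain E \<tau> where
    "hom_on E \<tau>" "sext K x \<subseteq> E" "set xs \<subseteq> E" "\<forall>y\<in>sext K x. \<tau> y = \<tau>0 y" by blast
  then show thesis using that[of E \<tau>] \<tau>0 K.sext_incl[of x] K.sext_gen[of x] by (metis subsetD subset_trans)
qed

lemma (in hom_on) hom_conj:
  assumes "K \<subseteq> F" "\<And>a. a \<in> K \<Longrightarrow> \<sigma> a = \<iota> a" "x \<in> F" "g \<in> polys K"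
  shows "poly (map_poly \<iota> g) (\<sigma> x) = \<sigma> (poly g x)"
proof -
  have "map_poly \<iota> g = map_poly \<sigma> g"
    using assms(2,4) by (intro map_poly_cong) (metis (no_types, opaque_lifting) coeffs_def list.set_map imageE polysD empty_iff list.set(1))
  then show ?thesis using poly_map_poly_hom[of g x] polys_mono[OF assms(1)] assms(3,4) by auto
qed

section \<open>Valuation rings of an algebraically closed field\<close>

lemma monic_prod_linear:
  fixes A :: "'a::field multiset"
  shows "degree (\<Prod>a\<in>#A. [:- a, 1:]) = size A" "lead_coeff (\<Prod>a\<in>#A. [:- a, 1:]) = 1"
proof (induction A)
  case (add a A)
  let ?p = "\<Prod>a\<in>#A. [:- a, 1:]"
  have "?p \<noteq> 0" using add by (metis leading_coeff_0_iff zero_neq_one)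
  show "degree (\<Prod>a\<in>#add_mset a A. [:- a, 1:]) = size (add_mset a A)"
    using add degree_mult_eq[of "[:- a, 1:]" ?p, OF _ \<open>?p \<noteq> 0\<close>] by (simp del: mult_pCons_left)
  show "lead_coeff (\<Prod>a\<in>#add_mset a A. [:- a, 1:]) = 1"
    using add lead_coeff_mult[of "[:- a, 1:]" ?p] by (simp del: mult_pCons_left)
qed simp_all

locale valued =
  fixes V :: "'a::alg_closed_field set"
  assumes V_one [simp]: "1 \<in> V"
    and V_diff: "x \<in> V \<Longrightarrow> y \<in> V \<Longrightarrow> x - y \<in> V"
    and V_mult: "x \<in> V \<Longrightarrow> y \<in> V \<Longrightarrow> x * y \<in> V"
    and V_total: "x \<notin> V \<Longrightarrow> inverse x \<in> V"
begin

text \<open>Read as comparison of absolute values, so the order is opposite to that of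
  \<open>hval\<close>. Working with the valuation ring alone avoids building a value group for the
  algebraic closure.\<close>

definition vle :: "'a \<Rightarrow> 'a \<Rightarrow> bool" (infix \<open>\<preceq>\<close> 50) where
  "x \<preceq> y \<longleftrightarrow> (\<exists>a\<in>V. x = a * y)"

definition vlt :: "'a \<Rightarrow> 'a \<Rightarrow> bool" (infix \<open>\<prec>\<close> 50) where
  "x \<prec> y \<longleftrightarrow> \<not> y \<preceq> x"

lemma V_zero [simp]: "0 \<in> V"
  using V_diff[OF V_one V_one] by simp

lemma V_uminus: "x \<in> V \<Longrightarrow> - x \<in> V"
  using V_diff[OF V_zero, of x] by simp

lemma V_add: "x \<in> V \<Longrightarrow> y \<in> V \<Longrightarrow> x + y \<in> V"
  using V_diff[of x "- y"] V_uminus by simp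

lemma V_iff: "x \<in> V \<longleftrightarrow> x \<preceq> 1"
  by (simp add: vle_def)

lemma not_vlt [simp]: "\<not> x \<prec> y \<longleftrightarrow> y \<preceq> x" and not_vle: "\<not> x \<preceq> y \<longleftrightarrow> y \<prec> x"
  by (auto simp: vlt_def)

lemma vle_refl [simp]: "x \<preceq> x"
  by (auto simp: vle_def intro: bexI[of _ 1])

lemma vle_trans [trans]: "x \<preceq> y \<Longrightarrow> y \<preceq> z \<Longrightarrow> x \<preceq> z"
  by (auto simp: vle_def simp flip: mult.assoc intro: V_mult)

lemma vle_zero [simp]: "0 \<preceq> x"
  unfolding vle_def by (rule bexI[of _ 0]) auto

lemma vle_total: "x \<preceq> y \<or> y \<preceq> x"
proof (cases "x = 0 \<or> y = 0")
  case False
  then have "x = (x / y) * y" "y = inverse (x / y) * x" by simp_all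
  then show ?thesis using V_total[of "x / y"] unfolding vle_def by blast
qed (use vle_zero in blast)

lemma vlt_imp_vle: "x \<prec> y \<Longrightarrow> x \<preceq> y"
  using vle_total by (auto simp: vlt_def)

lemma vlt_irrefl [simp]: "\<not> x \<prec> x"
  by simp

lemma vlt_vle_trans [trans]: "x \<prec> y \<Longrightarrow> y \<preceq> z \<Longrightarrow> x \<prec> z"
  and vle_vlt_trans [trans]: "x \<preceq> y \<Longrightarrow> y \<prec> z \<Longrightarrow> x \<prec> z"
  and vlt_trans [trans]: "x \<prec> y \<Longrightarrow> y \<prec> z \<Longrightarrow> x \<prec> z"
  unfolding vlt_def by (meson vle_trans vle_total)+

lemma vle_0_iff [simp]: "x \<preceq> 0 \<longleftrightarrow> x = 0"
  by (metis mult_zero_right vle_def vle_zero)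

lemma not_vlt_0: "\<not> x \<prec> 0" and vlt_zero_iff [simp]: "0 \<prec> x \<longleftrightarrow> x \<noteq> 0"
  by (auto simp: vlt_def)

lemma vlt_nonzero: "x \<prec> y \<Longrightarrow> y \<noteq> 0"
  using not_vlt_0 by blast

lemma vleI: "a \<in> V \<Longrightarrow> x = a * y \<Longrightarrow> x \<preceq> y"
  unfolding vle_def by blast

lemma vleE: assumes "x \<preceq> y" obtains a where "a \<in> V" "x = a * y"
  using assms unfolding vle_def by blast

lemma vle_uminus [simp]: "- x \<preceq> y \<longleftrightarrow> x \<preceq> y" "x \<preceq> - y \<longleftrightarrow> x \<preceq> y"
proof -
  have *: "- x \<preceq> y" "x \<preceq> - y" if xy: "x \<preceq> y" for x y
  proof -
    obtain a where a: "a \<in> V" "x = a * y" by (rule vleE[OF xy])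
    show "- x \<preceq> y" "x \<preceq> - y" by (rule vleI[OF V_uminus[OF a(1)]], simp add: a)+
  qed
  show "- x \<preceq> y \<longleftrightarrow> x \<preceq> y" using *(1)[of x y] *(1)[of "- x" y] by (metis minus_minus)
  show "x \<preceq> - y \<longleftrightarrow> x \<preceq> y" using *(2)[of x y] *(2)[of x "- y"] by (metis minus_minus)
qed

lemma vlt_uminus [simp]: "- x \<prec> y \<longleftrightarrow> x \<prec> y" "x \<prec> - y \<longleftrightarrow> x \<prec> y"
  by (simp_all add: vlt_def)

lemma vle_add: "x \<preceq> z \<Longrightarrow> y \<preceq> z \<Longrightarrow> x + y \<preceq> z"
  by (elim vleE, rule vleI[OF V_add]) (auto simp: distrib_right)

lemma vle_diff: "x \<preceq> z \<Longrightarrow> y \<preceq> z \<Longrightarrow> x - y \<preceq> z"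
  using vle_add[of x z "- y"] by simp

lemma vlt_add: "x \<prec> z \<Longrightarrow> y \<prec> z \<Longrightarrow> x + y \<prec> z"
  using vle_total[of x y] vle_add[of x y y] vle_add[of x x y] vle_vlt_trans[of "x + y" y z]
    vle_vlt_trans[of "x + y" x z] vle_refl by blast

lemma vlt_diff: "x \<prec> z \<Longrightarrow> y \<prec> z \<Longrightarrow> x - y \<prec> z"
  using vlt_add[of x z "- y"] by simp

lemma vlt_minus_commute: "x - y \<prec> z \<longleftrightarrow> y - x \<prec> z"
  using vlt_uminus(1)[of "x - y" z] by simp

lemma vle_add_dominant: "y \<prec> x \<Longrightarrow> x \<preceq> x + y" "y \<prec> x \<Longrightarrow> x + y \<preceq> x"
proof -
  assume y: "y \<prec> x"
  show "x \<preceq> x + y"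
  proof (rule ccontr)
    assume "\<not> x \<preceq> x + y"
    then have "x + y - y \<prec> x" using y by (intro vlt_diff) (simp_all add: not_vle)
    then show False by simp
  qed
  show "x + y \<preceq> x" using vlt_imp_vle[OF y] by (intro vle_add) auto
qed

lemma vle_mult: "x \<preceq> y \<Longrightarrow> x' \<preceq> y' \<Longrightarrow> x * x' \<preceq> y * y'"
proof -
  assume xy: "x \<preceq> y" "x' \<preceq> y'"
  obtain a where a: "a \<in> V" "x = a * y" by (rule vleE[OF xy(1)])
  obtain b where b: "b \<in> V" "x' = b * y'" by (rule vleE[OF xy(2)])
  show ?thesis by (rule vleI[OF V_mult[OF a(1) b(1)]]) (simp add: a b)
qed

lemma vle_mult_cancel: "z \<noteq> 0 \<Longrightarrow> x * z \<preceq> y * z \<longleftrightarrow> x \<preceq> y"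
  using vle_mult[of "x * z" "y * z" "inverse z" "inverse z"] vle_mult[of x y z z]
  by (auto simp: mult.assoc)

lemma vlt_mult_cancel: "z \<noteq> 0 \<Longrightarrow> x * z \<prec> y * z \<longleftrightarrow> x \<prec> y"
  by (simp add: vlt_def vle_mult_cancel)

lemma vlt_vle_mult: "x \<prec> y \<Longrightarrow> x' \<preceq> y' \<Longrightarrow> y' \<noteq> 0 \<Longrightarrow> x * x' \<prec> y * y'"
  using vle_vlt_trans[OF vle_mult[OF vle_refl, of x' y' x]] vlt_mult_cancel[of y' x y] by simp

lemma vle_vlt_mult: "x \<preceq> y \<Longrightarrow> x' \<prec> y' \<Longrightarrow> y \<noteq> 0 \<Longrightarrow> x * x' \<prec> y * y'"
  using vlt_vle_mult[of x' y' x y] by (simp add: mult.commute)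

lemma vle_power: "x \<preceq> y \<Longrightarrow> x ^ n \<preceq> y ^ n"
  by (induction n) (auto intro: vle_mult)

lemma vlt_power: "x \<prec> y \<Longrightarrow> n > 0 \<Longrightarrow> x ^ n \<prec> y ^ n"
proof (induction n)
  case (Suc n)
  then show ?case
    using vlt_vle_mult[OF Suc.prems(1) vle_power[OF vlt_imp_vle[OF Suc.prems(1)]], of n] vlt_nonzero[OF Suc.prems(1)]
    by simp
qed simp

lemma vle_inverse: "x \<preceq> y \<Longrightarrow> x \<noteq> 0 \<Longrightarrow> inverse y \<preceq> inverse x"
proof -
  assume *: "x \<preceq> y" "x \<noteq> 0"
  then have "y \<noteq> 0" by auto
  then have "x * (inverse x * inverse y) = inverse y" "y * (inverse x * inverse y) = inverse x"
    using *(2) by simp_all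
  then show ?thesis using vle_mult[OF *(1) vle_refl, of "inverse x * inverse y"] by (simp only:)
qed

lemma vle_divide: "y \<noteq> 0 \<Longrightarrow> x / y \<preceq> z \<longleftrightarrow> x \<preceq> z * y"
  using vle_mult_cancel[of y "x / y" z] by simp

lemma vlt_divide: "y \<noteq> 0 \<Longrightarrow> x / y \<prec> z \<longleftrightarrow> x \<prec> z * y"
  using vlt_mult_cancel[of y "x / y" z] by simp

lemma V_sum: "(\<And>i. i \<in> A \<Longrightarrow> f i \<in> V) \<Longrightarrow> sum f A \<in> V"
  by (induction A rule: infinite_finite_induct) (auto intro: V_add)

lemma V_power: "x \<in> V \<Longrightarrow> x ^ n \<in> V"
  by (induction n) (auto intro: V_mult)

lemma V_of_nat: "of_nat n \<in> V"
  by (induction n) (auto intro: V_add)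

lemma vle_prod: "(\<And>i. i \<in> A \<Longrightarrow> f i \<preceq> g i) \<Longrightarrow> prod f A \<preceq> prod g A"
  by (induction A rule: infinite_finite_induct) (auto intro: vle_mult)

lemma vlt_prod:
  assumes "finite A" "\<And>i. i \<in> A \<Longrightarrow> f i \<preceq> g i" "\<And>i. i \<in> A \<Longrightarrow> g i \<noteq> 0" "j \<in> A" "f j \<prec> g j"
  shows "prod f A \<prec> prod g A"
proof -
  have "f j * prod f (A - {j}) \<prec> g j * prod g (A - {j})"
    using assms by (intro vlt_vle_mult vle_prod) auto
  then show ?thesis using assms(1,4) by (simp add: prod.remove)
qed

lemma unit_mult: "\<not> x \<prec> 1 \<Longrightarrow> \<not> y \<prec> 1 \<Longrightarrow> \<not> x * y \<prec> 1"
  using vle_mult[of 1 x 1 y] by simp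

lemma unit_power: "\<not> x \<prec> 1 \<Longrightarrow> \<not> x ^ n \<prec> 1"
  using vle_power[of 1 x n] by simp

lemma small_mult: "x \<prec> 1 \<Longrightarrow> y \<in> V \<Longrightarrow> x * y \<prec> 1" "y \<in> V \<Longrightarrow> x \<prec> 1 \<Longrightarrow> y * x \<prec> 1"
  using vlt_vle_mult[of x 1 y 1] by (auto simp: V_iff mult.commute)

lemma small_V: "x \<prec> 1 \<Longrightarrow> x \<in> V"
  by (simp add: V_iff vlt_imp_vle)

lemma unit_cong: "x - y \<prec> 1 \<Longrightarrow> x \<prec> 1 \<longleftrightarrow> y \<prec> 1"
  using vlt_add[of "x - y" 1 y] vlt_diff[of x 1 "x - y"] by auto

subsection \<open>Integral polynomials\<close>

lemma polys_V_poly: "p \<in> polys V \<Longrightarrow> x \<in> V \<Longrightarrow> poly p x \<in> V"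
proof (induction p)
  case (pCons a p)
  have "a \<in> V" "p \<in> polys V"
    using polysD[OF pCons.prems(1), of 0] polysD[OF pCons.prems(1), of "Suc _"] by (auto intro: polysI)
  then show ?case using pCons by (auto intro!: V_add V_mult)
qed simp

lemma polys_V_add: "p \<in> polys V \<Longrightarrow> q \<in> polys V \<Longrightarrow> p + q \<in> polys V"
  and polys_V_mult: "p \<in> polys V \<Longrightarrow> q \<in> polys V \<Longrightarrow> p * q \<in> polys V"
  and polys_V_smult: "a \<in> V \<Longrightarrow> p \<in> polys V \<Longrightarrow> Polynomial.smult a p \<in> polys V"
  and polys_V_pCons: "a \<in> V \<Longrightarrow> p \<in> polys V \<Longrightarrow> pCons a p \<in> polys V"
  and polys_V_pderiv: "p \<in> polys V \<Longrightarrow> pderiv p \<in> polys V"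
  by (auto simp: polys_def coeff_mult coeff_pCons coeff_pderiv simp del: of_nat_Suc
    intro!: V_add V_mult V_sum V_of_nat split: nat.splits)

lemma polys_V_sum: "(\<And>i. i \<in> A \<Longrightarrow> f i \<in> polys V) \<Longrightarrow> sum f A \<in> polys V"
proof (induction A rule: infinite_finite_induct)
  case (insert a A)
  then show ?case using polys_V_add[of "f a" "sum f A"] by simp
qed (auto intro: polysI)

lemma polys_V_prod: "(\<And>i. i \<in> A \<Longrightarrow> f i \<in> polys V) \<Longrightarrow> prod f A \<in> polys V"
proof (induction A rule: infinite_finite_induct)
  case (insert a A)
  then show ?case using polys_V_mult[of "f a" "prod f A"] by simp
qed (auto intro!: polysI simp: one_pCons coeff_pCons split: nat.splits)

text \<open>Induction on the coefficients yields an integral second-order remainder without dividing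
  by 2, so the expansion is valid in every characteristic.\<close>

lemma polys_V_taylor:
  assumes "p \<in> polys V" "x \<in> V" "h \<in> V"
  shows "\<exists>r\<in>V. poly p (x + h) = poly p x + h * (poly (pderiv p) x + h * r)"
  using assms(1)
proof (induction p)
  case (pCons a p)
  have p: "p \<in> polys V" using polysD[OF pCons.prems(1), of "Suc _"] by (auto intro: polysI)
  obtain r where r: "r \<in> V" "poly p (x + h) = poly p x + h * (poly (pderiv p) x + h * r)"
    using pCons.IH[OF p] by blast
  show ?case
  proof (rule bexI[of _ "x * r + poly (pderiv p) x + h * r"])
    show "poly (pCons a p) (x + h) =
      poly (pCons a p) x + h * (poly (pderiv (pCons a p)) x + h * (x * r + poly (pderiv p) x + h * r))"
      unfolding poly_pCons r(2) pderiv_pCons poly_add by (simp add: algebra_simps)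
    show "x * r + poly (pderiv p) x + h * r \<in> V"
      using r(1) assms(2,3) p by (intro V_add V_mult polys_V_poly polys_V_pderiv)
  qed
qed (auto intro: bexI[of _ 0])

lemma poly_V_cong: "p \<in> polys V \<Longrightarrow> x \<in> V \<Longrightarrow> y \<in> V \<Longrightarrow> x - y \<prec> 1 \<Longrightarrow> poly p x - poly p y \<prec> 1"
proof -
  assume *: "p \<in> polys V" "x \<in> V" "y \<in> V" "x - y \<prec> 1"
  obtain r where "r \<in> V" "poly p x = poly p y + (x - y) * (poly (pderiv p) y + (x - y) * r)"
    using polys_V_taylor[OF *(1,3) V_diff[OF *(2,3)]] by auto
  then show ?thesis using *
    by (auto intro!: small_mult(1) V_add V_mult V_diff polys_V_poly polys_V_pderiv)
qed

text \<open>With \<open>h = y - x\<close> the expansion gives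
  \<open>0 = h * (p'(x) + h * r)\<close>, and the second factor is a unit.\<close>

lemma simple_root_unique:
  assumes p: "p \<in> polys V" and V: "x \<in> V" "y \<in> V" and xy: "y - x \<prec> 1"
    and roots: "poly p x = 0" "poly p y = 0" and simple: "\<not> poly (pderiv p) x \<prec> 1"
  shows "y = x"
proof -
  obtain r where r: "r \<in> V" "poly p (x + (y - x)) = poly p x + (y - x) * (poly (pderiv p) x + (y - x) * r)"
    using polys_V_taylor[OF p V(1) V_diff[OF V(2,1)]] by blast
  have "\<not> poly (pderiv p) x + (y - x) * r \<prec> 1"
    using simple unit_cong[of "poly (pderiv p) x + (y - x) * r" "poly (pderiv p) x"] small_mult(1)[OF xy r(1)] by simp
  then have "poly (pderiv p) x + (y - x) * r \<noteq> 0" by force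
  then show ?thesis using r roots by simp
qed

text \<open>Integral closedness: were \<open>b\<close> outside \<open>V\<close>, its inverse would
  be small, but the reversed polynomial is 1 at 0 and hence nonzero at every small argument.\<close>

lemma monic_root_V:
  assumes "p \<in> polys V" "lead_coeff p = 1" "poly p b = 0"
  shows "b \<in> V"
proof (rule ccontr)
  assume b: "b \<notin> V"
  then have c: "inverse b \<prec> 1" "b \<noteq> 0"
    using vle_inverse[of 1 "inverse b"] by (auto simp: V_iff vlt_def)
  have "poly (reflect_poly p) (inverse b) = 0"
    using c assms(3) by (simp add: poly_reflect_poly_nz)
  moreover have "reflect_poly p \<in> polys V" using assms(1) by (auto simp: polys_def coeff_reflect_poly)
  then have "poly (reflect_poly p) (inverse b) - poly (reflect_poly p) 0 \<prec> 1"
    using c by (intro poly_V_cong) (auto intro: small_V)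
  moreover have "poly (reflect_poly p) 0 = 1" using assms(2) by (simp add: poly_0_coeff_0)
  ultimately show False by simp
qed

text \<open>Up to sign the coefficient is an elementary symmetric function of degree
  \<open>size B - j\<close> in the roots; the induction adds one linear factor at a time.\<close>

lemma coeff_prod_small_roots:
  assumes "\<And>b. b \<in># B \<Longrightarrow> b \<prec> e" "j < size B"
  shows "coeff (\<Prod>b\<in>#B. [:- b, 1:]) j \<prec> e ^ (size B - j)"
  using assms
proof (induction B arbitrary: j)
  case (add b B)
  define p where "p = (\<Prod>b\<in>#B. [:- b, 1:])"
  have e: "e \<noteq> 0" "b \<prec> e" using add.prems(1)[of b] vlt_nonzero by auto
  have dp: "coeff p (size B) = 1" using monic_prod_linear[of B] unfolding p_def by metis
  have IH: "coeff p i \<prec> e ^ (size B - i)" if "i < size B" for i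
    using add.IH[OF _ that] add.prems(1) by (simp add: p_def)
  have IH': "coeff p i \<preceq> e ^ (size B - i)" if "i \<le> size B" for i
    using IH[of i] that dp by (cases "i = size B") (auto intro: vlt_imp_vle)
  have "coeff (\<Prod>b\<in>#add_mset b B. [:- b, 1:]) j = - b * coeff p j + (if j = 0 then 0 else coeff p (j - 1))"
    by (simp add: p_def coeff_pCons split: nat.splits)
  moreover have "- b * coeff p j \<prec> e ^ (size (add_mset b B) - j)"
  proof -
    have "b * coeff p j \<prec> e * e ^ (size B - j)"
      using add.prems(2) e by (intro vlt_vle_mult IH') auto
    then show ?thesis using add.prems(2) by (simp add: Suc_diff_le)
  qed
  moreover have "(if j = 0 then 0 else coeff p (j - 1)) \<prec> e ^ (size (add_mset b B) - j)"
    using IH[of "j - 1"] add.prems(2) e by (auto simp: Suc_diff_le)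
  ultimately show ?case by (metis vlt_add)
qed simp

end

section \<open>Henselian subfields\<close>

context valued
begin

definition nagata :: "'a poly \<Rightarrow> bool" where
  "nagata P \<longleftrightarrow> (\<exists>n R. P = Polynomial.monom 1 n * [:1, 1:] + R \<and> (\<forall>i. coeff R i \<prec> 1) \<and> degree R < Suc n)"

text \<open>Every instance of Hensel's Lemma reduces to a polynomial
  \<open>X\<^sup>n\<^sup>+\<^sup>1 + X\<^sup>n + c\<^sub>n\<^sub>-\<^sub>1 X\<^sup>n\<^sup>-\<^sup>1 + \<dots> + c\<^sub>0\<close> with \<open>\<bar>c\<^sub>i\<bar> < 1\<close> and its root near \<open>-1\<close>. (For \<open>c\<^sub>n\<close>
  the bound is all that is needed.)\<close>

definition hens :: "'a set \<Rightarrow> bool" where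
  "hens F \<longleftrightarrow> subfld F \<and> (\<forall>P\<in>polys F. nagata P \<longrightarrow> (\<exists>b\<in>F. poly P b = 0 \<and> \<not> b \<prec> 1))"

text \<open>\<open>uni F\<close> says that the valuation of \<open>F\<close> has only one extension to its algebraic closure, in the
  form that conjugate elements have the same absolute value.\<close>

definition uni :: "'a set \<Rightarrow> bool" where
  "uni F \<longleftrightarrow> (\<forall>x x'. alg F x \<longrightarrow> conj F x x' \<longrightarrow> x' \<preceq> x)"

text \<open>Modulo the maximal ideal \<open>P\<close> is \<open>X^n * (X + 1)\<close>. A root that
  is not small therefore reduces to -1, where the derivative reduces to \<open>b^n\<close>, a
  unit.\<close>

lemma nagata_props:
  assumes "nagata P"
  shows "P \<in> polys V" "lead_coeff P = 1" "P \<noteq> 0"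
    "poly P b = 0 \<Longrightarrow> b \<in> V"
    "poly P b = 0 \<Longrightarrow> \<not> b \<prec> 1 \<Longrightarrow> b + 1 \<prec> 1"
    "poly P b = 0 \<Longrightarrow> \<not> b \<prec> 1 \<Longrightarrow> \<not> poly (pderiv P) b \<prec> 1"
proof -
  obtain n R where P: "P = Polynomial.monom 1 n * [:1, 1:] + R" and R: "\<forall>i. coeff R i \<prec> 1" "degree R < Suc n"
    using assms unfolding nagata_def by blast
  let ?M = "Polynomial.monom 1 n :: 'a poly"
  have MV: "?M \<in> polys V" by (auto simp: polys_def)
  have RV: "R \<in> polys V" using R by (auto simp: polys_def intro: small_V)
  show PV: "P \<in> polys V" unfolding P by (intro polys_V_add polys_V_mult polys_V_pCons MV RV) (auto simp: polys_def)
  have "degree (?M * [:1, 1:]) = Suc n"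
    by (subst degree_mult_eq) (auto simp: degree_monom_eq)
  then have deg: "degree P = Suc n" unfolding P using R(2) by (subst degree_add_eq_left) auto
  then have "lead_coeff P = coeff (?M * [:1, 1:]) (Suc n)" using R(2) by (simp add: P coeff_eq_0)
  also have "\<dots> = 1" by (simp add: coeff_monom_mult)
  finally show lc: "lead_coeff P = 1" .
  then show "P \<noteq> 0" by auto
  show bV: "b \<in> V" if "poly P b = 0" for b using monic_root_V[OF PV lc that] .
  have Rb: "poly Q b \<prec> 1" if "b \<in> V" "\<forall>i. coeff Q i \<prec> 1" for b Q
    using that(2)
  proof (induction Q)
    case (pCons a Q)
    have "a \<prec> 1" "\<forall>i. coeff Q i \<prec> 1" using pCons.prems by (metis coeff_pCons_0, metis coeff_pCons_Suc)
    then show ?case using pCons.IH that(1) by (auto intro!: vlt_add small_mult)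
  qed auto
  show b1: "b + 1 \<prec> 1" if b: "poly P b = 0" "\<not> b \<prec> 1" for b
  proof (rule ccontr)
    assume "\<not> b + 1 \<prec> 1"
    then have "\<not> b ^ n * (b + 1) \<prec> 1" using b(2) by (intro unit_mult unit_power) auto
    moreover have "b ^ n * (b + 1) = - poly R b"
      using b(1) by (simp add: P poly_monom eq_neg_iff_add_eq_0 algebra_simps)
    ultimately show False using Rb[OF bV[OF b(1)] R(1)] by simp
  qed
  show "\<not> poly (pderiv P) b \<prec> 1" if b: "poly P b = 0" "\<not> b \<prec> 1" for b
  proof -
    have R': "\<forall>i. coeff (pderiv R) i \<prec> 1" using R(1) by (auto simp: coeff_pderiv simp del: of_nat_Suc intro!: small_mult V_of_nat)
    have "poly (pderiv P) b - b ^ n = (b + 1) * poly (pderiv ?M) b + poly (pderiv R) b"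
      by (simp add: P pderiv_add pderiv_mult pderiv_pCons poly_monom algebra_simps)
    moreover have "\<dots> \<prec> 1"
      using vlt_add[OF small_mult(1)[OF b1[OF b] polys_V_poly[OF polys_V_pderiv[OF MV] bV[OF b(1)]]]
        Rb[OF bV[OF b(1)] R']] .
    ultimately show ?thesis using unit_cong[of "poly (pderiv P) b" "b ^ n"] unit_power[OF b(2)] by simp
  qed
qed

text \<open>The coefficient of \<open>X^n\<close> is minus the sum of the roots and is congruent to
  1, so not all roots can be small.\<close>

lemma nagata_unit_root_exists:
  assumes "nagata P"
  obtains b where "poly P b = 0" "\<not> b \<prec> 1"
proof -
  obtain n R where P: "P = Polynomial.monom 1 n * [:1, 1:] + R" and R: "\<forall>i. coeff R i \<prec> 1" "degree R < Suc n"
    using assms unfolding nagata_def by blast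
  obtain A where A: "size A = degree P" "P = (\<Prod>a\<in>#A. [:- a, 1:])" "set_mset A = {x. poly P x = 0}"
    by (rule alg_closed_split[OF nagata_props(2)[OF assms]])
  have "\<exists>b\<in>#A. \<not> b \<prec> 1"
  proof (rule ccontr)
    assume "\<not> ?thesis"
    then have *: "b \<prec> 1" if "b \<in># A" for b using that by blast
    have "coeff P n = 1 + coeff R n" by (simp add: P coeff_monom_mult coeff_pCons split: nat.splits)
    moreover have "\<not> 1 + coeff R n \<prec> 1" using unit_cong[of "1 + coeff R n" 1] R by auto
    moreover have "coeff P n \<prec> 1 ^ (size A - n)"
    proof -
      have "coeff P (Suc n) \<noteq> 0" using R(2) by (simp add: P coeff_monom_mult coeff_eq_0)
      then have "n < size A" using A(1) le_degree by fastforce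
      then show ?thesis using coeff_prod_small_roots[of A 1 n] * A(2) by simp
    qed
    ultimately show False by (simp add: vlt_def)
  qed
  then show thesis using A(3) that by blast
qed

lemma uni_alg_ext:
  assumes "subfld K" "uni K" "K \<subseteq> F" "\<And>u. u \<in> F \<Longrightarrow> alg K u"
  shows "uni F"
  unfolding uni_def
proof (intro allI impI)
  fix x x' assume x: "alg F x" "conj F x x'"
  have "alg K x"
    using x(1) polys_mono[of F "{y. alg K y}"] assms(4) subfld.alg_trans[OF assms(1)] unfolding alg_def by blast
  then show "x' \<preceq> x" using conj_mono[OF assms(3) x(2)] assms(2) unfolding uni_def by blast
qed

text \<open>\<open>G\<close> may be any polynomial over \<open>K\<close>, not only the minimal one:
  the conjugates of \<open>x\<close> over a field containing \<open>K\<close> are among its roots,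
  so the gap applies to them.\<close>

definition rigid :: "'a set \<Rightarrow> 'a \<Rightarrow> bool" where
  "rigid K x \<longleftrightarrow> (\<exists>G\<in>polys K. poly G x = 0 \<and> poly (pderiv G) x \<noteq> 0 \<and>
    (\<forall>x'. poly G x' = 0 \<longrightarrow> x' - x \<prec> x \<longrightarrow> x' = x))"

lemma rigid_sep: "rigid K x \<Longrightarrow> sep K x"
  unfolding rigid_def sep_def by blast

text \<open>Translating by \<open>w\<close> in \<open>F\<close> turns conjugates into conjugates, so
  \<open>x' - w\<close> is as small as \<open>x - w\<close> and \<open>x'\<close> falls into the gap
  around \<open>x\<close>. Separability then leaves degree 1 for an element without other
  conjugates.\<close>

lemma krasner:
  assumes F: "subfld F" "uni F" and K: "K \<subseteq> F" "rigid K x" and w: "w \<in> F" "x - w \<prec> x"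
  shows "x \<in> F"
proof -
  interpret F: subfld F by fact
  obtain G where G: "G \<in> polys K" "poly G x = 0" "poly (pderiv G) x \<noteq> 0"
      "\<And>x'. poly G x' = 0 \<Longrightarrow> x' - x \<prec> x \<Longrightarrow> x' = x"
    using K(2) unfolding rigid_def by blast
  have sep: "sep F x" using sep_mono[OF K(1) rigid_sep[OF K(2)]] .
  then obtain q where q: "minp F x q" using F.minp_exists sep_alg by blast
  have "x' = x" if "poly q x' = 0" for x'
  proof (rule G(4))
    have c: "conj F x x'" using F.minp_conj_iff[OF q] that by simp
    then show "poly G x' = 0" using G(1,2) polys_mono[OF K(1)] unfolding conj_def by blast
    have "conj F (x - w) (x' - w)"
      unfolding conj_def
    proof (intro ballI impI)
      fix g assume g: "g \<in> polys F" "poly g (x - w) = 0"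
      have "pcompose g [:- w, 1:] \<in> polys F" using g(1) w(1) by auto
      moreover have "poly (pcompose g [:- w, 1:]) x = 0" using g(2) by (simp add: poly_pcompose)
      ultimately have "poly (pcompose g [:- w, 1:]) x' = 0" using c unfolding conj_def by blast
      then show "poly g (x' - w) = 0" by (simp add: poly_pcompose)
    qed
    moreover have "alg F (x - w)"
      using subfld.diff[OF F.algs_subfld] sep_alg[OF sep] F.alg_mem[OF w(1)] by blast
    ultimately have "x' - w \<prec> x" using F(2) w(2) unfolding uni_def by (blast intro: vle_vlt_trans)
    then show "x' - x \<prec> x" using vlt_diff[OF _ w(2), of "x' - w"] by (simp add: vlt_diff)
  qed
  then have "{y. poly q y = 0} = {x}" using minpD(3)[OF q] by blast
  moreover have "card {y. poly q y = 0} = degree q"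
    using F.minp_coprime[OF q] F.sep_iff_minp[OF q] minpD(1,2)[OF q] sep by (intro card_simple_roots) auto
  ultimately show ?thesis using F.minp_degree_1[OF q] by simp
qed

end

section \<open>Uniqueness of the extension of a henselian valuation\<close>

definition char_exp :: "'a::field itself \<Rightarrow> nat" where
  "char_exp _ = (if CHAR('a) = 0 then 1 else CHAR('a))"

text \<open>The purely inseparable closure of \<open>K\<close>. In characteristic 0 the exponent
  \<open>char_exp\<close> is 1 and the set is \<open>K\<close>, so both cases are treated
  alike.\<close>

definition insep :: "'a::field set \<Rightarrow> 'a set" where
  "insep K = {u. \<exists>s. u ^ (char_exp TYPE('a) ^ s) \<in> K}"

lemma char_exp_pos: "char_exp TYPE('a::field) > 0"
  by (simp add: char_exp_def)

lemma char_exp_sum: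
  fixes f :: "'b \<Rightarrow> 'a::{comm_ring_1,semiring_no_zero_divisors}"
  assumes "CHAR('a) = CHAR('c::field)"
  shows "sum f A ^ (char_exp TYPE('c) ^ s) = (\<Sum>i\<in>A. f i ^ (char_exp TYPE('c) ^ s))"
proof (cases "CHAR('c) = 0")
  case False
  then have "prime CHAR('a)" using assms prime_CHAR_semidom[where 'a='c] by simp
  from freshmans_dream_sum'[OF this refl, of f A s] show ?thesis
    using False assms by (simp add: char_exp_def)
qed (simp add: char_exp_def)

context subfld
begin

lemma insep_incl: "F \<subseteq> insep F"
  unfolding insep_def by (auto intro: exI[of _ 0])

lemma insep_raise:
  assumes "u ^ (char_exp TYPE('a) ^ s) \<in> F" "s \<le> t" shows "u ^ (char_exp TYPE('a) ^ t) \<in> F"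
proof -
  have "u ^ (char_exp TYPE('a) ^ t) = (u ^ (char_exp TYPE('a) ^ s)) ^ (char_exp TYPE('a) ^ (t - s))"
    using assms(2) by (simp flip: power_mult power_add)
  then show ?thesis using assms(1) by simp
qed

lemma insep_subfld: "subfld (insep F)"
proof
  show "1 \<in> insep F" using insep_incl by auto
next
  fix x y assume "x \<in> insep F" "y \<in> insep F"
  then obtain s t where "x ^ (char_exp TYPE('a) ^ s) \<in> F" "y ^ (char_exp TYPE('a) ^ t) \<in> F"
    by (auto simp: insep_def)
  then have *: "x ^ (char_exp TYPE('a) ^ max s t) \<in> F" "y ^ (char_exp TYPE('a) ^ max s t) \<in> F"
    using insep_raise by (meson max.cobounded1 max.cobounded2)+
  then show "x * y \<in> insep F" unfolding insep_def by (auto simp: power_mult_distrib intro: exI[of _ "max s t"])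
  let ?q = "char_exp TYPE('a) ^ max s t"
  have "(\<Sum>i\<in>{False, True}. if i then x - y else y) ^ ?q = (\<Sum>i\<in>{False, True}. (if i then x - y else y) ^ ?q)"
    by (rule char_exp_sum) simp
  then have "(x - y) ^ ?q = x ^ ?q - y ^ ?q" by (simp add: algebra_simps)
  then show "x - y \<in> insep F" unfolding insep_def using * by (auto intro!: exI[of _ "max s t"])
next
  show "inverse x \<in> insep F" if "x \<in> insep F" for x
    using that unfolding insep_def by (auto simp: power_inverse)
qed

text \<open>A large enough power of the characteristic exponent works for all coefficients at once,
  and raising to it acts on each term of a polynomial separately.\<close>

lemma polys_insep_power:
  assumes "g \<in> polys (insep F)"
  obtains m where "m > 0" "g ^ m \<in> polys F"
proof -
  have "\<exists>s. coeff g i ^ (char_exp TYPE('a) ^ s) \<in> F" for i using polysD[OF assms, of i] by (simp add: insep_def)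
  then obtain s where s: "\<And>i. coeff g i ^ (char_exp TYPE('a) ^ s i) \<in> F" by metis
  define t where "t = Max (s ` {..degree g})"
  let ?m = "char_exp TYPE('a) ^ t"
  have t: "coeff g i ^ ?m \<in> F" if "i \<le> degree g" for i
    using insep_raise[OF s, of i t] that by (simp add: t_def)
  have "g ^ ?m = (\<Sum>i\<le>degree g. Polynomial.monom (coeff g i) i) ^ ?m" by (simp only: poly_as_sum_of_monoms)
  also have "\<dots> = (\<Sum>i\<le>degree g. Polynomial.monom (coeff g i) i ^ ?m)"
    by (rule char_exp_sum) simp
  also have "\<dots> \<in> polys F" using t by (intro polys_sum) (simp add: monom_power)
  finally show thesis by (rule that[rotated]) (simp add: char_exp_pos)
qed

text \<open>Dividing \<open>g - g(t)\<close> by \<open>X - t\<close> gives the difference quotients,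
  which again take values in \<open>F\<close> at the remaining points, and lowers the
  degree.\<close>

lemma interpolation:
  assumes "infinite T" "T \<subseteq> F" "\<And>t. t \<in> T \<Longrightarrow> poly g t \<in> F"
  shows "g \<in> polys F"
  using assms
proof (induction "degree g" arbitrary: g T)
  case 0
  then obtain a where g: "g = [:a:]" by (metis degree_eq_zeroE)
  obtain t where "t \<in> T" using 0(2) by (metis finite.emptyI equals0I)
  then show ?case using 0(4)[of t] g by simp
next
  case (Suc n)
  obtain t where t: "t \<in> T" using Suc.prems(1) by (metis finite.emptyI equals0I)
  define h where "h = (g - [:poly g t:]) div [:- t, 1:]"
  have "[:- t, 1:] dvd g - [:poly g t:]" by (simp add: poly_eq_0_iff_dvd[symmetric])
  then have gh: "g - [:poly g t:] = h * [:- t, 1:]" unfolding h_def by (simp only: dvd_div_mult_self)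
  have "h \<noteq> 0"
  proof
    assume "h = 0"
    then have "g = [:poly g t:]" using gh by simp
    then have "degree g = degree [:poly g t:]" by (rule arg_cong)
    then show False using Suc.hyps(2) by simp
  qed
  have "degree (g - [:poly g t:]) = Suc n"
    using Suc.hyps(2) degree_add_eq_left[of "- [:poly g t:]" g]
    unfolding diff_conv_add_uminus by simp
  then have "degree h = n" using gh \<open>h \<noteq> 0\<close> by (simp add: degree_mult_eq del: mult_pCons_right)
  have "poly h u \<in> F" if u: "u \<in> T - {t}" for u
  proof -
    have "poly g u - poly g t = poly h u * (u - t)"
      using arg_cong[OF gh, of "\<lambda>p. poly p u"] by (simp add: algebra_simps)
    then have "poly h u = (poly g u - poly g t) / (u - t)" using u by simp
    then show ?thesis using u t Suc.prems by auto
  qed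
  then have "h \<in> polys F" using Suc.hyps(1)[of h "T - {t}"] \<open>degree h = n\<close> Suc.prems(1,2) by auto
  moreover have "g = h * [:- t, 1:] + [:poly g t:]" using gh by (simp add: algebra_simps)
  ultimately show ?case using t Suc.prems(2,3)
    by (metis polys_add polys_mult polys_pCons polys_0 one uminus subsetD)
qed

end

context valued
begin

text \<open>The substitution \<open>X = c * Y\<close>, with \<open>c\<close> the coefficient below
  the leading one, normalizes \<open>q\<close> to a Nagata polynomial. This \<open>c\<close> is
  minus the sum of the roots: it lies in \<open>K\<close>, and by dominance it has the absolute
  value of \<open>\<eta>\<close>. A root of \<open>q\<close> that is not smaller than
  \<open>\<eta>\<close> can only be \<open>\<eta>\<close>.\<close>

lemma hens_dominant_root_sep:
  assumes K: "hens K" and q: "minp K \<eta> q" "sep K \<eta>" and dom: "\<And>a. poly q a = 0 \<Longrightarrow> a \<noteq> \<eta> \<Longrightarrow> a \<prec> \<eta>"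
  shows "\<eta> \<in> K"
proof -
  interpret K: subfld K using K by (simp add: hens_def)
  note qD = minpD[OF q(1)]
  obtain A where A: "size A = degree q" "q = (\<Prod>a\<in>#A. [:- a, 1:])" "set_mset A = {x. poly q x = 0}"
    by (rule alg_closed_split[OF qD(2)])
  obtain B where B: "A = add_mset \<eta> B" using A(3) qD(3) by (metis mem_Collect_eq mset_add)
  have "\<eta> \<notin># B"
  proof
    assume "\<eta> \<in># B"
    then obtain C where C: "B = add_mset \<eta> C" by (meson mset_add)
    have *: "poly (pderiv (L * (L * R))) \<eta> = 0" if "poly L \<eta> = 0" for L R :: "'a poly"
      using that by (simp add: pderiv_mult)
    have "q = [:- \<eta>, 1:] * ([:- \<eta>, 1:] * (\<Prod>a\<in>#C. [:- a, 1:]))"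
      using A(2) unfolding B C by (simp only: image_mset_add_mset prod_mset.add_mset)
    then have "poly (pderiv q) \<eta> = 0" using *[of "[:- \<eta>, 1:]"] by simp
    then show False using K.sep_iff_minp[OF q(1)] q(2) by blast
  qed
  then have Bd: "b \<prec> \<eta>" if "b \<in># B" for b using dom[of b] A(3) B that by auto
  define p where "p = (\<Prod>a\<in>#B. [:- a, 1:])"
  define m where "m = size B"
  have p: "degree p = m" "lead_coeff p = 1" unfolding p_def m_def by (rule monic_prod_linear)+
  have qp: "q = [:- \<eta>, 1:] * p" using A(2) unfolding B p_def by (simp only: image_mset_add_mset prod_mset.add_mset)
  have dq: "degree q = Suc m" using A(1) B by (simp add: m_def)
  show ?thesis
  proof (cases "m = 0")
    case True
    then show ?thesis using K.minp_degree_1[OF q(1)] dq by simp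
  next
    case False
    then have e0: "\<eta> \<noteq> 0" using Bd vlt_nonzero by (metis m_def multiset_nonemptyE size_empty)
    have small: "coeff p j \<prec> \<eta> ^ (m - j)" if "j < m" for j
      using coeff_prod_small_roots[of B \<eta> j] Bd that by (simp add: p_def m_def)
    have cq: "coeff q i = - \<eta> * coeff p i + (if i = 0 then 0 else coeff p (i - 1))" for i
      by (simp add: qp coeff_pCons split: nat.splits)
    define c where "c = coeff q m"
    have c: "c = - \<eta> + coeff p (m - 1)" using False p by (simp add: c_def cq)
    have "coeff p (m - 1) \<prec> \<eta>" using small[of "m - 1"] False by simp
    then have ce: "c \<preceq> \<eta>" "\<eta> \<preceq> c"
      using vle_add_dominant[of "coeff p (m - 1)" "- \<eta>"] by (simp_all add: c)
    have c0: "c \<noteq> 0" using ce(2) e0 by auto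
    have cK: "c \<in> K" using qD(1) by (simp add: c_def polysD)
    \<comment> \<open>Dividing by \<open>c^(m+1)\<close> makes both top coefficients 1: the leading
      one is \<open>c^(m+1) / c^(m+1)\<close>, the next one
      \<open>c * c^m / c^(m+1)\<close>.\<close>
    define P where "P = Polynomial.smult (1 / c ^ Suc m) (pcompose q [:0, c:])"
    have coeffP: "coeff P i = coeff q i * c ^ i / c ^ Suc m" for i
    proof -
      have "[:0, c:] = Polynomial.monom c (Suc 0)" by (simp add: monom_Suc monom_0)
      then show ?thesis by (simp add: P_def coeff_pcompose_monom_linear)
    qed
    have PK: "P \<in> polys K" using cK qD(1) by (auto simp: P_def)
    have cm: "coeff q i * c ^ i \<prec> c ^ Suc m" if i: "i < m" for i
    proof -
      have "\<eta> * coeff p i \<prec> \<eta> * \<eta> ^ (m - i)" by (rule vle_vlt_mult[OF vle_refl small[OF i] e0])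
      moreover have "(if i = 0 then 0 else coeff p (i - 1)) \<prec> \<eta> ^ (Suc m - i)"
        using small[of "i - 1"] i e0 by (auto simp: Suc_diff_le)
      ultimately have "coeff q i \<prec> \<eta> ^ (Suc m - i)"
        unfolding cq using i by (intro vlt_add) (simp_all add: Suc_diff_le)
      also have "\<dots> \<preceq> c ^ (Suc m - i)" by (rule vle_power[OF ce(2)])
      finally have "coeff q i * c ^ i \<prec> c ^ (Suc m - i) * c ^ i" using c0 by (simp add: vlt_mult_cancel)
      then show ?thesis using i by (simp flip: power_add)
    qed
    have "nagata P"
      unfolding nagata_def
    proof (intro exI conjI allI)
      let ?R = "P - Polynomial.monom 1 m * [:1, 1:]"
      show "P = Polynomial.monom 1 m * [:1, 1:] + ?R" by simp
      have M: "coeff (Polynomial.monom 1 m * [:1, 1:] :: 'a poly) i = (if i = m \<or> i = Suc m then 1 else 0)" for i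
        by (auto simp: coeff_monom_mult coeff_pCons split: nat.splits)
      have top: "coeff P m = 1" "coeff P (Suc m) = 1" "i > Suc m \<Longrightarrow> coeff P i = 0" for i
        using c0 dq qD(2) by (auto simp: coeffP c_def coeff_eq_0)
      have R: "coeff ?R i = (if i < m then coeff P i else 0)" for i
        unfolding coeff_diff M using top by (cases "i < m"; cases "i = m"; cases "i = Suc m") auto
      show "coeff ?R i \<prec> 1" for i
        unfolding R using cm[of i] c0 by (auto simp: coeffP vlt_divide)
      have "degree ?R \<le> m" by (intro degree_le) (simp only: R, simp)
      then show "degree ?R < Suc m" by simp
    qed
    then obtain b where b: "b \<in> K" "poly P b = 0" "\<not> b \<prec> 1" using K PK unfolding hens_def by blast
    have "poly q (c * b) = 0" using b(2) c0 by (simp add: P_def poly_pcompose mult.commute)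
    moreover have "\<not> c * b \<prec> \<eta>"
    proof -
      have "\<eta> * 1 \<preceq> c * b" using ce(2) b(3) by (intro vle_mult) auto
      then show ?thesis by simp
    qed
    ultimately have "c * b = \<eta>" using dom by blast
    then show ?thesis using cK b(1) by auto
  qed
qed

text \<open>Induction on the degree. In the inseparable case \<open>q\<close> is a polynomial in
  \<open>X^p\<close>; conjugates of \<open>\<eta>^p\<close> are \<open>p\<close>-th powers of
  conjugates of \<open>\<eta>\<close>, so dominance passes to an element of smaller degree.\<close>

lemma hens_dominant_root:
  assumes K: "hens K"
  shows "minp K \<eta> q \<Longrightarrow> (\<And>a. conj K \<eta> a \<Longrightarrow> a \<noteq> \<eta> \<Longrightarrow> a \<prec> \<eta>) \<Longrightarrow> \<eta> \<in> insep K"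
proof (induction "degree q" arbitrary: \<eta> q rule: less_induct)
  case less
  interpret K: subfld K using K by (simp add: hens_def)
  note q = less.prems(1)
  show ?case
  proof (cases "sep K \<eta>")
    case True
    have "\<eta> \<in> K"
      using hens_dominant_root_sep[OF K q True] less.prems(2) K.minp_conj_iff[OF q] by blast
    then show ?thesis using K.insep_incl by blast
  next
    case False
    let ?P = "CHAR('a)"
    have pq: "pderiv q = 0" using K.minp_pderiv_zero[OF q False] .
    have P: "?P > 0"
      using False K.sepI_pth_power[of \<eta>] minpD[OF q] unfolding alg_def by blast
    have ce: "char_exp TYPE('a) = ?P" using P by (simp add: char_exp_def)
    obtain r where r: "q = pcompose r (Polynomial.monom 1 ?P)" "r \<in> polys K"
      using pderiv_zero_pcompose[OF pq P] minpD(1)[OF q] K.zero by metis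
    have r0: "r \<noteq> 0" using minpD(4)[OF q] r(1) by auto
    have rq: "poly q y = poly r (y ^ ?P)" for y by (simp add: r(1) poly_pcompose poly_monom)
    have root: "poly r (\<eta> ^ ?P) = 0" using minpD(3)[OF q] rq by simp
    then have "alg K (\<eta> ^ ?P)" using r(2) r0 by (auto simp: alg_def)
    then obtain q' where q': "minp K (\<eta> ^ ?P) q'" by (rule K.minp_exists)
    have "degree q' \<le> degree r" using minpD(5)[OF q' r(2) root r0] .
    also have "degree r < degree q"
    proof -
      have "degree q = degree r * ?P" by (simp add: r(1) degree_pcompose degree_monom_eq)
      moreover have "?P > 1" using prime_CHAR_semidom[OF P] by (rule prime_gt_1_nat)
      ultimately show ?thesis using K.minp_degree_pos[OF q] by auto
    qed
    finally have deg: "degree q' < degree q" .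
    have "\<eta> ^ ?P \<in> insep K"
    proof (rule less.hyps[OF deg q'])
      fix a assume a: "conj K (\<eta> ^ ?P) a" "a \<noteq> \<eta> ^ ?P"
      obtain y where y: "y ^ ?P = a" using nth_root_exists[OF P] by blast
      have "poly r a = 0" using a(1) r(2) root unfolding conj_def by blast
      then have "conj K \<eta> y" using K.minp_conj_iff[OF q] rq y by simp
      moreover have "y \<noteq> \<eta>" using a(2) y by auto
      ultimately have "y \<prec> \<eta>" by (rule less.prems(2))
      then show "a \<prec> \<eta> ^ ?P" using vlt_power[OF _ P] y by blast
    qed
    then obtain s where "(\<eta> ^ ?P) ^ (?P ^ s) \<in> K" by (auto simp: insep_def ce)
    then have "\<eta> ^ (?P ^ Suc s) \<in> K" by (simp add: power_mult)
    then show ?thesis unfolding insep_def ce by blast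
  qed
qed

end

context valued
begin

lemma vle_maximum: "finite R \<Longrightarrow> R \<noteq> {} \<Longrightarrow> \<exists>r\<in>R. \<forall>a\<in>R. a \<preceq> r"
proof (induction R rule: finite_ne_induct)
  case (insert x R)
  then obtain r where r: "r \<in> R" "\<forall>a\<in>R. a \<preceq> r" by blast
  then show ?case using vle_total[of x r] vle_trans by (metis insert_iff vle_refl)
qed simp

lemma minp_zero_root:
  assumes "subfld K" "minp K 0 q" "poly q a = 0" shows "a = 0"
proof -
  interpret subfld K by fact
  have "q dvd [:0, 1:]" using minp_dvd[OF assms(2)] by simp
  then have "poly [:0, 1:] a = 0" using assms(3) by (metis dvdE mult_zero_left poly_mult)
  then show ?thesis by simp
qed

text \<open>Supplies the points for interpolation. A nonzero element of \<open>K\<close> below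
  \<open>r\<close> is \<open>\<tau>\<close> itself if \<open>r\<close> has absolute value at least
  1; otherwise it is \<open>\<tau>\<close> times the constant term of \<open>q\<close>, which is the
  product of all roots up to sign and so bounded by \<open>r\<close>. Multiplying by powers of
  \<open>\<tau>\<close> gives infinitely many.\<close>

lemma infinite_below_root:
  assumes K: "subfld K" and t: "\<tau> \<in> K" "\<tau> \<noteq> 0" "\<tau> \<prec> 1"
    and q: "minp K r q" and r: "r \<noteq> 0" "\<And>a. poly q a = 0 \<Longrightarrow> a \<preceq> r"
  shows "infinite {t \<in> K. t \<prec> r}"
proof -
  interpret K: subfld K by fact
  note qD = minpD[OF q]
  have "\<exists>t0\<in>K. t0 \<noteq> 0 \<and> t0 \<prec> r"
  proof (cases "1 \<preceq> r")
    case True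
    then show ?thesis using t vlt_vle_trans by blast
  next
    case False
    obtain A where A: "size A = degree q" "q = (\<Prod>a\<in>#A. [:- a, 1:])" "set_mset A = {x. poly q x = 0}"
      by (rule alg_closed_split[OF qD(2)])
    obtain B where B: "A = add_mset r B" using A(3) qD(3) by (metis mem_Collect_eq mset_add)
    have "poly (\<Prod>a\<in>#B. [:- a, 1:]) 0 \<preceq> 1"
    proof -
      have "b \<preceq> 1" if "b \<in># B" for b
      proof -
        have "b \<preceq> r" using r(2)[of b] that A(3) B by auto
        also have "r \<preceq> 1" using False vle_total by blast
        finally show ?thesis .
      qed
      then show ?thesis
      proof (induction B)
        case (add b B)
        then have "- b * poly (\<Prod>a\<in>#B. [:- a, 1:]) 0 \<preceq> 1 * 1" by (intro vle_mult) auto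
        then show ?case by simp
      qed simp
    qed
    moreover have "poly q 0 = - r * poly (\<Prod>a\<in>#B. [:- a, 1:]) 0" using A(2) by (simp add: B)
    ultimately have le: "poly q 0 \<preceq> r" using vle_mult[of "- r" r "poly (\<Prod>a\<in>#B. [:- a, 1:]) 0" 1] by simp
    have ne: "poly q 0 \<noteq> 0"
      using minp_zero_root[OF K K.minp_root[OF q] qD(3)] r(1) by blast
    have "poly q 0 * \<tau> \<prec> r * 1" by (rule vle_vlt_mult[OF le t(3) r(1)])
    moreover have "poly q 0 \<in> K" using qD(1) by auto
    ultimately show ?thesis using t ne by (intro bexI[of _ "poly q 0 * \<tau>"]) auto
  qed
  then obtain t0 where t0: "t0 \<in> K" "t0 \<noteq> 0" "t0 \<prec> r" by blast
  have "inj (\<lambda>k. t0 * \<tau> ^ k)"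
  proof (rule linorder_injI)
    fix i j :: nat assume "i < j"
    then obtain k where k: "j = i + k" "k > 0" using less_imp_add_positive by blast
    have "\<tau> ^ k \<prec> 1" using vlt_power[OF t(3) k(2)] by simp
    then have "\<tau> ^ k \<noteq> 1" by auto
    then show "t0 * \<tau> ^ i \<noteq> t0 * \<tau> ^ j" using k t0 t by (auto simp: power_add)
  qed
  then have "infinite (range (\<lambda>k. t0 * \<tau> ^ k))" by (simp add: finite_image_iff)
  moreover have "t0 * \<tau> ^ k \<prec> r" for k
    using vlt_vle_mult[OF t0(3) vle_power[OF vlt_imp_vle[OF t(3)]], of k] by simp
  then have "range (\<lambda>k. t0 * \<tau> ^ k) \<subseteq> {t \<in> K. t \<prec> r}" using t0 t by auto
  ultimately show ?thesis using finite_subset by blast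
qed

text \<open>Let \<open>S\<close> be the set of roots of largest absolute value of the minimal polynomial of \<open>x\<close>. For small
  \<open>t \<in> K\<close> the element \<open>\<Prod>\<^bsub>a\<in>S\<^esub> (t - a)\<close> is larger than all its other conjugates, hence purely
  inseparable over \<open>K\<close>. By interpolation so are the coefficients of \<open>\<Prod>\<^bsub>a\<in>S\<^esub> (X - a)\<close>, and
  irreducibility shows that \<open>S\<close> contains all the roots.\<close>

theorem hens_imp_uni:
  assumes K: "hens K" and t: "\<tau> \<in> K" "\<tau> \<noteq> 0" "\<tau> \<prec> 1"
  shows "uni K"
  unfolding uni_def
proof (intro allI impI)
  fix x x' assume x: "alg K x" "conj K x x'"
  interpret K: subfld K using K by (simp add: hens_def)
  have sK: "subfld K" by (rule K.subfld_axioms)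
  obtain q where q: "minp K x q" using K.minp_exists[OF x(1)] .
  note qD = minpD[OF q]
  define R where "R = {a. poly q a = 0}"
  have finR: "finite R" using qD(4) by (simp add: R_def poly_roots_finite)
  have xR: "x \<in> R" "x' \<in> R" using qD(3) x(2) K.minp_conj_iff[OF q] by (auto simp: R_def)
  obtain r where r: "r \<in> R" "\<forall>a\<in>R. a \<preceq> r" using vle_maximum[OF finR] xR by blast
  have algR: "alg K a" if "a \<in> R" for a using that qD(1,4) by (auto simp: R_def alg_def)
  show "x' \<preceq> x"
  proof (cases "r = 0")
    case True
    then have "x' = 0" using r(2) xR(2) by auto
    then show ?thesis by simp
  next
    case r0: False
    define S where "S = {a \<in> R. r \<preceq> a}"
    have finS: "finite S" using finR by (simp add: S_def)
    define g where "g = (\<Prod>a\<in>S. [:- a, 1:])"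
    have gt: "poly g u = (\<Prod>a\<in>S. u - a)" for u by (simp add: g_def poly_prod)
    have "poly g u \<in> insep K" if u: "u \<in> K" "u \<prec> r" for u
    proof -
      interpret A: subfld "{y. alg K y}" by (rule K.algs_subfld)
      have "poly g u \<in> {y. alg K y}"
        unfolding gt using algR K.alg_mem[OF u(1)] by (intro A.prod A.diff) (auto simp: S_def)
      then have alg: "alg K (poly g u)" by simp
      then obtain qe where qe: "minp K (poly g u) qe" by (rule K.minp_exists)
      obtain xs where xs: "set xs = R" using finite_list[OF finR] by blast
      show ?thesis
      proof (rule hens_dominant_root[OF K qe])
        fix y assume y: "conj K (poly g u) y" "y \<noteq> poly g u"
        obtain E \<sigma> where E: "hom_on E \<sigma>" "K \<subseteq> E" "set xs \<subseteq> E" "poly g u \<in> E" "\<And>a. a \<in> K \<Longrightarrow> \<sigma> a = a" "\<sigma> (poly g u) = y"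
          using conj_hom_exists[OF sK alg y(1), of xs] algR xs by metis
        interpret hom_on E \<sigma> by fact
        have "\<sigma> a \<in> R" if "a \<in> R" for a
        proof -
          have "poly (map_poly id q) (\<sigma> a) = \<sigma> (poly q a)"
            using hom_conj[OF E(2), of id a q] E(3,5) xs that qD(1) by auto
          then show ?thesis using that by (simp add: R_def)
        qed
        then have SR: "\<sigma> ` S \<subseteq> R" by (auto simp: S_def)
        have SE: "S \<subseteq> E" using E(3) xs by (auto simp: S_def)
        then have injS: "inj_on \<sigma> S" using hom_inj inj_on_subset by blast
        have ysig: "y = (\<Prod>a\<in>S. u - \<sigma> a)"
          unfolding E(6)[symmetric] gt using SE subsetD[OF E(2) u(1)] E(5)[OF u(1)]
          by (subst hom_prod) (auto intro!: prod.cong)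
        \<comment> \<open>A homomorphism mapping \<open>S\<close> to itself permutes the factors of
          \<open>poly g u\<close> and fixes it; hence some member of \<open>S\<close> must leave
          \<open>S\<close>.\<close>
        have "\<not> \<sigma> ` S \<subseteq> S"
        proof
          assume "\<sigma> ` S \<subseteq> S"
          then have "\<sigma> ` S = S" using injS finS by (simp add: endo_inj_surj)
          then have "(\<Prod>a\<in>S. u - \<sigma> a) = (\<Prod>a\<in>S. u - a)" using prod.reindex[OF injS, of "\<lambda>a. u - a"] by simp
          then show False using y(2) ysig gt by simp
        qed
        then obtain j where j: "j \<in> S" "\<sigma> j \<notin> S" by blast
        have S1: "r \<preceq> u - a" if "a \<in> S" for a
        proof -
          have "r \<preceq> a" using that by (simp add: S_def)
          also have "a \<preceq> u - a"
            using vle_add_dominant(1)[of u "- a"] vlt_vle_trans[OF u(2) \<open>r \<preceq> a\<close>] by simp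
          finally show ?thesis .
        qed
        have R1: "u - a \<preceq> r" if "a \<in> R" for a
          using r(2) that vlt_imp_vle[OF u(2)] by (intro vle_diff) auto
        \<comment> \<open>Every factor \<open>u - a\<close> with \<open>a\<close> in
          \<open>S\<close> is at least as large as \<open>r\<close>, no factor of the conjugate
          exceeds \<open>r\<close>, and its factor at \<open>j\<close> is strictly smaller.\<close>
        have "y \<prec> (\<Prod>a\<in>S. u - a)"
          unfolding ysig
        proof (rule vlt_prod[OF finS _ _ j(1)])
          show "u - \<sigma> a \<preceq> u - a" if "a \<in> S" for a
            using vle_trans[OF R1 S1[OF that]] SR that by blast
          show "u - a \<noteq> 0" if "a \<in> S" for a using S1[OF that] r0 by auto
          have "\<sigma> j \<prec> r" using SR j by (auto simp: S_def vlt_def)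
          then have "u - \<sigma> j \<prec> r" using u(2) by (intro vlt_diff)
          then show "u - \<sigma> j \<prec> u - j" using S1[OF j(1)] vlt_vle_trans by blast
        qed
        then show "y \<prec> poly g u" by (simp add: gt)
      qed
    qed
    moreover have qr: "minp K r q" using K.minp_root[OF q] r(1) by (simp add: R_def)
    moreover have "infinite {t \<in> K. t \<prec> r}"
      using infinite_below_root[OF sK t qr r0] r(2) by (auto simp: R_def)
    ultimately have "g \<in> polys (insep K)"
      using subfld.interpolation[OF K.insep_subfld, of "{t \<in> K. t \<prec> r}" g] K.insep_incl by blast
    then obtain m where m: "m > 0" "g ^ m \<in> polys K" by (rule K.polys_insep_power)
    have "poly (g ^ m) r = 0"
    proof -
      have "r \<in> S" using r by (simp add: S_def)
      then have "poly g r = 0" using finS by (auto simp: gt)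
      then show ?thesis using m(1) by (simp add: poly_power)
    qed
    then have "q dvd g ^ m" using K.minp_dvd[OF qr m(2)] by simp
    then have "poly (g ^ m) x = 0" using qD(3) by (metis dvdE mult_zero_left poly_mult)
    then have "poly g x = 0" by (simp add: poly_power)
    then have "x \<in> S" using finS by (auto simp: gt)
    then have "r \<preceq> x" by (simp add: S_def)
    then show ?thesis using r(2) xR(2) vle_trans by blast
  qed
qed

end

section \<open>Extension of valuations to the algebraic closure\<close>

locale subrng =
  fixes A :: "'a::field set"
  assumes one [simp]: "1 \<in> A"
    and diff: "x \<in> A \<Longrightarrow> y \<in> A \<Longrightarrow> x - y \<in> A"
    and mult: "x \<in> A \<Longrightarrow> y \<in> A \<Longrightarrow> x * y \<in> A"
begin

lemma zero [simp]: "0 \<in> A"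
  using diff[OF one one] by simp

lemma add: "x \<in> A \<Longrightarrow> y \<in> A \<Longrightarrow> x + y \<in> A"
  using diff[of x "0 - y"] diff[of 0 y] by simp

lemma polys_mult: "p \<in> polys A \<Longrightarrow> q \<in> polys A \<Longrightarrow> p * q \<in> polys A"
proof -
  assume *: "p \<in> polys A" "q \<in> polys A"
  have "(\<Sum>i\<le>n. coeff p i * coeff q (n - i)) \<in> A" for n
  proof -
    have "sum f S \<in> A" if "\<And>i. i \<in> S \<Longrightarrow> f i \<in> A" for f and S :: "nat set"
      using that by (induction S rule: infinite_finite_induct) (auto intro: add)
    note sumA = this
    show ?thesis using * by (intro sumA mult) (auto simp: polys_def)
  qed
  then show ?thesis by (simp add: polys_def coeff_mult)
qed

lemma generated_subrng: "subrng ((\<lambda>p. poly p x) ` polys A)"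
proof
  let ?B = "(\<lambda>p. poly p x) ` polys A"
  show "1 \<in> ?B" by (rule image_eqI[of _ _ 1]) (auto simp: polys_def one_pCons coeff_pCons split: nat.splits)
  fix u w assume "u \<in> ?B" "w \<in> ?B"
  then obtain p q where *: "p \<in> polys A" "q \<in> polys A" "u = poly p x" "w = poly q x" by auto
  show "u - w \<in> ?B" by (rule image_eqI[of _ _ "p - q"]) (use * diff in \<open>auto simp: polys_def\<close>)
  show "u * w \<in> ?B" by (rule image_eqI[of _ _ "p * q"]) (use * polys_mult in auto)
qed

end

text \<open>If both \<open>x\<close> and \<open>x\<^sup>-\<^sup>1\<close> satisfy an equation expressing \<open>1\<close> with coefficients in an ideal \<open>J\<close>,
  then the one of larger degree is not of minimal degree.\<close>

lemma ideal_poly_reduce: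
  fixes x :: "'a::field"
  assumes A: "subrng A" and J: "J \<subseteq> A" "0 \<in> J" "\<And>a b. a \<in> J \<Longrightarrow> b \<in> J \<Longrightarrow> a + b \<in> J" "\<And>a b. a \<in> A \<Longrightarrow> b \<in> J \<Longrightarrow> a * b \<in> J"
    and x: "x \<noteq> 0" and p: "p \<in> polys J" "poly p x = 1" and q: "q \<in> polys J" "poly q (inverse x) = 1"
    and deg: "degree q \<le> degree p" "degree q > 0"
  shows "\<exists>r\<in>polys J. poly r x = 1 \<and> degree r < degree p"
proof -
  interpret subrng A by fact
  define n where "n = degree p"
  define k where "k = degree q"
  have Jadd: "s + t \<in> polys J" if "s \<in> polys J" "t \<in> polys J" for s t using that J(3) by (auto simp: polys_def)
  have Jsmult: "Polynomial.smult a t \<in> polys J" if "a \<in> A" "t \<in> polys J" for a t using that J(4) by (auto simp: polys_def)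
  have Juminus: "- a \<in> J" if "a \<in> J" for a using J(4)[of "0 - 1" a] diff[of 0 1] that by simp
  define b where "b = coeff q 0"
  define c where "c = coeff p n"
  have bJ: "b \<in> J" and cJ: "c \<in> J" using p q by (auto simp: b_def c_def polysD)
  define s where "s = reflect_poly q - Polynomial.monom b k"
  have sc: "coeff s i = (if i < k then coeff q (k - i) else 0)" for i
    by (auto simp: s_def b_def k_def coeff_reflect_poly)
  have sJ: "s \<in> polys J" using q(1) J(2) by (auto simp: polys_def sc)
  have sdeg: "degree s < k"
  proof -
    have "degree s \<le> k - 1" by (rule degree_le) (auto simp: sc)
    then show ?thesis using deg(2) by (simp add: k_def)
  qed
  have "poly (reflect_poly q) x = x ^ k" using x q(2) by (simp add: poly_reflect_poly_nz k_def)
  then have sx: "poly s x = (1 - b) * x ^ k" by (simp add: s_def poly_monom algebra_simps)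
  define p1 where "p1 = p - Polynomial.monom c n"
  have p1c: "coeff p1 i = (if i = n then 0 else coeff p i)" for i by (simp add: p1_def c_def)
  have p1J: "p1 \<in> polys J" using p(1) J(2) by (auto simp: polys_def p1c)
  have "k > 0" "k \<le> n" using deg by (auto simp: k_def n_def)
  have p1deg: "degree p1 < n"
  proof -
    have "degree p1 \<le> n - 1"
      by (rule degree_le) (auto simp: p1c n_def coeff_eq_0)
    then show ?thesis using \<open>k > 0\<close> \<open>k \<le> n\<close> by simp
  qed
  have px: "poly p1 x + c * x ^ n = 1" using p(2) by (simp add: p1_def poly_monom)
  define r where "r = [:b:] + (Polynomial.smult (1 - b) p1 + Polynomial.smult c (Polynomial.monom 1 (n - k) * s))"
  have "poly r x = b + (1 - b) * poly p1 x + c * (x ^ (n - k) * ((1 - b) * x ^ k))"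
    by (simp add: r_def poly_monom sx)
  also have "x ^ (n - k) * ((1 - b) * x ^ k) = (1 - b) * x ^ n"
    using \<open>k \<le> n\<close> by (simp add: mult.left_commute flip: power_add)
  also have "b + (1 - b) * poly p1 x + c * ((1 - b) * x ^ n) = b + (1 - b) * (poly p1 x + c * x ^ n)"
    by (simp add: algebra_simps)
  also have "\<dots> = 1" by (simp add: px)
  finally have "poly r x = 1" .
  moreover have "r \<in> polys J"
  proof -
    have "[:b:] \<in> polys J" using bJ J(2) by (auto simp: polys_def coeff_pCons split: nat.splits)
    moreover have "Polynomial.monom 1 (n - k) * s \<in> polys J" using sJ J(2) by (auto simp: polys_def coeff_monom_mult)
    ultimately show ?thesis unfolding r_def using bJ cJ J(1) p1J by (intro Jadd Jsmult diff) auto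
  qed
  moreover have "degree r < n"
  proof -
    have "degree (Polynomial.monom 1 (n - k) * s) < n"
      using sdeg \<open>k \<le> n\<close> degree_mult_le[of "Polynomial.monom 1 (n - k)" s] by (simp add: degree_monom_eq)
    then show ?thesis unfolding r_def using p1deg \<open>k > 0\<close> \<open>k \<le> n\<close>
      by (intro degree_add_less le_less_trans[OF degree_smult_le]) auto
  qed
  ultimately show ?thesis unfolding n_def by blast
qed

text \<open>Chevalley's extension theorem: a subring \<open>M\<close> maximal among those meeting
  \<open>H\<close> in \<open>A\<close> is a valuation ring. For \<open>x\<close> outside
  \<open>M\<close> the ring \<open>M[x]\<close> contains an element of \<open>H\<close> outside
  \<open>A\<close>; its inverse is a nonunit of \<open>A\<close>, so 1 becomes a polynomial in
  \<open>x\<close> with coefficients in the ideal \<open>J\<close>. This cannot happen for both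
  \<open>x\<close> and its inverse.\<close>

theorem valuation_extension:
  fixes H :: "'a::alg_closed_field set"
  assumes H: "subfld H" and A: "subrng A" "A \<subseteq> H" "\<And>x. x \<in> H \<Longrightarrow> x \<notin> A \<Longrightarrow> inverse x \<in> A"
  obtains V where "valued V" "V \<inter> H = A"
proof -
  interpret H: subfld H by fact
  interpret A: subrng A by fact
  define S0 where "S0 = {R. subrng R \<and> R \<inter> H = A}"
  have "\<exists>M\<in>S0. \<forall>R\<in>S0. M \<subseteq> R \<longrightarrow> R = M"
  proof (rule subset_Zorn_nonempty)
    show "S0 \<noteq> {}" using A by (auto simp: S0_def)
    fix C assume C: "C \<noteq> {}" "subset.chain S0 C"
    have sub: "subrng R" "R \<inter> H = A" if "R \<in> C" for R using C(2) that by (auto simp: S0_def subset_chain_def)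
    have tot: "\<exists>R\<in>C. x \<in> R \<and> y \<in> R" if xy: "x \<in> \<Union>C" "y \<in> \<Union>C" for x y
      using C(2) xy unfolding subset_chain_def by blast
    have "subrng (\<Union>C)"
    proof
      show "1 \<in> \<Union>C" using C(1) sub(1) subrng.one by blast
      fix x y assume "x \<in> \<Union>C" "y \<in> \<Union>C"
      then obtain R where "R \<in> C" "x \<in> R" "y \<in> R" using tot by blast
      then show "x - y \<in> \<Union>C" "x * y \<in> \<Union>C" using sub(1) subrng.diff subrng.mult by blast+
    qed
    moreover have "\<Union>C \<inter> H = A" using C(1) sub(2) by blast
    ultimately show "\<Union>C \<in> S0" by (simp add: S0_def)
  qed
  then obtain M where M: "subrng M" "M \<inter> H = A" and max: "\<And>R. subrng R \<Longrightarrow> R \<inter> H = A \<Longrightarrow> M \<subseteq> R \<Longrightarrow> R = M"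
    unfolding S0_def by blast
  interpret M: subrng M by fact
  have AM: "A \<subseteq> M" using M(2) by blast
  \<comment> \<open>The nonunits of \<open>A\<close>. Zero is listed separately because
    \<open>inverse 0 = 0\<close> belongs to \<open>A\<close>.\<close>
  define I where "I = {m \<in> A. m = 0 \<or> inverse m \<notin> A}"
  \<comment> \<open>Single products already form an ideal of \<open>M\<close>: of two elements of
    \<open>I\<close>, one divides the other in \<open>A\<close>.\<close>
  define J where "J = {m * r |m r. m \<in> I \<and> r \<in> M}"
  have IA: "I \<subseteq> A" by (auto simp: I_def)
  have JM: "J \<subseteq> M" using IA AM by (auto simp: J_def intro!: M.mult)
  have J0: "0 \<in> J" unfolding J_def I_def by (auto intro!: exI[of _ 0])
  have Jmult: "a * b \<in> J" if "a \<in> M" "b \<in> J" for a b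
  proof -
    obtain m r where "m \<in> I" "r \<in> M" "b = m * r" using \<open>b \<in> J\<close> by (auto simp: J_def)
    then have "a * b = m * (a * r)" "a * r \<in> M" using that(1) by (auto intro: M.mult)
    then show ?thesis using \<open>m \<in> I\<close> unfolding J_def by blast
  qed
  have Jadd: "a + b \<in> J" if ab: "a \<in> J" "b \<in> J" for a b
  proof -
    have *: "m * r + m' * r' \<in> J" if *: "m \<in> I" "r \<in> M" "m' \<in> I" "r' \<in> M" "m' \<noteq> 0" "m / m' \<in> A" for m r m' r'
    proof -
      have "m * r + m' * r' = m' * (m / m' * r + r')" using *(5) by (simp add: field_simps)
      moreover have "m / m' * r + r' \<in> M" using * AM by (intro M.add M.mult) auto
      ultimately show ?thesis using *(3) unfolding J_def by blast
    qed
    obtain m r where m: "m \<in> I" "r \<in> M" "a = m * r" using ab by (auto simp: J_def)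
    obtain m' r' where m': "m' \<in> I" "r' \<in> M" "b = m' * r'" using ab by (auto simp: J_def)
    consider "m = 0" | "m' = 0" | "m \<noteq> 0" "m' \<noteq> 0" "m / m' \<in> A" | "m \<noteq> 0" "m' \<noteq> 0" "m' / m \<in> A"
      using A(3)[of "m / m'"] m(1) m'(1) IA A(2) by (auto simp: subset_iff)
    then show ?thesis
      using ab m m' * [of m r m' r'] *[of m' r' m r] by cases (auto simp: add.commute)
  qed
  have J1: "1 \<notin> J"
  proof
    assume "1 \<in> J"
    then obtain m r where mr: "m \<in> I" "r \<in> M" "1 = m * r" by (auto simp: J_def)
    then have "r = inverse m" by (metis inverse_unique)
    then have "inverse m \<in> A" using mr M(2) IA A(2) H.inv by blast
    then show False using mr by (auto simp: I_def)
  qed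
  have eq: "\<exists>p\<in>polys J. poly p x = 1" if x: "x \<notin> M" for x
  proof -
    let ?X = "(\<lambda>p. poly p x) ` polys M"
    have MX: "M \<subseteq> ?X"
    proof
      fix a assume "a \<in> M"
      then show "a \<in> ?X" by (intro image_eqI[of _ _ "[:a:]"]) (auto simp: polys_def coeff_pCons split: nat.splits)
    qed
    have "x \<in> ?X" by (intro image_eqI[of _ _ "[:0, 1:]"]) (auto simp: polys_def coeff_pCons split: nat.splits)
    then have "?X \<inter> H \<noteq> A" using max[OF M.generated_subrng _ MX] x by blast
    then obtain p where p: "p \<in> polys M" "poly p x \<in> H" "poly p x \<notin> A" using AM MX A(2) by blast
    define m where "m = inverse (poly p x)"
    have "m \<in> I" using A(3)[OF p(2,3)] p(3) by (auto simp: m_def I_def)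
    then have "Polynomial.smult m p \<in> polys J" using p(1) by (auto simp: polys_def J_def)
    moreover have "poly (Polynomial.smult m p) x = 1"
    proof -
      have "poly p x \<noteq> 0" using p(3) A.zero by metis
      then show ?thesis by (simp add: m_def)
    qed
    ultimately show ?thesis by blast
  qed
  have posdeg: "degree p > 0" if "p \<in> polys J" "poly p x = 1" for p x
  proof (rule ccontr)
    assume "\<not> ?thesis"
    then obtain a where "p = [:a:]" by (metis degree_eq_zeroE gr0I)
    then show False using that J1 polysD[of p J 0] by simp
  qed
  have total: "inverse x \<in> M" if x: "x \<notin> M" for x
  proof (rule ccontr)
    assume ix: "inverse x \<notin> M"
    have x0: "x \<noteq> 0" using x by auto
    obtain p where p: "p \<in> polys J" "poly p x = 1" "\<And>r. r \<in> polys J \<Longrightarrow> poly r x = 1 \<Longrightarrow> degree p \<le> degree r"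
      using ex_has_least_nat[of "\<lambda>p. p \<in> polys J \<and> poly p x = 1" _ degree] eq[OF x] by metis
    obtain q where q: "q \<in> polys J" "poly q (inverse x) = 1" "\<And>r. r \<in> polys J \<Longrightarrow> poly r (inverse x) = 1 \<Longrightarrow> degree q \<le> degree r"
      using ex_has_least_nat[of "\<lambda>p. p \<in> polys J \<and> poly p (inverse x) = 1" _ degree] eq[OF ix] by metis
    show False
    proof (cases "degree q \<le> degree p")
      case True
      then show False
        using ideal_poly_reduce[OF M(1) JM J0 Jadd Jmult x0 p(1,2) q(1,2) True posdeg[OF q(1,2)]] p(3) by fastforce
    next
      case False
      then have "degree p \<le> degree q" by simp
      then show False
        using ideal_poly_reduce[OF M(1) JM J0 Jadd Jmult _ q(1,2) p(1) _ _ posdeg[OF p(1,2)]] q(3) p(2) x0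
        by fastforce
    qed
  qed
  have "valued M" by unfold_locales (use total M.diff M.mult in auto)
  then show thesis using that M(2) by blast
qed

section \<open>The valuation of the power series field\<close>

lemma hval_props:
  assumes "f \<noteq> 0"
  shows "hcoeff f (hval f) \<noteq> 0" "\<And>g. hcoeff f g \<noteq> 0 \<Longrightarrow> hval f \<le> g"
proof -
  obtain m where m: "m \<in> supp f" "\<forall>g\<in>supp f. m \<le> g" by (rule supp_minimum[OF assms])
  have "hval f = m" unfolding hval_def using m by (intro Least_equality) auto
  then show "hcoeff f (hval f) \<noteq> 0" "\<And>g. hcoeff f g \<noteq> 0 \<Longrightarrow> hval f \<le> g"
    using m by (auto simp: supp_def)
qed

lemma hval_eqI:
  assumes "hcoeff f m \<noteq> 0" "\<And>g. g < m \<Longrightarrow> hcoeff f g = 0"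
  shows "hval f = m" "f \<noteq> 0"
proof -
  show f0: "f \<noteq> 0" using assms(1) by (auto simp: hcoeff_simps)
  show "hval f = m"
    using hval_props[OF f0] assms by (meson antisym not_less)
qed

lemma hcoeff_below_hval: "g < hval f \<Longrightarrow> hcoeff f g = 0"
  using hval_props(2)[of f g] by (metis hcoeff_simps(1) not_le)

lemma hval_geI: "f \<noteq> 0 \<Longrightarrow> (\<And>g. g < m \<Longrightarrow> hcoeff f g = 0) \<Longrightarrow> m \<le> hval f"
  using hval_props(1)[of f] by (meson not_less)

lemma hval_times:
  assumes "f \<noteq> 0" "h \<noteq> 0"
  shows "hval (f * h) = hval f + hval h"
    "hcoeff (f * h) (hval f + hval h) = hcoeff f (hval f) * hcoeff h (hval h)"
proof -
  have le: "hval f \<le> a" if "a \<in> supp f" for a using hval_props(2)[OF assms(1)] that by (simp add: supp_def)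
  have le': "hval h \<le> a" if "a \<in> supp h" for a using hval_props(2)[OF assms(2)] that by (simp add: supp_def)
  have "{a \<in> supp f. hval f + hval h - a \<in> supp h} \<subseteq> {hval f}"
    using le le' by (fastforce simp: le_diff_eq add.commute)
  then have "hcoeff (f * h) (hval f + hval h) = (\<Sum>a\<in>{hval f}. hcoeff f a * hcoeff h (hval f + hval h - a))"
    by (intro hcoeff_times) auto
  then show c: "hcoeff (f * h) (hval f + hval h) = hcoeff f (hval f) * hcoeff h (hval h)" by simp
  show "hval (f * h) = hval f + hval h"
  proof (rule hval_eqI)
    show "hcoeff (f * h) (hval f + hval h) \<noteq> 0" using c hval_props(1)[OF assms(1)] hval_props(1)[OF assms(2)] by simp
    fix g assume g: "g < hval f + hval h"
    have "g \<notin> supp f + supp h"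
    proof
      assume "g \<in> supp f + supp h"
      then obtain a b where "a \<in> supp f" "b \<in> supp h" "g = a + b" by (auto simp: set_plus_def)
      then show False using g add_mono[OF le le', of a b] by simp
    qed
    then have "g \<notin> supp (f * h)" using supp_times by blast
    then show "hcoeff (f * h) g = 0" by (simp add: supp_def)
  qed
qed

lemma hval_monomial: "c \<noteq> 0 \<Longrightarrow> hval (monomial c g) = g"
  and monomial_eq_0_iff [simp]: "monomial c g = 0 \<longleftrightarrow> c = 0"
proof -
  show "hval (monomial c g) = g" if "c \<noteq> 0"
    by (rule hval_eqI) (use that in \<open>auto simp: monomial.rep_eq\<close>)
  have "monomial c g = 0 \<Longrightarrow> c = 0"
    by (metis hcoeff_simps(1) monomial.rep_eq)
  then show "monomial c g = 0 \<longleftrightarrow> c = 0"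
    by (auto intro: hahn_eqI simp: monomial.rep_eq hcoeff_simps)
qed

lemma monomial_zero [simp]: "monomial 0 g = 0"
  by simp

lemma monomial_mult: "monomial c g * monomial d h = monomial (c * d) (g + h)"
  by (rule hahn_eqI) (auto simp: hcoeff_monomial_times monomial.rep_eq algebra_simps)

lemma monomial_add: "monomial c g + monomial d g = monomial (c + d) g"
  and monomial_diff: "monomial c g - monomial d g = monomial (c - d) g"
  by (rule hahn_eqI; simp add: hcoeff_simps monomial.rep_eq)+

lemma monomial_one: "monomial 1 0 = 1"
  by (simp add: one_hahn_series_def)

lemma monomial_inverse: "inverse (monomial c g) = monomial (inverse c) (- g)"
proof (cases "c = 0")
  case False
  then have "monomial c g * monomial (inverse c) (- g) = 1" by (simp add: monomial_mult monomial_one)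
  then show ?thesis by (rule inverse_unique)
next
  case True
  then show ?thesis by (metis inverse_zero monomial_eq_0_iff)
qed

lemma monomial_power: "monomial c g ^ n = monomial (c ^ n) (\<Sum>i<n. g)"
  by (induction n) (simp_all add: monomial_one monomial_mult add.commute)

lemma monomial_sum: "monomial (sum c A) g = (\<Sum>i\<in>A. monomial (c i) g)"
  by (induction A rule: infinite_finite_induct) (simp_all flip: monomial_add)

lemma hval_one [simp]: "hval 1 = 0"
  using hval_monomial[of 1 0] by (simp add: monomial_one)

lemma hval_inverse:
  assumes "f \<noteq> 0"
  shows "hval (inverse f) = - hval f"
  using hval_times(1)[of f "inverse f"] assms by (simp add: eq_neg_iff_add_eq_0 add.commute)

lemma hval_diff: "f \<noteq> h \<Longrightarrow> f = 0 \<or> m \<le> hval f \<Longrightarrow> h = 0 \<or> m \<le> hval h \<Longrightarrow> m \<le> hval (f - h)"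
  by (rule hval_geI) (auto simp: hcoeff_simps hcoeff_below_hval dest: less_le_trans)

lemma hval_ring_subrng: "subrng hval_ring"
proof
  fix f h :: "('g::linordered_ab_group_add, 'k::field) hahn_series" assume *: "f \<in> hval_ring" "h \<in> hval_ring"
  show "f - h \<in> hval_ring" using * hval_diff[of f h 0] by (cases "f = h") (auto simp: hval_ring_def)
  show "f * h \<in> hval_ring" using * by (cases "f = 0 \<or> h = 0") (auto simp: hval_ring_def hval_times)
qed (simp add: hval_ring_def)

lemma hval_ring_total: "f \<notin> hval_ring \<Longrightarrow> inverse f \<in> hval_ring"
  by (auto simp: hval_ring_def hval_inverse)

lemma hcoeff_0_mult: "f \<in> hval_ring \<Longrightarrow> h \<in> hval_ring \<Longrightarrow> hcoeff (f * h) 0 = hcoeff f 0 * hcoeff h 0"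
proof (cases "f = 0 \<or> h = 0")
  case False
  assume fh: "f \<in> hval_ring" "h \<in> hval_ring"
  then have le: "0 \<le> hval f" "0 \<le> hval h" using False by (auto simp: hval_ring_def)
  have "{a \<in> supp f. 0 - a \<in> supp h} \<subseteq> {0}"
  proof safe
    fix a assume "a \<in> supp f" "0 - a \<in> supp h"
    then have "hval f \<le> a" "hval h \<le> - a" using hval_props(2) False by (auto simp: supp_def)
    then show "a = 0" using le by (metis add.inverse_inverse antisym neg_0_le_iff_le order_trans)
  qed
  then have "hcoeff (f * h) 0 = (\<Sum>a\<in>{0}. hcoeff f a * hcoeff h (0 - a))"
    by (intro hcoeff_times) auto
  then show ?thesis by simp
qed (auto simp: hcoeff_simps)

text \<open>\<open>lt 0 = 0\<close>, whatever the junk value of \<open>hval 0\<close> is.\<close>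

definition lt :: "('g::linordered_ab_group_add, 'k::field) hahn_series \<Rightarrow> ('g, 'k) hahn_series" where
  "lt f = monomial (hcoeff f (hval f)) (hval f)"

lemma lt_zero [simp]: "lt 0 = 0"
  by (simp add: lt_def hcoeff_simps)

lemma lt_eq_0_iff [simp]: "lt f = 0 \<longleftrightarrow> f = 0"
  using hval_props(1)[of f] by (auto simp: lt_def hcoeff_simps)

lemma lt_monomial: "lt (monomial c g) = monomial c g"
proof (cases "c = 0")
  case False
  then show ?thesis by (simp add: lt_def hval_monomial monomial.rep_eq)
qed simp

lemma lt_one [simp]: "lt 1 = 1"
  using lt_monomial[of 1 0] by (simp add: monomial_one)

lemma lt_mult: "lt (f * h) = lt f * lt h"
proof (cases "f = 0 \<or> h = 0")
  case False
  then show ?thesis by (simp add: lt_def hval_times monomial_mult)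
qed auto

lemma lt_inverse: "lt (inverse f) = inverse (lt f)"
proof (cases "f = 0")
  case False
  then have "lt f * lt (inverse f) = 1" using lt_mult[of f "inverse f"] by simp
  then show ?thesis by (metis inverse_unique)
qed simp

lemma hval_lt [simp]: "f \<noteq> 0 \<Longrightarrow> hval (lt f) = hval f"
  using hval_props(1)[of f] by (simp add: lt_def hval_monomial)

lemma lt_eqI:
  assumes "f \<noteq> 0" "h \<noteq> f \<Longrightarrow> hval f < hval (h - f)" shows "lt h = lt f"
proof (cases "h = f")
  case False
  have *: "hcoeff h g = hcoeff f g" if "g \<le> hval f" for g
    using hcoeff_below_hval[of g "h - f"] assms(2)[OF False] that by (simp add: hcoeff_simps)
  have "hval h = hval f"
    using hval_props(1)[OF assms(1)] hcoeff_below_hval[of _ f] by (intro hval_eqI) (auto simp: *)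
  then show ?thesis by (simp add: lt_def *)
qed simp

lemma lt_diff: "f \<noteq> lt f \<Longrightarrow> hval f < hval (f - lt f)"
proof -
  assume "f \<noteq> lt f"
  then have ne: "f - lt f \<noteq> 0" by simp
  have "hval f \<le> hval (f - lt f)"
    by (rule hval_geI[OF ne]) (auto simp: lt_def hcoeff_simps monomial.rep_eq hcoeff_below_hval)
  moreover have "hval (f - lt f) \<noteq> hval f"
    using hval_props(1)[OF ne] by (auto simp: lt_def hcoeff_simps monomial.rep_eq)
  ultimately show ?thesis by simp
qed

locale hahn_val = valued V
  for V :: "('g::linordered_ab_group_add, 'k::field) hahn_series alg_closure set" +
  assumes V_hahn: "to_ac f \<in> V \<longleftrightarrow> f \<in> hval_ring"
begin

lemma vle_to_ac: "to_ac f \<preceq> to_ac h \<longleftrightarrow> f = 0 \<or> (h \<noteq> 0 \<and> hval h \<le> hval f)"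
proof (cases "h = 0 \<or> f = 0")
  case False
  then have "to_ac f \<preceq> to_ac h \<longleftrightarrow> to_ac (f / h) \<in> V"
    by (simp add: V_iff vle_divide)
  also have "\<dots> \<longleftrightarrow> hval h \<le> hval f"
    unfolding V_hahn using False hval_times(1)[of f "inverse h"] hval_inverse[of h]
    by (auto simp: hval_ring_def field_class.field_divide_inverse)
  finally show ?thesis using False by simp
qed auto

lemma vlt_to_ac: "to_ac f \<prec> to_ac h \<longleftrightarrow> h \<noteq> 0 \<and> (f = 0 \<or> hval h < hval f)"
  unfolding vlt_def vle_to_ac by auto

lemma to_ac_subfld: "subfld F \<Longrightarrow> subfld (to_ac ` F)" for F :: "('g, 'k) hahn_series set"
proof -
  assume "subfld F"
  then interpret subfld F .
  show ?thesis
    by unfold_locales (auto simp flip: to_ac_diff to_ac_mult to_ac_inverse intro: image_eqI[of _ _ 1])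
qed

lemma lt_cong: "to_ac h - to_ac f \<prec> to_ac f \<Longrightarrow> lt h = lt f"
  using vlt_to_ac[of "h - f" f] by (intro lt_eqI) auto

text \<open>Let \<open>b\<close> be the unit root of a Nagata polynomial. By spherical completeness there is a best
  approximation \<open>u\<close> of \<open>b\<close> in \<open>k((G))\<close>; Newton's method improves it unless \<open>u = b\<close>.\<close>

lemma hahn_hens: "hens (range (to_ac :: ('g, 'k) hahn_series \<Rightarrow> _))"
  unfolding hens_def
proof (intro conjI ballI impI)
  show sH: "subfld (range (to_ac :: ('g, 'k) hahn_series \<Rightarrow> _))"
    by (rule to_ac_subfld) (unfold_locales, auto)
  interpret H: subfld "range (to_ac :: ('g, 'k) hahn_series \<Rightarrow> _)" by fact
  fix P assume P: "P \<in> polys (range (to_ac :: ('g, 'k) hahn_series \<Rightarrow> _))" "nagata P"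
  obtain b where b: "poly P b = 0" "\<not> b \<prec> 1" by (rule nagata_unit_root_exists[OF P(2)])
  note np = nagata_props[OF P(2)]
  have bV: "b \<in> V" by (rule np(4)[OF b(1)])
  have simple: "\<not> poly (pderiv P) b \<prec> 1" by (rule np(6)[OF b])
  have V_cong: "x \<in> V" if "x - b \<prec> 1" for x using V_add[OF small_V[OF that] bV] by simp
  \<comment> \<open>Near the simple root the value of \<open>P\<close> has exactly the size of the
    error. Hence the distance from a series to \<open>b\<close>, which might lie outside
    \<open>k((G))\<close>, is measured by a series.\<close>
  have near: "poly P x \<preceq> x - b \<and> x - b \<preceq> poly P x" if x: "x - b \<prec> 1" for x
  proof -
    obtain r where r: "r \<in> V" "poly P (b + (x - b)) = poly P b + (x - b) * (poly (pderiv P) b + (x - b) * r)"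
      using polys_V_taylor[OF np(1) bV small_V[OF x]] by blast
    define w where "w = poly (pderiv P) b + (x - b) * r"
    have w: "poly P x = (x - b) * w" using r(2) b(1) by (simp add: w_def)
    have "\<not> w \<prec> 1" unfolding w_def
      using simple unit_cong[of "poly (pderiv P) b + (x - b) * r" "poly (pderiv P) b"] small_mult(1)[OF x r(1)] by simp
    moreover have "w \<in> V" unfolding w_def
      using V_add[OF polys_V_poly[OF polys_V_pderiv[OF np(1)] bV] V_mult[OF small_V[OF x] r(1)]] .
    ultimately have "w \<preceq> 1" "1 \<preceq> w" by (auto simp: V_iff)
    then show ?thesis using vle_mult[of "x - b" "x - b" w 1] vle_mult[of "x - b" "x - b" 1 w] w by simp
  qed
  have "b \<in> range to_ac"
  proof (rule ccontr)
    assume nb: "b \<notin> range to_ac"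
    define D where "D = {f :: ('g, 'k) hahn_series. to_ac f - b \<prec> 1}"
    have "\<exists>h. poly P (to_ac f) = to_ac h" for f using H.poly_closed[OF P(1), of "to_ac f"] by auto
    then obtain \<pi> where \<pi>: "\<And>f. poly P (to_ac f) = to_ac (\<pi> f)" by metis
    have \<pi>0: "\<pi> f \<noteq> 0" if "f \<in> D" for f
    proof
      assume "\<pi> f = 0"
      then have "to_ac f - b = 0" using near[of "to_ac f"] \<pi>[of f] that by (auto simp: D_def)
      then show False using nb by auto
    qed
    define \<rho> where "\<rho> f = hval (\<pi> f)" for f
    \<comment> \<open>Two series near \<open>b\<close> differ by at most the larger of their errors,
      so they share all coefficients below both bounds.\<close>
    have agree: "hcoeff f g = hcoeff f' g" if f: "f \<in> D" "f' \<in> D" and g: "g < \<rho> f" "g < \<rho> f'" for f f' g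
    proof -
      have nf: "to_ac f - b \<preceq> to_ac (\<pi> f)" "to_ac f' - b \<preceq> to_ac (\<pi> f')"
        using near[of "to_ac f"] near[of "to_ac f'"] \<pi> f by (auto simp: D_def)
      have "to_ac (f - f') \<preceq> to_ac (\<pi> f) \<or> to_ac (f - f') \<preceq> to_ac (\<pi> f')"
      proof -
        have eq: "to_ac (f - f') = (to_ac f - b) - (to_ac f' - b)" by simp
        show ?thesis unfolding eq
          using vle_total[of "to_ac (\<pi> f)" "to_ac (\<pi> f')"] nf vle_trans vle_diff by meson
      qed
      then have "f - f' = 0 \<or> \<rho> f \<le> hval (f - f') \<or> \<rho> f' \<le> hval (f - f')"
        unfolding vle_to_ac \<rho>_def by blast
      then have "hcoeff (f - f') g = 0"
        using g hcoeff_below_hval[of g "f - f'"] by (auto simp: hcoeff_simps)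
      then show ?thesis by (simp add: hcoeff_simps)
    qed
    \<comment> \<open>The initial segments, each cut off at its bound \<open>\<rho> f\<close>, are
      compatible by \<open>agree\<close>, and \<open>u0\<close> glues them. Its support is
      well-ordered because below each bound it is that of a single series.\<close>
    define u0 where "u0 g = (if \<exists>f\<in>D. g < \<rho> f then hcoeff (SOME f. f \<in> D \<and> g < \<rho> f) g else 0)" for g
    have u0: "u0 g = hcoeff f g" if f: "f \<in> D" "g < \<rho> f" for f g
    proof -
      define h where "h = (SOME f. f \<in> D \<and> g < \<rho> f)"
      have "h \<in> D \<and> g < \<rho> h"
        unfolding h_def by (rule someI[of "\<lambda>f. f \<in> D \<and> g < \<rho> f" f]) (use f in simp)
      then have "hcoeff h g = hcoeff f g" using agree f by blast
      moreover have "\<exists>f\<in>D. g < \<rho> f" using f by blast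
      ultimately show ?thesis unfolding u0_def h_def by simp
    qed
    have "wfp_on {g. u0 g \<noteq> 0} (<)"
      unfolding wfp_on_iff_ex_minimal
    proof (intro allI impI)
      fix B assume B: "B \<subseteq> {g. u0 g \<noteq> 0}" "B \<noteq> {}"
      then obtain c where c: "c \<in> B" "u0 c \<noteq> 0" by blast
      then obtain f where f: "f \<in> D" "c < \<rho> f" unfolding u0_def by (metis (full_types))
      have "c \<in> supp f" using u0[OF f] c(2) by (simp add: supp_def)
      then obtain m where m: "m \<in> B \<inter> supp f" "\<And>y. y < m \<Longrightarrow> y \<notin> B \<inter> supp f"
        using supp_wo[of f] c(1) unfolding wfp_on_iff_ex_minimal
        by (metis IntI Int_lower2 empty_iff)
      have mc: "m \<le> c" using m(2)[of c] c(1) \<open>c \<in> supp f\<close> by (meson IntI not_le)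
      have "y \<notin> B" if "y < m" for y
      proof
        assume "y \<in> B"
        then have "u0 y \<noteq> 0" using B(1) by blast
        moreover have "u0 y = hcoeff f y" using u0[OF f(1), of y] f(2) mc that by (meson le_less_trans less_trans)
        ultimately show False using m(2)[OF that] \<open>y \<in> B\<close> by (simp add: supp_def)
      qed
      then show "\<exists>z\<in>B. \<forall>y. y < z \<longrightarrow> y \<notin> B" using m(1) by blast
    qed
    then have hu: "hcoeff (Abs_hahn_series u0) = u0" by (rule hcoeff_Abs)
    define u where "u = Abs_hahn_series u0"
    have best: "to_ac u - b \<preceq> to_ac f - b" if f: "f \<in> D" for f
    proof -
      have "\<rho> f \<le> hval (u - f)" if "u \<noteq> f"
        by (rule hval_geI) (use that u0[OF f] hu in \<open>auto simp: u_def hcoeff_simps\<close>)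
      then have "to_ac (u - f) \<preceq> to_ac (\<pi> f)" using \<pi>0[OF f] unfolding vle_to_ac by (auto simp: \<rho>_def)
      also have "to_ac (\<pi> f) \<preceq> to_ac f - b" using near[of "to_ac f"] f \<pi> by (auto simp: D_def)
      finally have "to_ac (u - f) + (to_ac f - b) \<preceq> to_ac f - b" by (rule vle_add) simp
      then show ?thesis by simp
    qed
    have "- 1 \<in> D" using vlt_minus_commute[of "- 1" b 1] np(5)[OF b] by (simp add: D_def)
    then have ub: "to_ac u - b \<prec> 1" using best[of "- 1"] by (auto simp: D_def intro: vle_vlt_trans)
    define \<delta> where "\<delta> = b - to_ac u"
    have \<delta>: "\<delta> \<prec> 1" "\<delta> \<noteq> 0" using ub nb by (auto simp: \<delta>_def vlt_minus_commute)
    obtain r where r: "r \<in> V" "poly P (to_ac u + \<delta>) = poly P (to_ac u) + \<delta> * (poly (pderiv P) (to_ac u) + \<delta> * r)"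
      using polys_V_taylor[OF np(1) V_cong[OF ub] small_V[OF \<delta>(1)]] by blast
    define d where "d = poly (pderiv P) (to_ac u)"
    have "\<not> d \<prec> 1"
      using simple unit_cong[OF poly_V_cong[OF polys_V_pderiv[OF np(1)] V_cong[OF ub] bV ub]] by (simp add: d_def)
    then have d: "d \<noteq> 0" "inverse d \<in> V" using vle_inverse[of 1 d] by (auto simp: V_iff)
    \<comment> \<open>The error of the Newton step is the square of the previous error up to an
      integral factor.\<close>
    define u' where "u' = to_ac u - poly P (to_ac u) / d"
    have "u' \<in> range to_ac"
    proof -
      have "d \<in> range to_ac" unfolding d_def using P(1) by (intro H.poly_closed H.polys_pderiv) auto
      then show ?thesis unfolding u'_def using P(1) by (intro H.diff H.divide H.poly_closed) auto
    qed
    then obtain f where f: "u' = to_ac f" by auto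
    have "poly P (to_ac u) = - (\<delta> * (d + \<delta> * r))"
      using r(2) b(1) by (simp add: \<delta>_def d_def eq_neg_iff_add_eq_0)
    then have "u' - b = \<delta> * (\<delta> * (r * inverse d))"
      using d(1) by (simp add: u'_def \<delta>_def field_simps)
    moreover have "\<delta> * (r * inverse d) \<prec> 1" using \<delta>(1) r(1) d(2) by (intro small_mult(1) V_mult)
    ultimately have "u' - b \<prec> \<delta>" using vle_vlt_mult[of \<delta> \<delta> "\<delta> * (r * inverse d)" 1] \<delta>(2) by simp
    then have lt: "to_ac f - b \<prec> to_ac u - b" using vlt_uminus(2)[of "u' - b" \<delta>] f by (simp add: \<delta>_def)
    then have "f \<in> D" using ub by (auto simp: D_def intro: vlt_trans)
    then show False using best lt by (simp add: vlt_def)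
  qed
  then show "\<exists>b\<in>range to_ac. poly P b = 0 \<and> \<not> b \<prec> 1" using b by blast
qed

end

lemma hahn_val_exists: "\<exists>V :: ('g::linordered_ab_group_add, 'k::field) hahn_series alg_closure set. hahn_val V"
proof -
  let ?H = "range (to_ac :: ('g, 'k) hahn_series \<Rightarrow> _)"
  let ?A = "to_ac ` (hval_ring :: ('g, 'k) hahn_series set)"
  have "subfld ?H"
    by unfold_locales (auto simp flip: to_ac_diff to_ac_mult to_ac_inverse intro: image_eqI[of _ _ 1])
  moreover have "subrng ?A"
    using subrng.diff[OF hval_ring_subrng] subrng.mult[OF hval_ring_subrng] subrng.one[OF hval_ring_subrng]
    by unfold_locales (auto simp flip: to_ac_diff to_ac_mult intro: image_eqI[of _ _ 1] intro!: imageI)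
  moreover have "inverse x \<in> ?A" if "x \<in> ?H" "x \<notin> ?A" for x
    using that hval_ring_total by (auto simp flip: to_ac_inverse intro!: imageI)
  ultimately obtain V where V: "valued V" "V \<inter> ?H = ?A" using valuation_extension[of ?H ?A] by blast
  then have "to_ac f \<in> V \<longleftrightarrow> f \<in> hval_ring" for f :: "('g, 'k) hahn_series"
  proof -
    have "to_ac f \<in> V \<longleftrightarrow> to_ac f \<in> ?A" using V(2) by blast
    then show ?thesis by auto
  qed
  then show ?thesis using V(1) by (auto simp: hahn_val_def hahn_val_axioms_def)
qed

section \<open>Adjoining the root of a Nagata polynomial\<close>

context valued
begin

lemma monic_roots_polys_V:
  assumes "lead_coeff p = 1" "\<And>a. poly p a = 0 \<Longrightarrow> a \<in> V"
  shows "p \<in> polys V"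
proof -
  obtain A where A: "p = (\<Prod>a\<in>#A. [:- a, 1:])" "set_mset A = {x. poly p x = 0}"
    by (rule alg_closed_split[OF assms(1)])
  have "(\<Prod>a\<in>#B. [:- a, 1:]) \<in> polys V" if "set_mset B \<subseteq> V" for B
    using that
  proof (induction B)
    case empty
    then show ?case by (auto simp: polys_def one_pCons coeff_pCons split: nat.splits)
  next
    case (add b B)
    have "[:- b, 1:] \<in> polys V" using add.prems
      by (intro polys_V_pCons) (auto simp: polys_def V_uminus)
    then have "[:- b, 1:] * (\<Prod>a\<in>#B. [:- a, 1:]) \<in> polys V" using add by (intro polys_V_mult) auto
    then show ?case by (simp only: image_mset_add_mset prod_mset.add_mset)
  qed
  then show ?thesis using A assms(2) by auto
qed

text \<open>Lagrange interpolation cleared of denominators: modulo \<open>q\<close>, the product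
  \<open>W * q'\<close> is the sum of \<open>W(a) * q / (X - a)\<close> over the roots. This sum
  already has degree below that of \<open>q\<close> and integral coefficients. The roots are taken
  from a list so that multiplicities are counted.\<close>

lemma pderiv_mod_polys_V:
  assumes q: "lead_coeff q = 1" and W: "\<And>a. poly q a = 0 \<Longrightarrow> a \<in> V \<and> poly W a \<in> V"
  shows "(W * pderiv q) mod q \<in> polys V"
proof -
  obtain A where A: "size A = degree q" "q = (\<Prod>a\<in>#A. [:- a, 1:])" "set_mset A = {x. poly q x = 0}"
    by (rule alg_closed_split[OF q])
  obtain xs where xs: "mset xs = A" using ex_mset by blast
  define n where "n = length xs"
  have n: "n = degree q" using A(1) xs by (simp add: n_def flip: size_mset)
  define f where "f i = [:- (xs ! i), 1:]" for i
  have qf: "q = (\<Prod>i<n. f i)"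
  proof -
    have "q = prod_mset (mset (map (\<lambda>a. [:- a, 1:]) xs))" using A(2) xs by simp
    also have "\<dots> = (\<Prod>i<n. f i)"
      unfolding prod_mset_prod_list prod.list_conv_set_nth by (simp add: f_def n_def atLeast0LessThan)
    finally show ?thesis .
  qed
  have root: "poly q (xs ! i) = 0" if "i < n" for i
  proof -
    have "xs ! i \<in># A" using that xs by (metis n_def nth_mem set_mset_mset)
    then show ?thesis using A(3) by blast
  qed
  define p where "p i = (\<Prod>j\<in>{..<n} - {i}. f j)" for i
  define S where "S = (\<Sum>i<n. Polynomial.smult (poly W (xs ! i)) (p i))"
  have qp: "q = f i * p i" if "i < n" for i
    using that by (simp add: qf p_def prod.remove)
  have "pderiv q = (\<Sum>i<n. p i)"
    unfolding qf pderiv_prod p_def by (intro sum.cong) (auto simp: f_def pderiv_pCons)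
  then have "W * pderiv q - S = (\<Sum>i<n. (W - [:poly W (xs ! i):]) * p i)"
    by (simp add: S_def sum_distrib_left left_diff_distrib sum_subtractf)
  also have "q dvd \<dots>"
  proof (rule dvd_sum)
    fix i assume "i \<in> {..<n}"
    moreover have "f i dvd W - [:poly W (xs ! i):]" by (simp add: f_def poly_eq_0_iff_dvd[symmetric])
    ultimately show "q dvd (W - [:poly W (xs ! i):]) * p i" using qp[of i] by (auto intro: mult_dvd_mono)
  qed
  finally have "(W * pderiv q) mod q = S mod q" by (simp add: mod_eq_dvd_iff)
  moreover have "S mod q = S"
  proof (cases "n = 0")
    case True
    then show ?thesis by (simp add: S_def)
  next
    case False
    have "degree (p i) \<le> n - 1" if i: "i < n" for i
    proof -
      have "degree (p i) \<le> (\<Sum>j\<in>{..<n} - {i}. degree (f j))"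
        using degree_prod_sum_le[of "{..<n} - {i}" f] by (simp add: p_def o_def)
      also have "\<dots> = n - 1" using i by (simp add: f_def)
      finally show ?thesis .
    qed
    then have "degree S \<le> n - 1"
      unfolding S_def by (intro degree_sum_le) (auto intro: order_trans[OF degree_smult_le])
    then show ?thesis using False n by (intro mod_poly_less) auto
  qed
  moreover have "S \<in> polys V"
    unfolding S_def
  proof (rule polys_V_sum)
    fix i assume i: "i \<in> {..<n}"
    have "p i \<in> polys V" unfolding p_def f_def
      using W root by (intro polys_V_prod polys_V_pCons) (auto simp: polys_def V_uminus)
    then show "Polynomial.smult (poly W (xs ! i)) (p i) \<in> polys V" using W root i by (intro polys_V_smult) auto
  qed
  ultimately show ?thesis by simp
qed

text \<open>An element \<open>u \<in> V\<close> of an algebraic extension is a quotient of integral elements with denominator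
  a unit: scale the minimal polynomial of \<open>u\<close> to have maximal coefficient \<open>1\<close>, and
  take the part \<open>\<Sum>\<^bsub>i\<ge>j\<^esub> a\<^sub>i u\<^bsup>i - j\<^esup>\<close> beginning at its last unit coefficient \<open>a\<^sub>j\<close>.\<close>

lemma unit_denominator:
  assumes F: "subfld F" and u: "alg F u" "u \<in> V"
  obtains Y where "Y \<in> polys F" "\<not> poly Y u \<prec> 1"
    "\<And>t. conj F u t \<Longrightarrow> poly Y t \<in> V \<and> t * poly Y t \<in> V"
proof -
  interpret F: subfld F by fact
  obtain q where q: "minp F u q" using F.minp_exists[OF u(1)] .
  note qD = minpD[OF q]
  define N where "N = degree q"
  obtain c where c: "c \<in> coeff q ` {..N}" "\<forall>a\<in>coeff q ` {..N}. a \<preceq> c"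
    using vle_maximum[of "coeff q ` {..N}"] by blast
  have "coeff q N \<preceq> c" using c(2) by blast
  then have c0: "c \<noteq> 0" using qD(2) by (auto simp: N_def)
  have cF: "c \<in> F" using c(1) qD(1) by (auto simp: polysD)
  define a where "a i = coeff q i / c" for i
  have aV: "a i \<in> V" for i
    using c(2) c0 by (cases "i \<le> N") (auto simp: a_def V_iff vle_divide N_def coeff_eq_0)
  have aF: "a i \<in> F" for i using cF qD(1) by (auto simp: a_def polysD)
  define U where "U = {i. i \<le> N \<and> \<not> a i \<prec> 1}"
  obtain i0 where "i0 \<le> N" "coeff q i0 = c" using c(1) by auto
  then have "i0 \<in> U" using c0 by (simp add: U_def a_def)
  define j where "j = Max U"
  have finU: "finite U" by (simp add: U_def)
  have jU: "j \<in> U" using Max_in[OF finU] \<open>i0 \<in> U\<close> unfolding j_def by blast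
  have small: "a i \<prec> 1" if "j < i" "i \<le> N" for i
  proof (rule ccontr)
    assume "\<not> a i \<prec> 1"
    then have "i \<in> U" using that(2) by (simp add: U_def)
    then show False using Max_ge[OF finU, of i] that(1) by (simp add: j_def)
  qed
  define Y where "Y = (\<Sum>i\<in>{j..N}. Polynomial.monom (a i) (i - j))"
  have Yt: "poly Y t = (\<Sum>i\<in>{j..N}. a i * t ^ (i - j))" for t by (simp add: Y_def poly_sum poly_monom)
  show thesis
  proof (rule that)
    show "Y \<in> polys F" unfolding Y_def using aF by (intro F.polys_sum) auto
    have jN: "j \<le> N" "\<not> a j \<prec> 1" using jU by (auto simp: U_def)
    have "poly Y u - a j = (\<Sum>i\<in>{j<..N}. a i * u ^ (i - j))"
      using jN(1) by (simp add: Yt sum.head)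
    also have "\<dots> \<prec> 1"
    proof -
      have "sum g S \<prec> 1" if "\<And>i. i \<in> S \<Longrightarrow> g i \<prec> 1" for g and S :: "nat set"
        using that by (induction S rule: infinite_finite_induct) (auto intro: vlt_add)
      note * = this
      show ?thesis using small u(2) by (intro * small_mult(1) V_power) auto
    qed
    finally show "\<not> poly Y u \<prec> 1" using unit_cong jN(2) by blast
    fix t assume "conj F u t"
    then have "poly q t = 0" using F.minp_conj_iff[OF q] by simp
    show "poly Y t \<in> V \<and> t * poly Y t \<in> V"
    proof (cases "t \<in> V")
      case True
      then show ?thesis unfolding Yt by (auto intro!: V_mult V_sum aV V_power)
    next
      case False
      then have t: "inverse t \<in> V" "t \<noteq> 0" using V_total by auto
      \<comment> \<open>For \<open>t\<close> outside \<open>V\<close> the sum from \<open>j\<close>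
        on is traded, by the equation of \<open>t\<close>, for the terms below \<open>j\<close>;
        after division by \<open>t^(j-1)\<close> only nonpositive powers of \<open>t\<close>
        remain.\<close>
      have "0 = (\<Sum>i\<le>N. a i * t ^ i)"
        using \<open>poly q t = 0\<close> by (simp add: a_def poly_altdef N_def flip: sum_divide_distrib)
      also have "\<dots> = (\<Sum>i<j. a i * t ^ i) + (\<Sum>i\<in>{j..N}. a i * t ^ i)"
        using jN(1) by (subst sum.union_disjoint[symmetric]) (auto intro!: sum.cong)
      also have "(\<Sum>i\<in>{j..N}. a i * t ^ i) = t ^ j * poly Y t"
        unfolding Yt sum_distrib_left by (intro sum.cong) (auto simp: algebra_simps simp flip: power_add)
      finally have e: "t ^ j * poly Y t = - (\<Sum>i<j. a i * t ^ i)" by (simp add: eq_neg_iff_add_eq_0 add.commute)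
      have "t * poly Y t = t * inverse t ^ j * (t ^ j * poly Y t)" using t(2) by (simp add: field_simps)
      also have "\<dots> = - (\<Sum>i<j. a i * inverse t ^ (j - 1 - i))"
      proof -
        have "t * inverse t ^ j * (a i * t ^ i) = a i * inverse t ^ (j - 1 - i)" if i: "i < j" for i
        proof -
          obtain m where "j = i + Suc m" using less_imp_Suc_add[OF i] by auto
          then show ?thesis using t(2) by (simp add: power_add field_simps)
        qed
        note term_eq = this
        show ?thesis unfolding e mult_minus_right sum_distrib_left
          by (intro arg_cong[of _ _ uminus] sum.cong refl term_eq) simp
      qed
      finally have "t * poly Y t \<in> V" using aV t(1) by (auto intro!: V_uminus V_sum V_mult V_power)
      moreover have "poly Y t = inverse t * (t * poly Y t)" using t(2) by simp
      ultimately show ?thesis using t(1) by (metis V_mult)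
    qed
  qed
qed

text \<open>The unit \<open>P'(b)\<close> equals \<open>q'(b) * w(b)\<close> for
  \<open>w = P div q\<close>, and both factors are integral, so both are units.\<close>

lemma nagata_minp_units:
  assumes F: "subfld F" and P: "P \<in> polys F" "nagata P" and b: "poly P b = 0" "\<not> b \<prec> 1" and q: "minp F b q"
  shows "q \<in> polys V" "\<And>a. poly q a = 0 \<Longrightarrow> a \<in> V" "P = q * (P div q)" "P div q \<in> polys V" "P div q \<in> polys F"
    "\<not> poly (pderiv q) b \<prec> 1" "\<not> poly (P div q) b \<prec> 1"
proof -
  interpret F: subfld F by fact
  note np = nagata_props[OF P(2)]
  note qD = minpD[OF q]
  have "q dvd P" by (rule F.minp_dvd[OF q P(1) b(1)])
  then show Pq: "P = q * (P div q)" by simp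
  define w where "w = P div q"
  have Pw: "P = q * w" using Pq by (simp add: w_def)
  have Pr: "poly P a = poly q a * poly w a" for a using arg_cong[OF Pw, of "\<lambda>p. poly p a"] by simp
  show qr: "a \<in> V" if "poly q a = 0" for a using that np(4)[of a] Pr by simp
  have wr: "a \<in> V" if "poly w a = 0" for a using that np(4)[of a] Pr by simp
  have "lead_coeff w = 1" using np(2) qD(2) lead_coeff_mult[of q w] by (simp flip: Pw)
  then have wV: "w \<in> polys V" using wr by (rule monic_roots_polys_V)
  then show "P div q \<in> polys V" by (simp add: w_def)
  show qV: "q \<in> polys V" using qD(2) qr by (rule monic_roots_polys_V)
  show "P div q \<in> polys F" using P(1) qD(1) by simp
  have bV: "b \<in> V" using qr qD(3) by blast
  have "poly (pderiv P) b = poly (pderiv q) b * poly w b" using qD(3) by (subst Pw) (simp add: pderiv_mult)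
  then have "\<not> poly (pderiv q) b * poly w b \<prec> 1" using np(6)[OF b] by simp
  then show "\<not> poly (pderiv q) b \<prec> 1" "\<not> poly (P div q) b \<prec> 1"
    using small_mult[of "poly (pderiv q) b" "poly w b"] small_mult(2)[of "poly (pderiv q) b" "poly w b"]
      polys_V_poly[OF wV bV] polys_V_poly[OF polys_V_pderiv[OF qV] bV] unfolding w_def by blast+
qed

text \<open>The valuation ring of \<open>F(b)\<close> is a localization of the integral polynomials
  in \<open>b\<close>. The unit denominator \<open>Y(u)\<close> makes numerator and denominator
  integral at every conjugate, and multiplying by \<open>q'(b)\<close>, a unit here, turns elements
  integral at all conjugates into integral polynomials in \<open>b\<close>.\<close>

lemma nagata_ext_local:
  assumes F: "subfld F" and P: "P \<in> polys F" "nagata P" and b: "poly P b = 0" "\<not> b \<prec> 1"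
    and u: "u \<in> sext F b" "u \<in> V"
  obtains h k where "h \<in> polys F" "h \<in> polys V" "k \<in> polys F" "k \<in> polys V"
    "\<not> poly k b \<prec> 1" "u * poly k b = poly h b"
proof -
  interpret F: subfld F by fact
  have "alg F b" using P(1) b(1) nagata_props(3)[OF P(2)] by (auto simp: alg_def)
  then obtain q where q: "minp F b q" by (rule F.minp_exists)
  note nu = nagata_minp_units[OF F P b q]
  note qD = minpD[OF q]
  obtain G where G: "G \<in> polys F" "u = poly G b" using u(1) by (auto simp: sext_def)
  obtain Y where Y: "Y \<in> polys F" "\<not> poly Y u \<prec> 1" "\<And>t. conj F u t \<Longrightarrow> poly Y t \<in> V \<and> t * poly Y t \<in> V"
    using unit_denominator[OF F F.alg_sext[OF \<open>alg F b\<close> u(1)] u(2)] by metis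
  define W where "W = pcompose Y G"
  have W: "poly W a \<in> V \<and> poly (G * W) a \<in> V" if a: "poly q a = 0" for a
  proof -
    have c: "conj F b a" using F.minp_conj_iff[OF q] a by simp
    have "conj F u (poly G a)"
      unfolding conj_def
    proof (intro ballI impI)
      fix g assume "g \<in> polys F" "poly g u = 0"
      then have "pcompose g G \<in> polys F" "poly (pcompose g G) b = 0" using G by (auto simp: poly_pcompose)
      then have "poly (pcompose g G) a = 0" using c unfolding conj_def by blast
      then show "poly g (poly G a) = 0" by (simp add: poly_pcompose)
    qed
    then show ?thesis using Y(3) by (simp add: W_def poly_pcompose)
  qed
  show thesis
  proof (rule that)
    show "(G * W * pderiv q) mod q \<in> polys F" "(W * pderiv q) mod q \<in> polys F"
      using G(1) Y(1) qD(1) by (auto simp: W_def)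
    show "(G * W * pderiv q) mod q \<in> polys V" "(W * pderiv q) mod q \<in> polys V"
      using W nu(2) by (intro pderiv_mod_polys_V[OF qD(2)]; simp)+
    have "poly ((W * pderiv q) mod q) b = poly Y u * poly (pderiv q) b"
      using qD(3) G(2) by (simp add: poly_mod W_def poly_pcompose)
    then show "\<not> poly ((W * pderiv q) mod q) b \<prec> 1" using unit_mult[OF Y(2) nu(6)] by simp
    show "u * poly ((W * pderiv q) mod q) b = poly ((G * W * pderiv q) mod q) b"
      using qD(3) G(2) by (simp add: poly_mod)
  qed
qed

end

section \<open>Isometric extension to roots of Nagata polynomials\<close>

context valued
begin

lemma small_iff: "x \<prec> 1 \<longleftrightarrow> x = 0 \<or> inverse x \<notin> V"
proof (cases "x = 0")
  case False
  have "inverse x \<in> V \<longleftrightarrow> 1 \<preceq> x"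
    using vle_mult_cancel[OF False, of "inverse x" 1] False by (simp add: V_iff)
  then show ?thesis using False by (simp add: vlt_def)
qed simp

text \<open>For a homomorphism on a field this preserves the whole order, since
  \<open>x \<preceq> y\<close> with \<open>y\<close> nonzero says that \<open>x / y\<close> is in
  \<open>V\<close>.\<close>

definition isometric_on :: "'a set \<Rightarrow> ('a \<Rightarrow> 'a) \<Rightarrow> bool" where
  "isometric_on F \<sigma> \<longleftrightarrow> (\<forall>x\<in>F. \<sigma> x \<in> V \<longleftrightarrow> x \<in> V)"

lemma isometric_small:
  assumes "hom_on F \<sigma>" "isometric_on F \<sigma>" "x \<in> F" shows "\<sigma> x \<prec> 1 \<longleftrightarrow> x \<prec> 1"
proof -
  interpret hom_on F \<sigma> by fact
  have "inverse x \<in> F" using assms(3) by simp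
  then have "\<sigma> (inverse x) \<in> V \<longleftrightarrow> inverse x \<in> V" using assms(2) unfolding isometric_on_def by blast
  then show ?thesis using assms(3) by (simp add: small_iff)
qed

lemma isometric_polys:
  assumes "hom_on F \<sigma>" "isometric_on F \<sigma>" "p \<in> polys F" "p \<in> polys V" shows "map_poly \<sigma> p \<in> polys V"
proof -
  interpret hom_on F \<sigma> by fact
  show ?thesis using assms(2-4) by (auto simp: polys_def coeff_map_poly isometric_on_def)
qed

lemma isometric_nagata:
  assumes "hom_on F \<sigma>" "isometric_on F \<sigma>" "P \<in> polys F" "nagata P" shows "nagata (map_poly \<sigma> P)"
proof -
  interpret hom_on F \<sigma> by fact
  obtain n R where P: "P = Polynomial.monom 1 n * [:1, 1:] + R" and R: "\<forall>i. coeff R i \<prec> 1" "degree R < Suc n"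
    using assms(4) unfolding nagata_def by blast
  have M: "Polynomial.monom 1 n * [:1, 1:] \<in> polys F" by (intro polys_mult) auto
  have "R = P - Polynomial.monom 1 n * [:1, 1:]" using P by simp
  then have RF: "R \<in> polys F" using assms(3) M by (simp only: polys_diff)
  have "map_poly \<sigma> P = map_poly \<sigma> (Polynomial.monom 1 n * [:1, 1:]) + map_poly \<sigma> R"
    unfolding P by (rule map_poly_hom_add[OF M RF])
  also have "map_poly \<sigma> (Polynomial.monom 1 n * [:1, 1:]) = Polynomial.monom 1 n * [:1, 1:]"
    by (subst map_poly_hom_mult) (auto simp: map_poly_monom map_poly_pCons)
  finally have "map_poly \<sigma> P = Polynomial.monom 1 n * [:1, 1:] + map_poly \<sigma> R" .
  moreover have "\<forall>i. coeff (map_poly \<sigma> R) i \<prec> 1"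
    using R(1) RF isometric_small[OF assms(1,2)] by (auto simp: coeff_map_poly polysD)
  moreover have "degree (map_poly \<sigma> R) < Suc n" using RF R(2) by (simp add: map_poly_hom_degree)
  ultimately show ?thesis unfolding nagata_def by blast
qed

text \<open>Both \<open>b\<close> and \<open>b'\<close> reduce to -1, so whether an integral
  polynomial is small at them is decided by its value at -1, an element of \<open>F\<close> that
  \<open>\<sigma>\<close> treats isometrically. Elements of \<open>F(b)\<close> in \<open>V\<close>
  are quotients of such polynomial values with unit denominator.\<close>

lemma isometric_nagata_extend:
  assumes \<sigma>: "hom_on F \<sigma>" "isometric_on F \<sigma>" and P: "P \<in> polys F" "nagata P"
    and b: "poly P b = 0" "\<not> b \<prec> 1" and b': "poly (map_poly \<sigma> P) b' = 0" "\<not> b' \<prec> 1"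
  obtains \<tau> where "hom_on (sext F b) \<tau>" "isometric_on (sext F b) \<tau>" "\<And>x. x \<in> F \<Longrightarrow> \<tau> x = \<sigma> x" "\<tau> b = b'"
    "\<And>g. g \<in> polys F \<Longrightarrow> \<tau> (poly g b) = poly (map_poly \<sigma> g) b'"
proof -
  interpret hom_on F \<sigma> by fact
  have F: "subfld F" by (rule subfld_axioms)
  have alg: "alg F b" using P(1) b(1) nagata_props(3)[OF P(2)] by (auto simp: alg_def)
  then obtain q where q: "minp F b q" by (rule minp_exists)
  note nu = nagata_minp_units[OF F P b q]
  note np = nagata_props[OF P(2)]
  note np' = nagata_props[OF isometric_nagata[OF \<sigma> P]]
  have m1: "b - (- 1) \<prec> 1" "b' - (- 1) \<prec> 1" "b \<in> V" "b' \<in> V" "- 1 \<in> V"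
    using np(4,5) np'(4,5) b b' by (auto intro: V_uminus)
  have transfer: "poly (map_poly \<sigma> h) b' \<prec> 1 \<longleftrightarrow> poly h b \<prec> 1" if h: "h \<in> polys F" "h \<in> polys V" for h
  proof -
    have hV: "map_poly \<sigma> h \<in> polys V" by (rule isometric_polys[OF \<sigma> h])
    have "poly h b \<prec> 1 \<longleftrightarrow> poly h (- 1) \<prec> 1" by (rule unit_cong[OF poly_V_cong[OF h(2) m1(3,5,1)]])
    also have "\<dots> \<longleftrightarrow> \<sigma> (poly h (- 1)) \<prec> 1" using isometric_small[OF \<sigma>, of "poly h (- 1)"] h(1) by simp
    also have "\<sigma> (poly h (- 1)) = poly (map_poly \<sigma> h) (- 1)" using poly_map_poly_hom[OF h(1), of "- 1"] by simp
    also have "\<dots> \<prec> 1 \<longleftrightarrow> poly (map_poly \<sigma> h) b' \<prec> 1" by (rule unit_cong[OF poly_V_cong[OF hV m1(4,5,2)], symmetric])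
    finally show ?thesis by simp
  qed
  \<comment> \<open>The image of the cofactor \<open>P div q\<close> is a unit at \<open>b'\<close>,
    because the cofactor is one at \<open>b\<close>; so \<open>b'\<close> must be a root of the
    image of \<open>q\<close>.\<close>
  have "poly (map_poly \<sigma> q) b' = 0"
  proof -
    have "map_poly \<sigma> P = map_poly \<sigma> q * map_poly \<sigma> (P div q)"
      by (subst nu(3)) (rule map_poly_hom_mult[OF minpD(1)[OF q] nu(5)])
    then have "poly (map_poly \<sigma> q) b' = 0 \<or> poly (map_poly \<sigma> (P div q)) b' = 0" using b'(1) by simp
    moreover have "poly (map_poly \<sigma> (P div q)) b' \<noteq> 0"
      using transfer[OF nu(5,4)] nu(7) by (auto simp: small_iff)
    ultimately show ?thesis by blast
  qed
  from hom_extend[OF q this] obtain \<tau> where \<tau>: "hom_on (sext F b) \<tau>" "\<And>x. x \<in> F \<Longrightarrow> \<tau> x = \<sigma> x" "\<tau> b = b'"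
    "\<And>g. g \<in> polys F \<Longrightarrow> \<tau> (poly g b) = poly (map_poly \<sigma> g) b'" by blast
  interpret T: hom_on "sext F b" \<tau> by fact
  have local: "\<tau> u \<in> V \<and> (u \<prec> 1 \<longrightarrow> \<tau> u \<prec> 1)" if u: "u \<in> sext F b" "u \<in> V" for u
  proof -
    obtain h k where hk: "h \<in> polys F" "h \<in> polys V" "k \<in> polys F" "k \<in> polys V"
      "\<not> poly k b \<prec> 1" "u * poly k b = poly h b"
      using nagata_ext_local[OF F P b u] by metis
    have kb: "poly k b \<in> sext F b" using hk(3) by (auto simp: sext_def)
    have e: "\<tau> u * poly (map_poly \<sigma> k) b' = poly (map_poly \<sigma> h) b'"
      using arg_cong[OF hk(6), of \<tau>] u(1) kb \<tau>(4) hk(1,3) by simp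
    define w where "w = poly (map_poly \<sigma> k) b'"
    have w: "\<not> w \<prec> 1" using transfer[OF hk(3,4)] hk(5) by (simp add: w_def)
    then have w': "w \<noteq> 0" "inverse w \<in> V" by (auto simp: small_iff)
    have tu: "\<tau> u = poly (map_poly \<sigma> h) b' * inverse w"
      using e w'(1) by (simp add: field_simps flip: w_def)
    show ?thesis
    proof (intro conjI impI)
      show "\<tau> u \<in> V" unfolding tu
        by (intro V_mult polys_V_poly isometric_polys[OF \<sigma> hk(1,2)] m1(4) w'(2))
      assume "u \<prec> 1"
      then have "poly h b \<prec> 1"
        using small_mult(1)[OF _ polys_V_poly[OF hk(4) m1(3)], of u] hk(6) by simp
      then show "\<tau> u \<prec> 1" unfolding tu using transfer[OF hk(1,2)] w'(2) by (intro small_mult(1)) auto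
    qed
  qed
  have "isometric_on (sext F b) \<tau>"
    unfolding isometric_on_def
  proof (intro ballI iffI)
    fix x assume x: "x \<in> sext F b"
    show "\<tau> x \<in> V" if "x \<in> V" using local[OF x that] by simp
    show "x \<in> V" if "\<tau> x \<in> V"
    proof (rule ccontr)
      assume "x \<notin> V"
      then have "inverse x \<in> V" "inverse x \<prec> 1" using V_total[of x] by (auto simp: small_iff)
      then have "inverse (\<tau> x) \<prec> 1" using local[of "inverse x"] x by simp
      then have "\<tau> x = 0 \<or> \<tau> x \<notin> V" by (simp add: small_iff)
      then show False using that x \<open>x \<notin> V\<close> by auto
    qed
  qed
  then show thesis using that \<tau> by blast
qed

section \<open>Henselian subfields avoiding a given algebraic element\<close>

lemma nagata_root_sep: "P \<in> polys F \<Longrightarrow> nagata P \<Longrightarrow> poly P b = 0 \<Longrightarrow> \<not> b \<prec> 1 \<Longrightarrow> sep F b"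
  using nagata_props(6)[of P b] unfolding sep_def by (auto simp: small_iff)

lemma maximal_subfld:
  assumes "good E0" "\<And>F. good F \<Longrightarrow> subfld F"
    "\<And>C. C \<noteq> {} \<Longrightarrow> (\<And>F. F \<in> C \<Longrightarrow> good F) \<Longrightarrow> (\<And>F G. F \<in> C \<Longrightarrow> G \<in> C \<Longrightarrow> F \<subseteq> G \<or> G \<subseteq> F) \<Longrightarrow> good (\<Union>C)"
  obtains F where "good F" "\<And>G. good G \<Longrightarrow> F \<subseteq> G \<Longrightarrow> G = F"
proof -
  have "\<exists>F\<in>Collect good. \<forall>G\<in>Collect good. F \<subseteq> G \<longrightarrow> G = F"
  proof (rule subset_Zorn_nonempty)
    show "Collect good \<noteq> {}" using assms(1) by blast
    fix C assume "C \<noteq> {}" "subset.chain (Collect good) C"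
    then show "\<Union>C \<in> Collect good" using assms(3)[of C] by (auto simp: subset_chain_def)
  qed
  then show thesis using that by blast
qed

text \<open>A maximal subfield omitting \<open>y\<close> contains the unit roots in \<open>H\<close>
  of its Nagata polynomials: such a root is separable, and a \<open>p\<close>-th root cannot enter
  through a separable extension.\<close>

lemma hens_avoiding_insep:
  assumes H: "hens H" and E0: "subfld E0" "E0 \<subseteq> H" and y: "y \<notin> E0" "y ^ CHAR('a) \<in> E0" "CHAR('a) > 0"
  obtains F where "hens F" "E0 \<subseteq> F" "F \<subseteq> H" "y \<notin> F"
proof -
  define good where "good F \<longleftrightarrow> subfld F \<and> E0 \<subseteq> F \<and> F \<subseteq> H \<and> y \<notin> F" for F
  obtain F where F: "good F" and max: "\<And>G. good G \<Longrightarrow> F \<subseteq> G \<Longrightarrow> G = F"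
  proof (rule maximal_subfld[of good E0])
    show "good E0" using E0 y by (simp add: good_def)
    show "good (\<Union>C)" if "C \<noteq> {}" "\<And>F. F \<in> C \<Longrightarrow> good F" "\<And>F G. F \<in> C \<Longrightarrow> G \<in> C \<Longrightarrow> F \<subseteq> G \<or> G \<subseteq> F" for C
      using that subfld_Union_chain[of C] unfolding good_def by blast
  qed (auto simp: good_def)
  interpret F: subfld F using F by (simp add: good_def)
  interpret H: subfld H using H by (simp add: hens_def)
  have "hens F"
    unfolding hens_def
  proof (intro conjI ballI impI)
    show "subfld F" by (rule F.subfld_axioms)
    fix P assume P: "P \<in> polys F" "nagata P"
    then obtain b where b: "b \<in> H" "poly P b = 0" "\<not> b \<prec> 1"
      using H F polys_mono[of F H] unfolding hens_def good_def by blast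
    have "b \<in> F"
    proof (rule ccontr)
      assume "b \<notin> F"
      have sep: "sep F b" by (rule nagata_root_sep[OF P b(2,3)])
      have "F \<subseteq> sext F b" by (rule F.sext_incl)
      moreover have "sext F b \<noteq> F" using F.sext_gen \<open>b \<notin> F\<close> by blast
      ultimately have "\<not> good (sext F b)" using max by blast
      moreover have "subfld (sext F b)" by (rule F.sext_subfld[OF sep_alg[OF sep]])
      moreover have "sext F b \<subseteq> H" using F b(1) by (intro F.sext_minimal H.subfld_axioms) (auto simp: good_def)
      ultimately have "y \<in> sext F b" using F \<open>F \<subseteq> sext F b\<close> unfolding good_def by blast
      then have "y \<in> F" using sep_pth_root[OF F.subfld_axioms sep _ _ y(3)] y(2) F unfolding good_def by blast
      then show False using F by (simp add: good_def)
    qed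
    then show "\<exists>b\<in>F. poly P b = 0 \<and> \<not> b \<prec> 1" using b by blast
  qed
  then show thesis using that F unfolding good_def by blast
qed

text \<open>Take \<open>F\<close> maximal such that \<open>y\<close> to \<open>y'\<close> is
  isometric over \<open>F\<close>. This isometry fixes the coefficients of a Nagata polynomial over
  \<open>F\<close>, so it extends to a root \<open>b\<close> in \<open>H\<close> with
  \<open>b\<close> fixed; it is then an isometry over \<open>F(b)\<close>, whence \<open>b\<close>
  is in \<open>F\<close>. And \<open>y\<close> is not in \<open>F\<close>, since elements of
  \<open>F\<close> do not move.\<close>

lemma hens_avoiding_sep:
  assumes H: "hens H" and E0: "subfld E0" "E0 \<subseteq> H" and y: "alg E0 y" "y' \<noteq> y"
    and iso: "\<And>g. g \<in> polys E0 \<Longrightarrow> (poly g y = 0 \<longrightarrow> poly g y' = 0) \<and> (poly g y \<in> V \<longleftrightarrow> poly g y' \<in> V)"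
  obtains F where "hens F" "E0 \<subseteq> F" "F \<subseteq> H" "y \<notin> F"
proof -
  define good where "good F \<longleftrightarrow> subfld F \<and> E0 \<subseteq> F \<and> F \<subseteq> H \<and>
    (\<forall>g\<in>polys F. (poly g y = 0 \<longrightarrow> poly g y' = 0) \<and> (poly g y \<in> V \<longleftrightarrow> poly g y' \<in> V))" for F
  obtain F where F: "good F" and max: "\<And>G. good G \<Longrightarrow> F \<subseteq> G \<Longrightarrow> G = F"
  proof (rule maximal_subfld[of good E0])
    show "good E0" using E0 iso by (simp add: good_def)
    show "good (\<Union>C)" if C: "C \<noteq> {}" "\<And>F. F \<in> C \<Longrightarrow> good F" "\<And>F G. F \<in> C \<Longrightarrow> G \<in> C \<Longrightarrow> F \<subseteq> G \<or> G \<subseteq> F" for C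
    proof -
      have sub: "subfld F" if "F \<in> C" for F using C(2)[OF that] by (simp add: good_def)
      have "\<exists>F\<in>C. g \<in> polys F" if "g \<in> polys (\<Union>C)" for g
        by (rule polys_Union_chain[OF C(1,3) that]) (auto intro: subfld.zero[OF sub])
      then have "(poly g y = 0 \<longrightarrow> poly g y' = 0) \<and> (poly g y \<in> V \<longleftrightarrow> poly g y' \<in> V)" if "g \<in> polys (\<Union>C)" for g
        using C(2) that unfolding good_def by blast
      moreover have "subfld (\<Union>C)" using subfld_Union_chain[OF C(1) sub C(3)] .
      moreover have "E0 \<subseteq> \<Union>C" "\<Union>C \<subseteq> H" using C(1,2) unfolding good_def by blast+
      ultimately show ?thesis unfolding good_def by blast
    qed
  qed (auto simp: good_def)
  interpret F: subfld F using F by (simp add: good_def)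
  interpret H: subfld H using H by (simp add: hens_def)
  have FE: "E0 \<subseteq> F" "F \<subseteq> H" using F by (simp_all add: good_def)
  have algF: "alg F y" using alg_mono[OF FE(1) y(1)] .
  obtain q where q: "minp F y q" using F.minp_exists[OF algF] .
  have "conj F y y'" using F unfolding good_def conj_def by blast
  then have "poly (map_poly id q) y' = 0" using F.minp_conj_iff[OF q] by simp
  from hom_on.hom_extend[OF F.id_hom_on q this] obtain \<sigma> where \<sigma>: "hom_on (sext F y) \<sigma>"
    "\<And>x. x \<in> F \<Longrightarrow> \<sigma> x = x" "\<sigma> y = y'" "\<And>g. g \<in> polys F \<Longrightarrow> \<sigma> (poly g y) = poly g y'" by auto
  interpret S: hom_on "sext F y" \<sigma> by fact
  have iso\<sigma>: "isometric_on (sext F y) \<sigma>"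
    using F \<sigma>(4) unfolding isometric_on_def sext_def good_def by auto
  have "y \<notin> F"
  proof
    assume "y \<in> F"
    then show False using \<sigma>(2,3) y(2) by auto
  qed
  moreover have "hens F"
    unfolding hens_def
  proof (intro conjI ballI impI)
    show "subfld F" by (rule F.subfld_axioms)
    fix P assume P: "P \<in> polys F" "nagata P"
    then obtain b where b: "b \<in> H" "poly P b = 0" "\<not> b \<prec> 1"
      using H polys_mono[OF FE(2)] unfolding hens_def by blast
    let ?F1 = "sext F y"
    have F1: "F \<subseteq> ?F1" by (rule F.sext_incl)
    have P1: "P \<in> polys ?F1" using polys_mono[OF F1] P(1) by blast
    have map_id: "map_poly \<sigma> g = g" if "g \<in> polys F" for g
      using \<sigma>(2) that by (intro poly_eqI) (auto simp: coeff_map_poly polysD)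
    from isometric_nagata_extend[OF \<sigma>(1) iso\<sigma> P1 P(2) b(2,3)] obtain \<tau> where
      \<tau>: "hom_on (sext ?F1 b) \<tau>" "isometric_on (sext ?F1 b) \<tau>" "\<And>x. x \<in> ?F1 \<Longrightarrow> \<tau> x = \<sigma> x" "\<tau> b = b"
      using map_id[OF P(1)] b(2,3) by metis
    interpret T: hom_on "sext ?F1 b" \<tau> by fact
    have algb: "alg F b" by (rule sep_alg[OF nagata_root_sep[OF P b(2,3)]])
    let ?Fb = "sext F b"
    have F1b: "?F1 \<subseteq> sext ?F1 b" "b \<in> sext ?F1 b" by (rule S.sext_incl, rule S.sext_gen)
    have FbT: "?Fb \<subseteq> sext ?F1 b"
      using F1 F1b by (intro F.sext_minimal T.subfld_axioms) auto
    have \<tau>F: "\<tau> x = x" if "x \<in> F" for x using \<tau>(3) \<sigma>(2) F1 that by auto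
    have \<tau>id: "\<tau> x = x" if x: "x \<in> ?Fb" for x
    proof -
      obtain g where g: "g \<in> polys F" "x = poly g b" using x by (auto simp: sext_def)
      have "map_poly \<tau> g = g" using \<tau>F g(1) by (intro poly_eqI) (auto simp: coeff_map_poly polysD)
      moreover have "g \<in> polys (sext ?F1 b)" using g(1) polys_mono F1 F1b(1) by blast
      ultimately show ?thesis using T.poly_map_poly_hom[of g b] F1b(2) \<tau>(4) g(2) by simp
    qed
    have "good ?Fb"
      unfolding good_def
    proof (intro conjI ballI)
      show "subfld ?Fb" by (rule F.sext_subfld[OF algb])
      show "E0 \<subseteq> ?Fb" using FE(1) F.sext_incl by blast
      show "?Fb \<subseteq> H" using FE(2) b(1) by (intro F.sext_minimal H.subfld_axioms)
      fix g assume g: "g \<in> polys ?Fb"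
      have "map_poly \<tau> g = g" using \<tau>id g by (intro poly_eqI) (auto simp: coeff_map_poly polysD)
      moreover have g1: "g \<in> polys (sext ?F1 b)" using g polys_mono[OF FbT] by blast
      moreover have y1: "y \<in> sext ?F1 b" "\<tau> y = y'" using F.sext_gen[of y] F1b(1) \<tau>(3) \<sigma>(3) by auto
      ultimately have gy: "\<tau> (poly g y) = poly g y'" using T.poly_map_poly_hom[of g y] by simp
      have "poly g y \<in> sext ?F1 b" using g1 y1(1) by (rule T.poly_closed)
      then have "\<tau> (poly g y) \<in> V \<longleftrightarrow> poly g y \<in> V" using \<tau>(2) unfolding isometric_on_def by blast
      then show "poly g y \<in> V \<longleftrightarrow> poly g y' \<in> V" by (simp add: gy)
      show "poly g y = 0 \<longrightarrow> poly g y' = 0" using gy T.hom_zero by metis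
    qed
    then have "?Fb = F" using max F.sext_incl by blast
    then show "\<exists>b\<in>F. poly P b = 0 \<and> \<not> b \<prec> 1" using b F.sext_gen by blast
  qed
  ultimately show thesis using that FE by blast
qed

end

section \<open>Limits of sequences of rigid elements\<close>

lemma (in subfld) conj_poly:
  assumes "conj F x x'" "g \<in> polys F" shows "conj F (poly g x) (poly g x')"
  unfolding conj_def
proof (intro ballI impI)
  fix h assume h: "h \<in> polys F" "poly h (poly g x) = 0"
  then have "pcompose h g \<in> polys F" "poly (pcompose h g) x = 0" using assms(2) by (auto simp: poly_pcompose)
  then have "poly (pcompose h g) x' = 0" using assms(1) unfolding conj_def by blast
  then show "poly h (poly g x') = 0" by (simp add: poly_pcompose)
qed

definition fracs :: "'a::field set \<Rightarrow> 'a \<Rightarrow> 'a set" where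
  "fracs L z = {poly g z / poly h z |g h. g \<in> polys L \<and> h \<in> polys L \<and> poly h z \<noteq> 0}"

context subfld
begin

lemma fracsI: "g \<in> polys F \<Longrightarrow> h \<in> polys F \<Longrightarrow> poly h z \<noteq> 0 \<Longrightarrow> poly g z / poly h z \<in> fracs F z"
  unfolding fracs_def by blast

lemma fracs_subfld: "subfld (fracs F z)"
proof
  show "1 \<in> fracs F z" using fracsI[of 1 1 z] by simp
next
  fix x y assume "x \<in> fracs F z" "y \<in> fracs F z"
  then obtain g h g' h' where *: "g \<in> polys F" "h \<in> polys F" "poly h z \<noteq> 0" "x = poly g z / poly h z"
    "g' \<in> polys F" "h' \<in> polys F" "poly h' z \<noteq> 0" "y = poly g' z / poly h' z"
    unfolding fracs_def by blast
  have "x - y = poly (g * h' - g' * h) z / poly (h * h') z"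
    unfolding *(4,8) using *(3,7) by (simp add: diff_frac_eq algebra_simps)
  then show "x - y \<in> fracs F z" using * fracsI[of "g * h' - g' * h" "h * h'" z] by simp
  have "x * y = poly (g * g') z / poly (h * h') z" using * by simp
  then show "x * y \<in> fracs F z" using * fracsI[of "g * g'" "h * h'" z] by simp
next
  fix x assume "x \<in> fracs F z"
  then obtain g h where *: "g \<in> polys F" "h \<in> polys F" "poly h z \<noteq> 0" "x = poly g z / poly h z"
    unfolding fracs_def by blast
  show "inverse x \<in> fracs F z"
  proof (cases "poly g z = 0")
    case True
    then show ?thesis using * fracsI[of 0 1 z] by simp
  next
    case False
    then show ?thesis using * fracsI[of h g z] by simp
  qed
qed

lemma fracs_incl: "F \<subseteq> fracs F z" "z \<in> fracs F z"
proof -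
  show "F \<subseteq> fracs F z" using fracsI[of "[:_:]" 1 z] by auto
  show "z \<in> fracs F z" using fracsI[of "[:0, 1:]" 1 z] by simp
qed

lemma fracs_minimal: "subfld E \<Longrightarrow> F \<subseteq> E \<Longrightarrow> z \<in> E \<Longrightarrow> fracs F z \<subseteq> E"
  using polys_mono[of F E] unfolding fracs_def
  by (auto intro!: subfld.divide subfld.poly_closed)

lemma polys_fracs:
  assumes "g \<in> polys (fracs F z)"
  obtains d c where "d \<in> polys F" "poly d z \<noteq> 0" "\<And>i. c i \<in> polys F" "\<And>i. poly d z * coeff g i = poly (c i) z"
proof -
  have "\<exists>d c. d \<in> polys F \<and> poly d z \<noteq> 0 \<and> (\<forall>i. c i \<in> polys F) \<and> (\<forall>i. poly d z * coeff g i = poly (c i) z)"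
    using assms
  proof (induction g)
    case 0
    show ?case by (intro exI[of _ 1] exI[of _ "\<lambda>_. 0"]) auto
  next
    case (pCons a g)
    have "a \<in> fracs F z" "g \<in> polys (fracs F z)"
      using subfld.polys_pCons[OF fracs_subfld] pCons.prems by blast+
    then obtain n m where nm: "n \<in> polys F" "m \<in> polys F" "poly m z \<noteq> 0" "a = poly n z / poly m z"
      unfolding fracs_def by blast
    obtain d c where dc: "d \<in> polys F" "poly d z \<noteq> 0" "\<And>i. c i \<in> polys F" "\<And>i. poly d z * coeff g i = poly (c i) z"
      using pCons.IH[OF \<open>g \<in> polys (fracs F z)\<close>] by blast
    show ?case
    proof (intro exI[of _ "d * m"] exI[of _ "\<lambda>i. case i of 0 \<Rightarrow> d * n | Suc j \<Rightarrow> m * c j"] conjI allI)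
      fix i
      show "poly (d * m) z * coeff (pCons a g) i = poly (case i of 0 \<Rightarrow> d * n | Suc j \<Rightarrow> m * c j) z"
        using nm dc by (auto simp: coeff_pCons algebra_simps simp flip: dc(4) split: nat.splits)
    qed (use nm dc in \<open>auto split: nat.splits\<close>)
  qed
  then show thesis using that by blast
qed

end

locale tame_limit = valued V for V :: "'a::alg_closed_field set" +
  fixes K :: "'a set" and x :: "nat \<Rightarrow> 'a" and z :: 'a
  assumes K: "subfld K" and uniK: "uni K" and rigid_x: "\<And>n. rigid K (x n)"
    and x_decr: "\<And>n. x (Suc n) \<prec> x n"
    and lim: "\<And>n. z - (\<Sum>j<n. x j) \<preceq> x n"
begin

sublocale K: subfld K by (rule K)

definition s :: "nat \<Rightarrow> 'a" where "s n = (\<Sum>j<n. x j)"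

lemma s_Suc: "s (Suc n) = s n + x n"
  by (simp add: s_def)

lemma x_nonzero: "x n \<noteq> 0"
  using vlt_nonzero[OF x_decr] .

lemma x_mono: "m \<le> n \<Longrightarrow> x n \<preceq> x m"
proof (induction n)
  case (Suc n)
  then show ?case using vlt_imp_vle[OF x_decr[of n]] by (cases "m = Suc n") (auto intro: vle_trans)
qed simp

lemma x_strict: "m < n \<Longrightarrow> x n \<prec> x m"
  using vle_vlt_trans[OF x_mono[of "Suc m" n] x_decr[of m]] by simp

text \<open>The reverse estimate uses the next index: \<open>z - s n\<close> is the sum of
  \<open>x n\<close> and the smaller \<open>z - s (Suc n)\<close>.\<close>

lemma z_s: "z - s n \<preceq> x n" "x n \<preceq> z - s n"
proof -
  show *: "z - s n \<preceq> x n" for n using lim by (simp add: s_def)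
  have "z - s (Suc n) \<prec> x n" using vle_vlt_trans[OF * x_decr] .
  then have "x n \<preceq> x n + (z - s (Suc n))" by (rule vle_add_dominant)
  then show "x n \<preceq> z - s n" by (simp add: s_Suc)
qed

lemma s_diff: "m \<le> n \<Longrightarrow> s n - s m \<preceq> x m"
  using vle_diff[OF z_s(1)[of m] vle_trans[OF z_s(1) x_mono[of m n]]] by simp

lemma approx_strict:
  assumes "a - s n \<preceq> x n" "i < n" shows "a - s (Suc i) \<prec> x i"
proof -
  have "a - s n \<prec> x i" using vle_vlt_trans[OF assms(1) x_strict[OF assms(2)]] .
  moreover have "s n - s (Suc i) \<prec> x i"
    using vle_vlt_trans[OF s_diff[of "Suc i" n] x_decr[of i]] assms(2) by simp
  ultimately have "(a - s n) + (s n - s (Suc i)) \<prec> x i" by (rule vlt_add)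
  then show ?thesis by simp
qed

text \<open>Stated for any \<open>a\<close> in place of \<open>z\<close>: it serves for
  \<open>z\<close> in henselian fields and for an algebraic \<open>a\<close> in
  \<open>K(a)\<close>.\<close>

lemma approx_contains:
  assumes F: "subfld F" "uni F" "K \<subseteq> F" and a: "a \<in> F" "\<And>i. i < n \<Longrightarrow> a - s (Suc i) \<prec> x i"
  shows "i < n \<Longrightarrow> x i \<in> F"
proof (induction i rule: less_induct)
  case (less i)
  interpret F: subfld F by fact
  have "s i \<in> F" unfolding s_def using less by (intro F.sum) auto
  then have "a - s i \<in> F" using a(1) by simp
  moreover have "x i - (a - s i) \<prec> x i"
    using a(2)[OF less.prems] vlt_minus_commute[of "a - s i" "x i" "x i"] by (simp add: s_Suc diff_diff_eq)
  ultimately show ?case using krasner[OF F rigid_x] by blast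
qed

lemma x_alg: "alg K (x n)"
  using sep_alg[OF rigid_sep[OF rigid_x]] .

lemma s_alg: "alg K (s n)"
  unfolding s_def using subfld.sum[OF K.algs_subfld, of "{..<n}" x] x_alg by simp

text \<open>The quotient \<open>u / w\<close> is congruent to 1; for series this is equality of
  leading terms. It forces \<open>w\<close> to be nonzero.\<close>

definition close :: "'a \<Rightarrow> 'a \<Rightarrow> bool" where "close u w \<longleftrightarrow> u - w \<prec> w"

lemma close_mult:
  assumes "close u w" "close u' w'" shows "close (u * u') (w * w')"
proof -
  have w: "w \<noteq> 0" "w' \<noteq> 0" using assms vlt_nonzero unfolding close_def by blast+
  have u': "u' \<preceq> w'"
    using vle_add_dominant(2)[of "u' - w'" w'] assms(2) by (simp add: close_def)
  have "u * u' - w * w' = (u - w) * u' + w * (u' - w')" by (simp add: algebra_simps)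
  moreover have "(u - w) * u' \<prec> w * w'" using assms(1) u' w(2) unfolding close_def by (rule vlt_vle_mult)
  moreover have "w * (u' - w') \<prec> w * w'" using assms(2) w(1) unfolding close_def by (intro vle_vlt_mult) auto
  ultimately show ?thesis unfolding close_def by (metis vlt_add)
qed

lemma closeD: "close u w \<Longrightarrow> u \<preceq> w" "close u w \<Longrightarrow> w \<preceq> u" "close u w \<Longrightarrow> u \<noteq> 0" "close u w \<Longrightarrow> w \<noteq> 0"
proof -
  assume "close u w"
  then have *: "u - w \<prec> w" by (simp add: close_def)
  show "u \<preceq> w" "w \<preceq> u" using vle_add_dominant[OF *] by auto
  then show "w \<noteq> 0" "u \<noteq> 0" using vlt_nonzero[OF *] by auto
qed

text \<open>For \<open>a\<close> algebraic over \<open>K\<close> and an ultimate approximation of \<open>z\<close>, Krasner's Lemma puts all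
  \<open>x n\<close> into \<open>K(a)\<close>.\<close>

lemma stable_difference:
  assumes inf: "\<And>a. alg K a \<Longrightarrow> \<exists>n. x n \<notin> sext K a" and a: "alg K a"
  shows "\<exists>n0. \<forall>n\<ge>n0. z - s n \<prec> a - s n"
proof (rule ccontr)
  assume *: "\<not> ?thesis"
  have "x i \<in> sext K a" for i
  proof -
    obtain n where n: "n \<ge> Suc i" "\<not> z - s n \<prec> a - s n" using * by blast
    then have an: "a - s n \<preceq> x n" using vle_trans[OF _ z_s(1)] by simp
    show ?thesis
    proof (rule approx_contains[of _ a n])
      show "subfld (sext K a)" by (rule K.sext_subfld[OF a])
      show "uni (sext K a)" using K.alg_sext[OF a] by (intro uni_alg_ext[OF K uniK K.sext_incl]) auto
      show "K \<subseteq> sext K a" by (rule K.sext_incl)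
      show "a \<in> sext K a" by (rule K.sext_gen)
      show "i < n" using n(1) by simp
      show "a - s (Suc j) \<prec> x j" if "j < n" for j using approx_strict[OF an that] .
    qed
  qed
  then show False using inf[OF a] by blast
qed

lemma stable_poly:
  assumes inf: "\<And>a. alg K a \<Longrightarrow> \<exists>n. x n \<notin> sext K a" and f: "f \<in> polys {a. alg K a}" "f \<noteq> 0"
  shows "\<exists>n0. \<forall>n\<ge>n0. close (poly f z) (poly f (s n))"
proof -
  obtain A where A: "f = Polynomial.smult (lead_coeff f) (\<Prod>a\<in>#A. [:- a, 1:])"
    using alg_closed_imp_factorization[OF f(2)] by blast
  have "alg K a" if "a \<in># A" for a
  proof (rule K.alg_trans[OF f])
    show "poly f a = 0" using that by (subst A) (auto simp: poly_prod_mset prod_mset_zero_iff)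
  qed
  then have "\<exists>n0. \<forall>n\<ge>n0. close (poly (\<Prod>a\<in>#A. [:- a, 1:]) z) (poly (\<Prod>a\<in>#A. [:- a, 1:]) (s n))"
  proof (induction A)
    case empty
    then show ?case by (simp add: close_def)
  next
    case (add a A)
    obtain n1 where n1: "\<forall>n\<ge>n1. close (poly (\<Prod>a\<in>#A. [:- a, 1:]) z) (poly (\<Prod>a\<in>#A. [:- a, 1:]) (s n))"
      using add by auto
    obtain n2 where n2: "\<forall>n\<ge>n2. z - s n \<prec> a - s n" using stable_difference[OF inf, of a] add.prems by auto
    have "close (z - a) (s n - a)" if "n \<ge> n2" for n
      using n2 that vlt_uminus(2)[of "z - s n" "a - s n"] by (simp add: close_def)
    then have "\<forall>n\<ge>max n1 n2. close ((z - a) * poly (\<Prod>a\<in>#A. [:- a, 1:]) z)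
        ((s n - a) * poly (\<Prod>a\<in>#A. [:- a, 1:]) (s n))"
      using n1 by (auto intro: close_mult)
    moreover have "poly (\<Prod>a\<in>#add_mset a A. [:- a, 1:]) w = (w - a) * poly (\<Prod>a\<in>#A. [:- a, 1:]) w" for w
      by (simp add: algebra_simps)
    ultimately show ?case by metis
  qed
  then obtain n0 where "\<forall>n\<ge>n0. close (poly (\<Prod>a\<in>#A. [:- a, 1:]) z) (poly (\<Prod>a\<in>#A. [:- a, 1:]) (s n))" by blast
  moreover have "close (lead_coeff f) (lead_coeff f)" using f(2) by (simp add: close_def)
  ultimately show ?thesis by (subst A, subst (2) A) (auto intro: close_mult)
qed

lemma z_transcendental_aux:
  assumes inf: "\<And>a. alg K a \<Longrightarrow> \<exists>n. x n \<notin> sext K a" and f: "f \<in> polys {a. alg K a}" "poly f z = 0"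
  shows "f = 0"
  using stable_poly[OF inf f(1)] closeD(3) f(2) by fastforce

lemma z_transcendental:
  assumes inf: "\<And>a. alg K a \<Longrightarrow> \<exists>n. x n \<notin> sext K a" shows "\<not> alg K z"
proof
  assume "alg K z"
  then obtain f where "f \<in> polys K" "f \<noteq> 0" "poly f z = 0" by (auto simp: alg_def)
  then show False using z_transcendental_aux[OF inf, of f] polys_mono[of K "{a. alg K a}"] K.alg_mem by blast
qed

text \<open>\<open>H\<close> plays the part of \<open>k((G))\<close>: it bounds the competing fields
  \<open>F\<close>, since the henselization is formed inside \<open>k((G))\<close>.\<close>

lemma algebraic_in_henselization:
  assumes inf: "\<And>a. alg K a \<Longrightarrow> \<exists>n. x n \<notin> sext K a"
    and L: "subfld L" "K \<subseteq> L" "\<And>u. u \<in> L \<Longrightarrow> alg K u" "\<And>n. x n \<in> L"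
    and H: "hens H" "L \<subseteq> H" "z \<in> H"
  shows "alg K y \<Longrightarrow> (\<And>F. hens F \<Longrightarrow> L \<subseteq> F \<Longrightarrow> z \<in> F \<Longrightarrow> F \<subseteq> H \<Longrightarrow> y \<in> F) \<Longrightarrow> y \<in> L"
proof -
  interpret L: subfld L by fact
  let ?A = "{a. alg K a}"
  interpret A: subfld ?A by (rule K.algs_subfld)
  have uniL: "uni L" by (rule uni_alg_ext[OF K uniK L(2,3)])
  let ?E0 = "fracs L z"
  have E0: "subfld ?E0" "L \<subseteq> ?E0" "z \<in> ?E0" by (rule L.fracs_subfld, rule L.fracs_incl, rule L.fracs_incl)
  have E0H: "?E0 \<subseteq> H" using H by (intro L.fracs_minimal) (auto simp: hens_def)
  have LA: "polys L \<subseteq> polys ?A" using L(3) by (intro polys_mono) auto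
  have sL: "s n \<in> L" for n unfolding s_def using L(4) by (intro L.sum)
  have algL: "alg L u" if "alg K u" for u using alg_mono[OF L(2) that] .
  \<comment> \<open>\<open>z\<close> satisfies no nontrivial equation with algebraic coefficients,
    so \<open>g(z) = u * h(z)\<close> is an identity of polynomials, and \<open>u\<close> is a
    quotient of coefficients from \<open>L\<close>.\<close>
  have E0_alg: "u \<in> L" if u: "u \<in> ?E0" "alg K u" for u
  proof -
    obtain g h where gh: "g \<in> polys L" "h \<in> polys L" "poly h z \<noteq> 0" "u = poly g z / poly h z"
      using u(1) unfolding fracs_def by blast
    have "g - Polynomial.smult u h \<in> polys ?A" using gh(1,2) LA u(2) by auto
    moreover have "poly (g - Polynomial.smult u h) z = 0" using gh(3,4) by simp
    ultimately have "g = Polynomial.smult u h" using z_transcendental_aux[OF inf] by fastforce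
    moreover have "lead_coeff h \<noteq> 0" using gh(3) by auto
    ultimately have "u = coeff g (degree h) / lead_coeff h" by simp
    then show ?thesis using gh(1,2) by (metis L.divide polysD)
  qed
  have sep_case: "y \<in> L" if y: "alg K y" "\<And>F. hens F \<Longrightarrow> L \<subseteq> F \<Longrightarrow> z \<in> F \<Longrightarrow> F \<subseteq> H \<Longrightarrow> y \<in> F" "sep L y" for y
  proof (rule ccontr)
    assume yL: "y \<notin> L"
    obtain q where q: "minp L y q" using L.minp_exists[OF algL[OF y(1)]] .
    have card: "card {a. poly q a = 0} = degree q"
      using L.minp_coprime[OF q] L.sep_iff_minp[OF q] minpD(1,2)[OF q] y(3) by (intro card_simple_roots) auto
    have "degree q \<noteq> 1" using L.minp_degree_1[OF q] yL by blast
    then have "{a. poly q a = 0} \<noteq> {y}" using card by auto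
    then obtain y' where y': "poly q y' = 0" "y' \<noteq> y" using minpD(3)[OF q] by blast
    have c: "conj L y y'" "conj L y' y"
      using L.minp_conj_iff[OF q] y'(1) L.conj_sym[OF algL[OF y(1)]] by auto
    have alg': "alg K y'" using conj_mono[OF L(2) c(1)] K.conj_alg[OF y(1)] by blast
    \<comment> \<open>Clear denominators: \<open>d(z) * g(w) = h_w(z)\<close> for
      \<open>w = y\<close> and \<open>w = y'\<close>. For large \<open>n\<close> the size of a
      nonzero \<open>h_w\<close> at \<open>z\<close> is that of \<open>h_w(s n) = G_n(w)\<close>,
      and \<open>G_n\<close> has coefficients in \<open>L\<close>, over which conjugates have equal
      absolute value.\<close>
    have iso: "(poly g y = 0 \<longrightarrow> poly g y' = 0) \<and> (poly g y \<in> V \<longleftrightarrow> poly g y' \<in> V)" if g: "g \<in> polys ?E0" for g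
    proof -
      obtain d c where dc: "d \<in> polys L" "poly d z \<noteq> 0" "\<And>i. c i \<in> polys L"
        "\<And>i. poly d z * coeff g i = poly (c i) z" using L.polys_fracs[OF g] by metis
      define N where "N = degree g"
      define h where "h w = (\<Sum>i\<le>N. Polynomial.smult (w ^ i) (c i))" for w
      define G where "G n = (\<Sum>i\<le>N. Polynomial.monom (poly (c i) (s n)) i)" for n
      have hA: "h w \<in> polys ?A" if "alg K w" for w
        unfolding h_def using LA dc(3) that by (intro A.polys_sum A.polys_smult A.power) auto
      have hz: "poly (h w) z = poly d z * poly g w" for w
        by (simp add: h_def poly_sum poly_altdef[of g] N_def sum_distrib_left algebra_simps flip: dc(4))
      have hs: "poly (h w) (s n) = poly (G n) w" for w n
        by (simp add: h_def G_def poly_sum poly_monom algebra_simps)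
      have GL: "G n \<in> polys L" for n
        unfolding G_def using dc(3) sL by (intro L.polys_sum L.polys_monom L.poly_closed)
      \<comment> \<open>Each coefficient of \<open>h w\<close> is a polynomial in \<open>w\<close>
        over \<open>L\<close>, so vanishing passes to conjugates.\<close>
      have h0: "h w' = 0" if "h w = 0" "conj L w w'" for w w'
      proof (rule poly_eqI)
        fix k
        define r where "r = (\<Sum>i\<le>N. Polynomial.monom (coeff (c i) k) i)"
        have r: "poly r w = coeff (h w) k" for w
          by (simp add: r_def h_def poly_sum poly_monom coeff_sum algebra_simps)
        have "r \<in> polys L" unfolding r_def using dc(3) by (intro L.polys_sum L.polys_monom) (auto simp: polysD)
        then show "coeff (h w') k = coeff 0 k" using that r unfolding conj_def by (metis coeff_0)
      qed
      show ?thesis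
      proof (cases "h y = 0")
        case True
        then have "poly g y = 0" "poly g y' = 0" using h0[OF True c(1)] hz[of y] hz[of y'] dc(2) by auto
        then show ?thesis by simp
      next
        case False
        then have "h y' \<noteq> 0" using h0[OF _ c(2)] by blast
        obtain n1 where n1: "\<forall>n\<ge>n1. close (poly (h y) z) (poly (h y) (s n))"
          using stable_poly[OF inf hA[OF y(1)] False] by blast
        obtain n2 where n2: "\<forall>n\<ge>n2. close (poly (h y') z) (poly (h y') (s n))"
          using stable_poly[OF inf hA[OF alg'] \<open>h y' \<noteq> 0\<close>] by blast
        define n where "n = max n1 n2"
        have cl: "close (poly (h y) z) (poly (h y) (s n))" "close (poly (h y') z) (poly (h y') (s n))"
          using n1 n2 by (auto simp: n_def)
        have "poly (h y) (s n) \<preceq> poly (h y') (s n)" "poly (h y') (s n) \<preceq> poly (h y) (s n)"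
          unfolding hs
          using uniL L.conj_poly[OF c(1) GL, of n] L.conj_poly[OF c(2) GL, of n]
            L.alg_sext[OF algL[OF y(1)], of "poly (G n) y"] L.alg_sext[OF algL[OF alg'], of "poly (G n) y'"] GL
          unfolding uni_def sext_def by blast+
        then have "poly (h y) z \<preceq> poly (h y') z" "poly (h y') z \<preceq> poly (h y) z"
          using closeD(1,2)[OF cl(1)] closeD(1,2)[OF cl(2)] vle_trans by blast+
        then have "poly g y \<preceq> poly g y'" "poly g y' \<preceq> poly g y"
          using vle_mult_cancel[OF dc(2)] unfolding hz by (simp_all add: mult.commute[of "poly d z"])
        moreover have "poly g y \<noteq> 0" using closeD(3)[OF cl(1)] by (simp add: hz)
        ultimately show ?thesis using vle_trans unfolding V_iff by blast
      qed
    qed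
    obtain F where F: "hens F" "?E0 \<subseteq> F" "F \<subseteq> H" "y \<notin> F"
      using hens_avoiding_sep[OF H(1) E0(1) E0H alg_mono[OF E0(2) algL[OF y(1)]] y'(2) iso] by blast
    then show False using y(2)[OF F(1) _ _ F(3)] E0 by blast
  qed
  show "alg K y \<Longrightarrow> (\<And>F. hens F \<Longrightarrow> L \<subseteq> F \<Longrightarrow> z \<in> F \<Longrightarrow> F \<subseteq> H \<Longrightarrow> y \<in> F) \<Longrightarrow> y \<in> L"
  \<comment> \<open>Induction on the degree over \<open>L\<close>, expressed through
    \<open>LEAST\<close> since minimal polynomials are given by a predicate.\<close>
  proof (induction "LEAST n. \<exists>q. minp L y q \<and> degree q = n" arbitrary: y rule: less_induct)
    case less
    let ?deg = "\<lambda>y. LEAST n. \<exists>q. minp L y q \<and> degree q = n"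
    have deg: "?deg u \<le> degree q" if "minp L u q" for u q using that by (intro Least_le) blast
    show ?case
    proof (cases "sep L y")
      case True
      then show ?thesis using sep_case less.prems by blast
    next
      case False
      obtain q0 where "minp L y q0" using L.minp_exists[OF algL[OF less.prems(1)]] .
      then have "\<exists>n q. minp L y q \<and> degree q = n" by blast
      from LeastI_ex[OF this] obtain q where q: "minp L y q" "degree q = ?deg y" by blast
      let ?P = "CHAR('a)"
      have pq: "pderiv q = 0" using L.minp_pderiv_zero[OF q(1) False] .
      have P: "?P > 0" using False L.sepI_pth_power[OF algL[OF less.prems(1)]] by blast
      obtain r where r: "q = pcompose r (Polynomial.monom 1 ?P)" "r \<in> polys L"
        using pderiv_zero_pcompose[OF pq P] minpD(1)[OF q(1)] L.zero by metis
      have root: "poly r (y ^ ?P) = 0" using minpD(3)[OF q(1)] by (simp add: r(1) poly_pcompose poly_monom)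
      have r0: "r \<noteq> 0" using minpD(4)[OF q(1)] r(1) by auto
      have algP: "alg K (y ^ ?P)" using A.power[of y ?P] less.prems(1) by simp
      obtain q' where q': "minp L (y ^ ?P) q'" using L.minp_exists[OF algL[OF algP]] .
      have "?deg (y ^ ?P) \<le> degree r" using deg[OF q'] minpD(5)[OF q' r(2) root r0] by simp
      also have "degree r < degree q"
      proof -
        have "degree q = degree r * ?P" by (simp add: r(1) degree_pcompose degree_monom_eq)
        moreover have "?P > 1" using prime_CHAR_semidom[OF P] by (rule prime_gt_1_nat)
        ultimately show ?thesis using L.minp_degree_pos[OF q(1)] by auto
      qed
      \<comment> \<open>The power \<open>y^p\<close> lies in every competing \<open>F\<close> along
        with \<open>y\<close>, and its degree over \<open>L\<close> is smaller.\<close>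
      finally have "y ^ ?P \<in> L"
      proof (intro less.hyps)
        show "y ^ ?P \<in> F" if "hens F" "L \<subseteq> F" "z \<in> F" "F \<subseteq> H" for F
          using less.prems(2)[OF that] that(1) subfld.power unfolding hens_def by blast
      qed (use q(2) algP in auto)
      show ?thesis
      proof (rule ccontr)
        assume "y \<notin> L"
        then have "y \<notin> ?E0" using E0_alg less.prems(1) by blast
        obtain F where F: "hens F" "?E0 \<subseteq> F" "F \<subseteq> H" "y \<notin> F"
          using hens_avoiding_insep[OF H(1) E0(1) E0H \<open>y \<notin> ?E0\<close> _ P] \<open>y ^ ?P \<in> L\<close> E0(2) by blast
        then show False using less.prems(2)[OF F(1) _ _ F(3)] E0 by blast
      qed
    qed
  qed
qed

end

section \<open>Minimal polynomials of the partial sums, evaluated at the limit\<close>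

context tame_limit
begin

text \<open>A conjugate of \<open>s n\<close> is the sum of conjugates of the \<open>x j\<close>; by rigidity the first \<open>x j\<close> that moves
  does so by its own absolute value.\<close>

lemma s_conj_apart:
  assumes "conj K (s n) a" "a \<noteq> s n" shows "z - s n \<prec> a - s n"
proof -
  have xs_alg: "alg K y" if "y \<in> set (map x [0..<n])" for y using that x_alg by auto
  obtain E \<tau> where E: "hom_on E \<tau>" "K \<subseteq> E" "set (map x [0..<n]) \<subseteq> E" "s n \<in> E" "\<And>a. a \<in> K \<Longrightarrow> \<tau> a = a" "\<tau> (s n) = a"
    by (rule conj_hom_exists[OF K s_alg assms(1) xs_alg]) (assumption | rule that)+
  interpret hom_on E \<tau> by fact
  have xE: "x j \<in> E" if "j < n" for j using E(3) that by auto
  have a: "a = (\<Sum>j<n. \<tau> (x j))"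
    unfolding E(6)[symmetric] s_def by (rule hom_sum) (use xE in auto)
  have conj: "conj K (x j) (\<tau> (x j))" if "j < n" for j
    unfolding conj_def
  proof (intro ballI impI)
    fix g assume g: "g \<in> polys K" "poly g (x j) = 0"
    have "poly (map_poly id g) (\<tau> (x j)) = \<tau> (poly g (x j))"
      using hom_conj[OF E(2) _ xE[OF that] g(1), of id] E(5) by simp
    then show "poly g (\<tau> (x j)) = 0" using g(2) by simp
  qed
  have "\<exists>j<n. \<tau> (x j) \<noteq> x j"
    using assms(2) a unfolding s_def by (metis (mono_tags, lifting) lessThan_iff sum.cong)
  then obtain j where j: "j < n" "\<tau> (x j) \<noteq> x j" and least: "\<And>i. i < j \<Longrightarrow> \<not> (i < n \<and> \<tau> (x i) \<noteq> x i)"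
    using exists_least_iff[of "\<lambda>j. j < n \<and> \<tau> (x j) \<noteq> x j"] by blast
  have below: "\<tau> (x i) = x i" if "i < j" for i using least[OF that] that j(1) by auto
  have "x j \<preceq> \<tau> (x j) - x j"
  proof (rule ccontr)
    assume "\<not> ?thesis"
    then have "\<tau> (x j) - x j \<prec> x j" by (simp add: vlt_def)
    moreover obtain G where "G \<in> polys K" "poly G (x j) = 0"
      "\<And>x'. poly G x' = 0 \<Longrightarrow> x' - x j \<prec> x j \<Longrightarrow> x' = x j" using rigid_x[of j] unfolding rigid_def by blast
    ultimately show False using conj[OF j(1)] j(2) unfolding conj_def by blast
  qed
  moreover have "(\<Sum>i\<in>{Suc j..<n}. \<tau> (x i) - x i) \<prec> x j"
  proof -
    have "sum g A \<prec> x j" if "\<And>i. i \<in> A \<Longrightarrow> g i \<prec> x j" for g and A :: "nat set"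
      using that x_nonzero[of j] by (induction A rule: infinite_finite_induct) (auto intro: vlt_add)
    note sum_small = this
    show ?thesis
    proof (rule sum_small)
      fix i assume i: "i \<in> {Suc j..<n}"
      then have "\<tau> (x i) \<preceq> x i" using conj uniK x_alg unfolding uni_def by auto
      then have "\<tau> (x i) - x i \<preceq> x i" by (intro vle_diff) auto
      then show "\<tau> (x i) - x i \<prec> x j" using x_strict[of j i] i by (auto intro: vle_vlt_trans)
    qed
  qed
  then have "(\<Sum>i\<in>{Suc j..<n}. \<tau> (x i) - x i) \<prec> \<tau> (x j) - x j" using calculation by (rule vlt_vle_trans)
  from vle_add_dominant(1)[OF this] have "\<tau> (x j) - x j \<preceq> \<tau> (x j) - x j + (\<Sum>i\<in>{Suc j..<n}. \<tau> (x i) - x i)" .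
  moreover have "a - s n = \<tau> (x j) - x j + (\<Sum>i\<in>{Suc j..<n}. \<tau> (x i) - x i)"
  proof -
    have "i = j" if "\<not> Suc j \<le> i" "\<tau> (x i) \<noteq> x i" for i using that below[of i] by force
    note * = this
    have "a - s n = (\<Sum>i<n. \<tau> (x i) - x i)" by (simp add: a s_def sum_subtractf)
    also have "\<dots> = (\<Sum>i\<in>insert j {Suc j..<n}. \<tau> (x i) - x i)"
      using j(1) below by (intro sum.mono_neutral_right) (auto dest: *)
    finally show ?thesis by simp
  qed
  ultimately have "x j \<preceq> a - s n" using vle_trans by metis
  then show ?thesis using vle_vlt_trans[OF z_s(1) x_strict[OF j(1)]] vlt_vle_trans by blast
qed

text \<open>It suffices to recover \<open>s n\<close> from \<open>D = K(s n ^ p)\<close>. Adjoining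
  \<open>x 0, ..., x (n - 1)\<close> to \<open>D\<close> certainly gives \<open>s n\<close>; they
  are removed one by one from the top, each being separable, while the \<open>p\<close>-th power of
  \<open>s n\<close> stays in \<open>D\<close>.\<close>

lemma s_sep: "sep K (s n)"
proof (rule K.sepI_pth_power[OF s_alg])
  assume P: "CHAR('a) > 0"
  define D where "D = sext K (s n ^ CHAR('a))"
  have algP: "alg K (s n ^ CHAR('a))" using subfld.power[OF K.algs_subfld, of "s n"] s_alg by simp
  interpret D: subfld D unfolding D_def by (rule K.sext_subfld[OF algP])
  have "s n \<in> adjoin D (x ` {..<n - i})" for i
  proof (induction i)
    case 0
    interpret A: subfld "adjoin D (x ` {..<n})" by (rule subfld_adjoin)
    have "x j \<in> adjoin D (x ` {..<n})" if "j < n" for j using adjoin_incl[of D "x ` {..<n}"] that by auto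
    then show ?case unfolding s_def by (auto intro!: A.sum)
  next
    case (Suc i)
    show ?case
    proof (cases "i < n")
      case True
      define m where "m = n - Suc i"
      have m: "n - i = Suc m" using True by (simp add: m_def)
      let ?A = "adjoin D (x ` {..<m})"
      interpret A: subfld ?A by (rule subfld_adjoin)
      have DA: "D \<subseteq> ?A" "x ` {..<m} \<subseteq> ?A" using adjoin_incl[of D "x ` {..<m}"] by (metis le_sup_iff)+
      have KA: "K \<subseteq> ?A" using K.sext_incl DA(1) unfolding D_def by blast
      have sep: "sep ?A (x m)" by (rule sep_mono[OF KA rigid_sep[OF rigid_x]])
      have "adjoin D (x ` {..<Suc m}) \<subseteq> sext ?A (x m)"
        using DA A.sext_incl[of "x m"] A.sext_gen[of "x m"]
        by (intro adjoin_minimal A.sext_subfld[OF sep_alg[OF sep]]) (auto simp: lessThan_Suc)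
      then have "s n \<in> sext ?A (x m)" using Suc m by auto
      moreover have "s n ^ CHAR('a) \<in> ?A" using K.sext_gen DA(1) unfolding D_def by blast
      ultimately have "s n \<in> ?A" using sep_pth_root[OF A.subfld_axioms sep _ _ P] by blast
      then show ?thesis by (simp add: m_def)
    qed (use Suc in simp)
  qed
  from this[of n] have "s n \<in> adjoin D {}" by simp
  also have "adjoin D {} \<subseteq> D" by (rule adjoin_minimal[OF D.subfld_axioms]) auto
  finally show "s n \<in> sext K (s n ^ CHAR('a))" by (simp add: D_def)
qed

text \<open>Split off the simple root \<open>s n\<close> of \<open>f\<close>. The factor
  \<open>z - s n\<close> has the leading term of \<open>x n\<close>, every other factor
  \<open>z - a\<close> that of \<open>s n - a\<close>, and the product of the latter is
  \<open>f'(s n)\<close>.\<close>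

lemma minp_s_at_z:
  assumes f: "minp K (s n) f"
  shows "close (poly f z) (x n * poly (pderiv f) (s n))"
proof -
  note fD = minpD[OF f]
  obtain A where A: "size A = degree f" "f = (\<Prod>a\<in>#A. [:- a, 1:])" "set_mset A = {x. poly f x = 0}"
    by (rule alg_closed_split[OF fD(2)])
  obtain B where B: "A = add_mset (s n) B" using A(3) fD(3) by (metis mem_Collect_eq mset_add)
  define p where "p = (\<Prod>a\<in>#B. [:- a, 1:])"
  have fp: "f = [:- s n, 1:] * p" using A(2) unfolding B p_def by (simp only: image_mset_add_mset prod_mset.add_mset)
  have deriv: "poly (pderiv f) (s n) = poly p (s n)" unfolding fp pderiv_mult by (simp add: pderiv_pCons)
  have ns: "s n \<notin># B"
  proof
    assume "s n \<in># B"
    then have "poly p (s n) = 0" by (auto simp: p_def poly_prod_mset prod_mset_zero_iff)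
    then show False using s_sep K.sep_iff_minp[OF f] deriv by simp
  qed
  have "close (z - a) (s n - a)" if "a \<in># B" for a
  proof -
    have "conj K (s n) a" using that A(3) B K.minp_conj_iff[OF f] by auto
    moreover have "a \<noteq> s n" using ns that by blast
    ultimately show ?thesis using s_conj_apart vlt_uminus(2)[of "z - s n" "a - s n"] by (simp add: close_def)
  qed
  then have "close (poly p z) (poly p (s n))"
    unfolding p_def
  proof (induction B)
    case empty
    then show ?case by (simp add: close_def)
  next
    case (add a B)
    then have "close ((z - a) * poly (\<Prod>a\<in>#B. [:- a, 1:]) z) ((s n - a) * poly (\<Prod>a\<in>#B. [:- a, 1:]) (s n))"
      by (intro close_mult) auto
    moreover have "poly (\<Prod>a\<in>#add_mset a B. [:- a, 1:]) w = (w - a) * poly (\<Prod>a\<in>#B. [:- a, 1:]) w" for w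
      by (simp add: algebra_simps)
    ultimately show ?case by metis
  qed
  moreover have "close (z - s n) (x n)"
    using vle_vlt_trans[OF z_s(1)[of "Suc n"] x_decr] by (simp add: close_def s_Suc diff_diff_eq)
  ultimately have "close ((z - s n) * poly p z) (x n * poly p (s n))" by (intro close_mult)
  moreover have "poly f z = (z - s n) * poly p z" unfolding fp by (simp add: algebra_simps)
  ultimately show ?thesis unfolding deriv by simp
qed

end

section \<open>Leading terms\<close>

text \<open>\<open>R\<close> plays the role of the homogeneous elements of a graded field: sums are only required to stay
  in \<open>R\<close> when the exponents agree.\<close>

locale graded =
  fixes K R :: "('g::linordered_ab_group_add, 'k::field) hahn_series set"
  assumes K: "subfld K" and lt_K: "\<And>f. f \<in> K \<Longrightarrow> lt f \<in> K"
    and KR: "\<And>f. f \<in> K \<Longrightarrow> lt f \<in> R"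
    and mono: "\<And>r. r \<in> R \<Longrightarrow> lt r = r"
    and mult: "\<And>r r'. r \<in> R \<Longrightarrow> r' \<in> R \<Longrightarrow> r * r' \<in> R"
    and inv: "\<And>r. r \<in> R \<Longrightarrow> inverse r \<in> R"
    and add: "\<And>a b g. monomial a g \<in> R \<Longrightarrow> monomial b g \<in> R \<Longrightarrow> monomial (a + b) g \<in> R"
begin

sublocale K: subfld K by (rule K)

lemma zero_R: "0 \<in> R" and one_R: "1 \<in> R"
  using KR[OF K.zero] KR[OF K.one] by simp_all

text \<open>Take a representation with as few summands as possible: then the terms of smallest value do not
  cancel.\<close>

lemma lt_combination:
  fixes I :: "nat set"
  assumes "finite I" "\<And>i. i \<in> I \<Longrightarrow> \<kappa> i \<in> K" "\<And>i. i \<in> I \<Longrightarrow> r i \<in> R"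
  shows "lt (\<Sum>i\<in>I. \<kappa> i * r i) \<in> R"
  using assms
proof (induction "card I" arbitrary: I \<kappa> rule: less_induct)
  case less
  show ?case
  proof (cases "\<exists>i\<in>I. \<kappa> i * r i = 0")
    case True
    then obtain i where i: "i \<in> I" "\<kappa> i * r i = 0" by blast
    have "(\<Sum>i\<in>I. \<kappa> i * r i) = (\<Sum>i\<in>I - {i}. \<kappa> i * r i)"
      using i less.prems(1) by (simp add: sum.remove)
    moreover have "lt (\<Sum>i\<in>I - {i}. \<kappa> i * r i) \<in> R"
      using less.prems i(1) by (intro less.hyps psubset_card_mono) auto
    ultimately show ?thesis by simp
  next
    case nz: False
    show ?thesis
    proof (cases "I = {}")
      case True
      then show ?thesis using zero_R by simp
    next
      case False
      define v where "v i = hval (\<kappa> i * r i)" for i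
      define m where "m = Min (v ` I)"
      define S where "S = {i \<in> I. v i = m}"
      have m: "m \<le> v i" if "i \<in> I" for i using that less.prems(1) by (simp add: m_def)
      have "m \<in> v ` I" unfolding m_def using False less.prems(1) by (intro Min_in) auto
      then have "S \<noteq> {}" by (auto simp: S_def)
      have SI: "S \<subseteq> I" "finite S" using less.prems(1) by (auto simp: S_def)
      \<comment> \<open>The contributions of smallest value \<open>m\<close>, each replaced by its
        leading term; all are monomials with exponent \<open>m\<close>.\<close>
      define t where "t = (\<Sum>i\<in>S. lt (\<kappa> i) * r i)"
      have lti: "lt (\<kappa> i * r i) = lt (\<kappa> i) * r i" if "i \<in> I" for i
        using mono[OF less.prems(3)[OF that]] by (simp add: lt_mult)
      have "\<exists>a. lt (\<kappa> i) * r i = monomial a m" if "i \<in> S" for i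
        using lti[of i] that unfolding lt_def[of "\<kappa> i * r i"] S_def v_def by (metis (mono_tags, lifting) mem_Collect_eq)
      then obtain a where a: "\<And>i. i \<in> S \<Longrightarrow> lt (\<kappa> i) * r i = monomial (a i) m" by metis
      have t: "t = monomial (sum a S) m" unfolding t_def monomial_sum using a by (intro sum.cong) auto
      have aR: "monomial (a i) m \<in> R" if "i \<in> S" for i
        using a[OF that] mult[OF KR[OF less.prems(2)] less.prems(3), of i i] that SI by auto
      have "monomial (sum a T) m \<in> R" if "finite T" "T \<subseteq> S" for T
        using that
      proof (induction T)
        case empty
        then show ?case using zero_R by simp
      next
        case (insert i T)
        then show ?case using add[OF aR[of i], of "sum a T"] by simp
      qed
      then have tR: "t \<in> R" unfolding t using SI by blast
      show ?thesis
      proof (cases "t = 0")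
        case False
        have "lt (\<Sum>i\<in>I. \<kappa> i * r i) = lt t"
        proof (rule lt_eqI[OF False])
          assume "(\<Sum>i\<in>I. \<kappa> i * r i) \<noteq> t"
          have ht: "hval t = m" unfolding t using False t by (intro hval_monomial) auto
          have small: "hcoeff (\<kappa> i * r i - (if i \<in> S then lt (\<kappa> i) * r i else 0)) g = 0" if i: "i \<in> I" "g \<le> m" for i g
          proof (cases "i \<in> S")
            case True
            then have "lt (\<kappa> i) * r i = lt (\<kappa> i * r i)" "hval (\<kappa> i * r i) = m" using lti[OF i(1)] by (auto simp: S_def v_def)
            then show ?thesis using lt_diff[of "\<kappa> i * r i"] i(2) True hcoeff_below_hval[of g "\<kappa> i * r i - lt (\<kappa> i * r i)"]
              by (cases "\<kappa> i * r i = lt (\<kappa> i * r i)") (auto simp: hcoeff_simps)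
          next
            case False
            then have "g < hval (\<kappa> i * r i)" using m[OF i(1)] i by (auto simp: S_def v_def)
            then show ?thesis using False by (simp add: hcoeff_below_hval)
          qed
          have diff: "(\<Sum>i\<in>I. \<kappa> i * r i) - t = (\<Sum>i\<in>I. \<kappa> i * r i - (if i \<in> S then lt (\<kappa> i) * r i else 0))"
          proof -
            have "t = (\<Sum>i\<in>I. if i \<in> S then lt (\<kappa> i) * r i else 0)"
              unfolding t_def using SI less.prems(1) by (intro sum.mono_neutral_cong_left) auto
            then show ?thesis by (simp add: sum_subtractf)
          qed
          have hs: "hcoeff (sum h J) g = (\<Sum>i\<in>J. hcoeff (h i) g)" for h :: "nat \<Rightarrow> ('g, 'k) hahn_series" and J g
            by (induction J rule: infinite_finite_induct) (auto simp: hcoeff_simps)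
          have below: "hcoeff ((\<Sum>i\<in>I. \<kappa> i * r i) - t) g = 0" if "g \<le> m" for g
            unfolding diff hs using small[OF _ that] by simp
          have "hcoeff ((\<Sum>i\<in>I. \<kappa> i * r i) - t) (hval ((\<Sum>i\<in>I. \<kappa> i * r i) - t)) \<noteq> 0"
            using \<open>(\<Sum>i\<in>I. \<kappa> i * r i) \<noteq> t\<close> by (intro hval_props(1)) simp
          then show "hval t < hval ((\<Sum>i\<in>I. \<kappa> i * r i) - t)"
            unfolding ht using below leI by blast
        qed
        then show ?thesis using mono[OF tR] tR by simp
      next
        case True
        obtain i0 where i0: "i0 \<in> S" using \<open>S \<noteq> {}\<close> by blast
        then have i0I: "i0 \<in> I" and k0: "\<kappa> i0 \<noteq> 0" "\<kappa> i0 \<in> K" using SI nz less.prems(2) by auto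
        \<comment> \<open>If the leading terms cancel, \<open>t = 0\<close> is a linear relation
          among the \<open>r i\<close> over \<open>K\<close>, since each
          \<open>lt (\<kappa> i)\<close> lies in \<open>K\<close>. It expresses \<open>r i0\<close>
          through the others and saves one summand.\<close>
        define e where "e i = (if i \<in> S then lt (\<kappa> i) / lt (\<kappa> i0) else 0)" for i
        have eK: "e i \<in> K" if "i \<in> I" for i using lt_K less.prems(2) that k0(2) by (auto simp: e_def)
        have "lt (\<kappa> i0) * r i0 + (\<Sum>i\<in>S - {i0}. lt (\<kappa> i) * r i) = 0"
          using True i0 SI(2) by (simp add: t_def sum.remove)
        then have "r i0 = - (\<Sum>i\<in>S - {i0}. lt (\<kappa> i) * r i) / lt (\<kappa> i0)"
          using k0(1) by (simp add: field_simps eq_neg_iff_add_eq_0)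
        also have "\<dots> = - (\<Sum>i\<in>S - {i0}. e i * r i)"
          by (simp add: sum_divide_distrib e_def)
        also have "(\<Sum>i\<in>S - {i0}. e i * r i) = (\<Sum>i\<in>I - {i0}. e i * r i)"
          using SI less.prems(1) by (intro sum.mono_neutral_left) (auto simp: e_def)
        finally have r0: "r i0 = - (\<Sum>i\<in>I - {i0}. e i * r i)" .
        have "(\<Sum>i\<in>I. \<kappa> i * r i) = \<kappa> i0 * r i0 + (\<Sum>i\<in>I - {i0}. \<kappa> i * r i)"
          using i0I less.prems(1) by (simp add: sum.remove)
        also have "\<dots> = (\<Sum>i\<in>I - {i0}. (\<kappa> i - \<kappa> i0 * e i) * r i)"
          unfolding r0 by (simp add: sum_distrib_left sum_subtractf left_diff_distrib mult.assoc)
        finally have eq: "(\<Sum>i\<in>I. \<kappa> i * r i) = (\<Sum>i\<in>I - {i0}. (\<kappa> i - \<kappa> i0 * e i) * r i)" .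
        show ?thesis
          unfolding eq using less.prems i0I eK k0(2)
          by (intro less.hyps psubset_card_mono) auto
      qed
    qed
  qed
qed

text \<open>The ring generated by \<open>K\<close> and \<open>R\<close>: as \<open>R\<close> is
  closed under products, no longer products are needed.\<close>

definition span :: "('g, 'k) hahn_series set" where
  "span = {\<Sum>(\<kappa>, r)\<leftarrow>xs. \<kappa> * r |xs. set xs \<subseteq> K \<times> R}"

lemma lt_span: "f \<in> span \<Longrightarrow> lt f \<in> R"
proof -
  assume "f \<in> span"
  then obtain xs where xs: "f = (\<Sum>(\<kappa>, r)\<leftarrow>xs. \<kappa> * r)" "set xs \<subseteq> K \<times> R" by (auto simp: span_def)
  have "f = (\<Sum>i\<in>{0..<length xs}. fst (xs ! i) * snd (xs ! i))"
    by (simp add: xs(1) sum_list_sum_nth split_def)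
  also have "lt \<dots> \<in> R"
  proof (intro lt_combination)
    fix i assume "i \<in> {0..<length xs}"
    then have "xs ! i \<in> K \<times> R" using xs(2) by (meson atLeastLessThan_iff nth_mem subsetD)
    then show "fst (xs ! i) \<in> K" "snd (xs ! i) \<in> R" by (simp_all add: mem_Times_iff)
  qed simp
  finally show ?thesis .
qed

lemma span_add: "f \<in> span \<Longrightarrow> h \<in> span \<Longrightarrow> f + h \<in> span"
proof -
  assume "f \<in> span" "h \<in> span"
  then obtain xs ys where "f = (\<Sum>(\<kappa>, r)\<leftarrow>xs. \<kappa> * r)" "set xs \<subseteq> K \<times> R" "h = (\<Sum>(\<kappa>, r)\<leftarrow>ys. \<kappa> * r)" "set ys \<subseteq> K \<times> R"
    unfolding span_def by blast
  then show ?thesis unfolding span_def by (intro CollectI exI[of _ "xs @ ys"]) auto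
qed

lemma span_monomial_mult:
  assumes "\<kappa> \<in> K" "r \<in> R" "h \<in> span" shows "\<kappa> * r * h \<in> span"
proof -
  obtain ys where ys: "h = (\<Sum>(\<kappa>, r)\<leftarrow>ys. \<kappa> * r)" "set ys \<subseteq> K \<times> R" using assms(3) unfolding span_def by blast
  have "\<kappa> * r * h = (\<Sum>(\<kappa>', r')\<leftarrow>map (\<lambda>(\<kappa>', r'). (\<kappa> * \<kappa>', r * r')) ys. \<kappa>' * r')"
    unfolding ys(1) by (induction ys) (auto simp: algebra_simps)
  then show ?thesis unfolding span_def
    using ys(2) assms(1,2) mult by (intro CollectI exI[of _ "map (\<lambda>(\<kappa>', r'). (\<kappa> * \<kappa>', r * r')) ys"]) auto
qed

lemma span_mult: "f \<in> span \<Longrightarrow> h \<in> span \<Longrightarrow> f * h \<in> span"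
proof -
  assume "f \<in> span" and h: "h \<in> span"
  then obtain xs where xs: "f = (\<Sum>(\<kappa>, r)\<leftarrow>xs. \<kappa> * r)" "set xs \<subseteq> K \<times> R" unfolding span_def by blast
  have "(\<Sum>(\<kappa>, r)\<leftarrow>xs. \<kappa> * r) * h \<in> span" using xs(2)
  proof (induction xs)
    case Nil
    show ?case unfolding span_def by (intro CollectI exI[of _ "[]"]) simp
  next
    case (Cons p xs)
    then have "fst p * snd p * h + (\<Sum>(\<kappa>, r)\<leftarrow>xs. \<kappa> * r) * h \<in> span"
      using h by (intro span_add span_monomial_mult) auto
    then show ?case by (simp add: split_def distrib_right)
  qed
  then show ?thesis using xs(1) by simp
qed

lemma span_incl: "K \<subseteq> span" "R \<subseteq> span"
proof -
  have *: "\<kappa> * r \<in> span" if "\<kappa> \<in> K" "r \<in> R" for \<kappa> r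
    unfolding span_def using that by (intro CollectI exI[of _ "[(\<kappa>, r)]"]) auto
  show "K \<subseteq> span" using *[OF _ one_R] by auto
  show "R \<subseteq> span" using *[OF K.one] by auto
qed

text \<open>\<open>K(R)\<close> consists of quotients of elements of the ring \<open>span\<close>,
  and \<open>lt\<close> respects quotients.\<close>

lemma lt_adjoin:
  assumes "u \<in> adjoin K R" shows "lt u \<in> R"
proof -
  define E where "E = {f / h |f h. f \<in> span \<and> h \<in> span}"
  have sub: "f - h \<in> span" if "f \<in> span" "h \<in> span" for f h
  proof -
    have "- 1 * 1 * h \<in> span" using that(2) one_R by (intro span_monomial_mult) auto
    then show ?thesis using span_add[OF that(1), of "- h"] by simp
  qed
  have "subfld E"
  proof
    have one: "1 \<in> span" using span_incl(1) by auto
    then show "1 \<in> E" unfolding E_def by (intro CollectI exI[of _ 1]) auto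
    fix x y assume "x \<in> E" "y \<in> E"
    then obtain f h f' h' where *: "f \<in> span" "h \<in> span" "x = f / h" "f' \<in> span" "h' \<in> span" "y = f' / h'"
      unfolding E_def by blast
    have E: "a / b \<in> E" if "a \<in> span" "b \<in> span" for a b using that unfolding E_def by blast
    show "x * y \<in> E" using E[OF span_mult[OF *(1,4)] span_mult[OF *(2,5)]] *(3,6) by simp
    show "x - y \<in> E"
    proof (cases "h = 0 \<or> h' = 0")
      case True
      have "x - y = f / h \<or> x - y = (0 - f') / h'" using True *(3,6) by auto
      moreover have "0 \<in> span" using span_incl(1) by auto
      ultimately show ?thesis using E *(1,2,4,5) sub by metis
    next
      case False
      then have "x - y = (f * h' - f' * h) / (h * h')" using *(3,6) by (simp add: diff_frac_eq)
      then show ?thesis using E[OF sub[OF span_mult[OF *(1,5)] span_mult[OF *(4,2)]] span_mult[OF *(2,5)]] by simp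
    qed
  next
    show "inverse x \<in> E" if "x \<in> E" for x
      using that unfolding E_def by (force simp: inverse_divide)
  qed
  moreover have "span \<subseteq> E"
  proof
    fix f assume "f \<in> span"
    moreover have "1 \<in> span" using span_incl(1) by auto
    ultimately show "f \<in> E" unfolding E_def by (intro CollectI exI[of _ f] exI[of _ 1]) auto
  qed
  ultimately have "adjoin K R \<subseteq> E" using span_incl by (intro adjoin_minimal) auto
  then obtain f h where "f \<in> span" "h \<in> span" "u = f / h" using assms unfolding E_def by blast
  then show ?thesis
    using lt_span mult inv by (simp add: field_class.field_divide_inverse lt_mult lt_inverse)
qed

end

text \<open>Applied to fields such as \<open>K(z)\<close>. The point is addition: for equal
  exponents and coefficients that do not cancel, the leading term of \<open>f + h\<close> is the sum
  of the leading terms.\<close>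

lemma graded_lt_image:
  assumes K: "subfld K" "\<And>f. f \<in> K \<Longrightarrow> lt f \<in> K" and F: "subfld F" "K \<subseteq> F"
  shows "graded K (lt ` F)"
proof
  interpret F: subfld F by fact
  show "lt r = r" if "r \<in> lt ` F" for r using that by (metis imageE lt_def lt_monomial)
  show "r * r' \<in> lt ` F" if "r \<in> lt ` F" "r' \<in> lt ` F" for r r' using that by (auto simp flip: lt_mult)
  show "inverse r \<in> lt ` F" if "r \<in> lt ` F" for r using that by (auto simp flip: lt_inverse)
  fix a b :: 'b and g :: 'a
  assume "monomial a g \<in> lt ` F" "monomial b g \<in> lt ` F"
  then obtain f h where fh: "f \<in> F" "h \<in> F" "lt f = monomial a g" "lt h = monomial b g" by auto
  show "monomial (a + b) g \<in> lt ` F"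
  proof (cases "a = 0 \<or> b = 0 \<or> a + b = 0")
    case True
    then show ?thesis using fh by (auto intro: image_eqI[of _ lt 0] simp flip: fh(3,4))
  next
    case False
    have *: "hval f' = g \<and> (f' \<noteq> lt f' \<longrightarrow> g < hval (f' - lt f'))" if "lt f' = monomial c g" "c \<noteq> 0" for f' c
    proof -
      have "f' \<noteq> 0" using that by (metis lt_eq_0_iff monomial_eq_0_iff)
      then have "hval f' = g" using hval_lt[of f'] hval_monomial[OF that(2), of g] that(1) by simp
      then show ?thesis using lt_diff[of f'] by auto
    qed
    have c0: "hcoeff (f - lt f) g' = 0" "hcoeff (h - lt h) g' = 0" if "g' \<le> g" for g'
    proof -
      have **: "hcoeff (f' - lt f') g' = 0" if "lt f' = monomial c g" "c \<noteq> 0" for f' c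
        using *[OF that] \<open>g' \<le> g\<close> hcoeff_below_hval[of g' "f' - lt f'"] by (cases "f' = lt f'") (auto simp: hcoeff_simps)
      show "hcoeff (f - lt f) g' = 0" "hcoeff (h - lt h) g' = 0" using **[OF fh(3)] **[OF fh(4)] False by auto
    qed
    have "lt (f + h) = lt (monomial (a + b) g)"
    proof (rule lt_eqI)
      show "monomial (a + b) g \<noteq> 0" using False by simp
      assume "f + h \<noteq> monomial (a + b) g"
      then have ne: "f + h - monomial (a + b) g \<noteq> 0" by simp
      have "f + h - monomial (a + b) g = (f - lt f) + (h - lt h)"
        unfolding fh(3,4) by (simp add: algebra_simps flip: monomial_add)
      then have "hcoeff (f + h - monomial (a + b) g) g' = 0" if "g' \<le> g" for g'
        using c0[OF that] by (metis hcoeff_simps(3) add_0)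
      then show "hval (monomial (a + b) g) < hval (f + h - monomial (a + b) g)"
        using hval_props(1)[OF ne] hval_monomial[of "a + b" g] False by (metis not_less)
    qed
    then show ?thesis using fh(1,2) by (metis F.add image_eqI lt_monomial)
  qed
qed (use assms subfld.one[OF K(1)] subfld.diff[OF K(1)] subfld.mult[OF K(1)] subfld.inv[OF K(1)] in auto)

section \<open>Hensel's Lemma from Nagata polynomials\<close>

context valued
begin

text \<open>With \<open>c = P(a) / P'(a)\<close>, the polynomial \<open>P(a + c Y) / P(a)\<close> is \<open>1 + Y + \<dots>\<close> with
  small higher coefficients, and reversing it gives a polynomial to which \<open>hens\<close> applies.\<close>

lemma hens_hensel:
  assumes F: "hens F" and P: "P \<in> polys F" "P \<in> polys V" and a: "a \<in> F" "a \<in> V"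
    and root: "poly P a \<prec> 1" and simple: "\<not> poly (pderiv P) a \<prec> 1"
  shows "\<exists>b\<in>F. poly P b = 0 \<and> b - a \<prec> 1"
proof (cases "poly P a = 0")
  case True
  then show ?thesis using a(1) by auto
next
  case False
  interpret F: subfld F using F unfolding hens_def by blast
  define c0 c1 where "c0 = poly P a" and "c1 = poly (pderiv P) a"
  have c0: "c0 \<noteq> 0" "c0 \<prec> 1" "c0 \<in> F" and c1: "1 \<preceq> c1" "c1 \<in> F"
    using False root simple P(1) a(1) by (auto simp: c0_def c1_def intro!: F.poly_closed F.polys_pderiv)
  have c1nz: "c1 \<noteq> 0" using c1(1) by auto
  have inv: "inverse c1 \<in> V" using vle_inverse[OF c1(1)] by (simp add: V_iff)
  define c where "c = c0 / c1"
  have cc: "c * c1 = c0" "c \<noteq> 0" "c \<in> F" using c0 c1 c1nz by (auto simp: c_def intro: F.divide)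
  have csmall: "c \<prec> 1" using small_mult(1)[OF c0(2) inv] by (simp add: c_def field_class.field_divide_inverse)
  define T where "T = pcompose P [:a, 1:]"
  have T: "T \<in> polys V" "T \<in> polys F"
  proof -
    show "T \<in> polys F" unfolding T_def using P(1) a(1) by (auto intro!: F.polys_pcompose F.polys_pCons)
    have "pcompose p [:a, 1:] \<in> polys V" if "p \<in> polys V" for p
      using that
    proof (induction p)
      case (pCons d p)
      have "d \<in> V" "p \<in> polys V"
        using polysD[OF pCons.prems, of 0] polysD[OF pCons.prems, of "Suc _"] by (auto intro: polysI)
      moreover have "0 \<in> polys V" by (auto intro: polysI)
      ultimately have "[:a, 1:] \<in> polys V" "[:d:] \<in> polys V"
        using a(2) by (auto intro!: polys_V_pCons)
      then show ?case using pCons.IH[OF \<open>p \<in> polys V\<close>]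
        unfolding pcompose_pCons by (intro polys_V_add polys_V_mult)
    qed (auto intro: polysI)
    then show "T \<in> polys V" unfolding T_def using P(2) by blast
  qed
  have T0: "coeff T 0 = c0" unfolding T_def c0_def by (simp flip: poly_0_coeff_0 add: poly_pcompose)
  have T1: "coeff T 1 = c1"
  proof -
    have "coeff T 1 = poly (pderiv T) 0" by (simp add: poly_0_coeff_0 coeff_pderiv)
    then show ?thesis by (simp add: T_def pderiv_pcompose poly_pcompose pderiv_pCons c1_def)
  qed
  define Q where "Q = Polynomial.smult (1 / c0) (pcompose T [:0, c:])"
  have Qi: "coeff Q i = coeff T i * c ^ i / c0" for i by (simp add: Q_def coeff_pcompose_linear)
  have Q0: "coeff Q 0 = 1" and Q1: "coeff Q 1 = 1"
    unfolding Qi T0 T1 using c0(1) cc(1) by (simp_all add: mult.commute[of c1])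
  \<comment> \<open>From \<open>c0 = c * c1\<close> the coefficient is
    \<open>c * T_i * c^(i-2) / c1\<close>, with one factor \<open>c\<close> left over to make it
    small.\<close>
  have Qsmall: "coeff Q i \<prec> 1" if "2 \<le> i" for i
  proof -
    obtain j where j: "i = Suc (Suc j)" using le_Suc_ex[OF \<open>2 \<le> i\<close>] by auto
    have "coeff Q i = c * (coeff T i * c ^ j * inverse c1)"
      using cc(2) c1nz by (simp add: Qi j divide_simps flip: cc(1))
    then show ?thesis using small_mult(1)[OF csmall] T(1) small_V[OF csmall] inv
      by (auto intro!: V_mult V_power dest: polysD)
  qed
  define n where "n = degree Q - 1"
  have "degree Q \<noteq> 0" using Q1 by (metis One_nat_def coeff_eq_0 less_one zero_neq_one neq0_conv)
  then have n: "degree Q = Suc n" by (simp add: n_def)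
  have QF: "reflect_poly Q \<in> polys F"
    using T(2) c0(3) cc(3) unfolding polys_def by (auto simp: coeff_reflect_poly Qi intro!: F.divide F.mult F.power F.zero)
  have nag: "nagata (reflect_poly Q)"
    unfolding nagata_def
  proof (intro exI conjI allI)
    let ?M = "Polynomial.monom 1 n * [:1, 1:] :: 'a poly"
    show "reflect_poly Q = ?M + (reflect_poly Q - ?M)" by simp
    have M: "coeff ?M i = (if i = n \<or> i = Suc n then 1 else 0)" for i
      by (auto simp: coeff_monom_mult coeff_pCons not_le split: nat.splits)
    have R: "coeff (reflect_poly Q - ?M) i = (if i < n then coeff Q (Suc n - i) else 0)" for i
    proof -
      consider "i < n" | "i = n" | "i = Suc n" | "i > Suc n" by linarith
      then show ?thesis unfolding coeff_diff M coeff_reflect_poly n using Q0 Q1 by cases simp_all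
    qed
    show "coeff (reflect_poly Q - ?M) i \<prec> 1" for i unfolding R using Qsmall[of "Suc n - i"] by auto
    show "degree (reflect_poly Q - ?M) < Suc n"
      unfolding less_Suc_eq_le by (rule degree_le) (unfold R, simp)
  qed
  obtain y where y: "y \<in> F" "poly (reflect_poly Q) y = 0" "\<not> y \<prec> 1"
    using F QF nag unfolding hens_def by blast
  have y0: "y \<noteq> 0" "inverse y \<in> V" using y(3) vle_inverse[of 1 y] by (auto simp: V_iff)
  then have "poly Q (inverse y) = 0" using y(2) by (simp add: poly_reflect_poly_nz)
  then have "poly P (a + c * inverse y) = 0" using c0(1) by (simp add: Q_def T_def poly_pcompose mult.commute)
  moreover have "a + c * inverse y \<in> F" using a(1) cc(3) y(1) by (intro F.add F.mult F.inv)
  moreover have "a + c * inverse y - a \<prec> 1" using small_mult(1)[OF csmall y0(2)] by simp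
  ultimately show ?thesis by blast
qed

end

lemma map_poly_to_ac:
  "poly (map_poly to_ac p) (to_ac x) = to_ac (poly p x)"
  "pderiv (map_poly to_ac p) = map_poly to_ac (pderiv p)"
proof -
  show "poly (map_poly to_ac p) (to_ac x) = to_ac (poly p x)"
    by (induction p) (simp_all add: map_poly_pCons)
  show "pderiv (map_poly to_ac p) = map_poly to_ac (pderiv p)"
    by (rule poly_eqI) (simp add: coeff_pderiv coeff_map_poly del: of_nat_Suc flip: to_ac_of_nat)
qed

context hahn_val
begin

lemma small_to_ac: "to_ac f \<prec> 1 \<longleftrightarrow> f \<in> hval_ideal"
  using vlt_to_ac[of f 1] by (auto simp: hval_ideal_def)

lemma polys_to_ac:
  assumes "0 \<in> F" "P \<in> polys (to_ac ` F)" obtains p where "P = map_poly to_ac p" "p \<in> polys F"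
proof -
  have "\<forall>i. \<exists>u\<in>F. coeff P i = to_ac u" using polysD[OF assms(2)] by blast
  then obtain u where u: "\<And>i. u i \<in> F" "\<And>i. coeff P i = to_ac (u i)" by metis
  define p where "p = Poly (map u [0..<Suc (degree P)])"
  have "coeff p i = (if i \<le> degree P then u i else 0)" for i
    by (auto simp: p_def nth_default_def simp del: upt_Suc)
  then have "P = map_poly to_ac p" "p \<in> polys F"
    using u assms(1) by (auto intro!: poly_eqI polysI simp: coeff_map_poly u(2)[symmetric] not_le coeff_eq_0)
  then show thesis using that by blast
qed

text \<open>For a Nagata polynomial -1 is an approximate simple root, being congruent to a unit root
  in the closure, so Hensel's Lemma applies; the converse is \<open>hens_hensel\<close>.\<close>

lemma henselian_iff:
  fixes F :: "('g, 'k) hahn_series set"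
  assumes F: "subfld F" shows "henselian F \<longleftrightarrow> hens (to_ac ` F)"
proof
  interpret F: subfld F by fact
  assume H: "henselian F"
  show "hens (to_ac ` F)"
    unfolding hens_def
  proof (intro conjI ballI impI to_ac_subfld F)
    fix P assume P: "P \<in> polys (to_ac ` F)" "nagata P"
    obtain p where p: "P = map_poly to_ac p" "p \<in> polys F" by (rule polys_to_ac[OF F.zero P(1)])
    note np = nagata_props[OF P(2)]
    obtain b where b: "poly P b = 0" "\<not> b \<prec> 1" by (rule nagata_unit_root_exists[OF P(2)])
    have bV: "b \<in> V" and b1: "- 1 - b \<prec> 1" and m1: "- 1 \<in> V"
      using np(4)[OF b(1)] vlt_minus_commute[of "- 1" b 1] np(5)[OF b] V_uminus by auto
    have "poly P (to_ac (- 1)) \<prec> 1" using poly_V_cong[OF np(1) m1 bV b1] b(1) by simp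
    then have 1: "poly p (- 1) \<in> hval_ideal" unfolding p(1) map_poly_to_ac small_to_ac .
    have "\<not> poly (pderiv P) (to_ac (- 1)) \<prec> 1"
      using unit_cong[OF poly_V_cong[OF polys_V_pderiv[OF np(1)] m1 bV b1]] np(6)[OF b] by simp
    then have 2: "poly (pderiv p) (- 1) \<notin> hval_ideal" unfolding p(1) map_poly_to_ac small_to_ac .
    have "coeff p i \<in> F \<inter> hval_ring" for i
      using polysD[OF p(2)] polysD[OF np(1), of i] by (auto simp: p(1) coeff_map_poly V_hahn)
    moreover have "- 1 \<in> F \<inter> hval_ring" using V_hahn[of "- 1"] m1 F.uminus[OF F.one] by simp
    ultimately obtain \<beta> where \<beta>: "\<beta> \<in> F" "poly p \<beta> = 0" "\<beta> - (- 1) \<in> hval_ideal"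
      using H 1 2 unfolding henselian_def by blast
    have "to_ac \<beta> - (- 1) \<prec> 1" using \<beta>(3) small_to_ac[of "\<beta> - (- 1)"] by simp
    then have "\<not> to_ac \<beta> \<prec> 1" using unit_cong[of "to_ac \<beta>" "- 1"] by simp
    moreover have "poly P (to_ac \<beta>) = 0" unfolding p(1) map_poly_to_ac \<beta>(2) by simp
    ultimately show "\<exists>b\<in>to_ac ` F. poly P b = 0 \<and> \<not> b \<prec> 1" using \<beta>(1) by blast
  qed
next
  interpret F: subfld F by fact
  assume H: "hens (to_ac ` F)"
  show "henselian F"
    unfolding henselian_def
  proof (intro allI impI)
    fix p a
    assume p: "\<forall>i. coeff p i \<in> F \<inter> hval_ring" and a: "a \<in> F \<inter> hval_ring"
      and root: "poly p a \<in> hval_ideal" and simple: "poly (pderiv p) a \<notin> hval_ideal"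
    have "\<exists>b\<in>to_ac ` F. poly (map_poly to_ac p) b = 0 \<and> b - to_ac a \<prec> 1"
    proof (rule hens_hensel[OF H])
      show "map_poly to_ac p \<in> polys (to_ac ` F)" "map_poly to_ac p \<in> polys V"
        using p by (auto intro!: polysI simp: coeff_map_poly V_hahn)
      show "to_ac a \<in> to_ac ` F" "to_ac a \<in> V" using a by (auto simp: V_hahn)
    qed (use root simple in \<open>simp_all only: map_poly_to_ac small_to_ac not_False_eq_True\<close>)
    then obtain b where b: "b \<in> F" "poly (map_poly to_ac p) (to_ac b) = 0" "to_ac b - to_ac a \<prec> 1" by blast
    have "to_ac (poly p b) = 0" using b(2) unfolding map_poly_to_ac .
    then have "poly p b = 0" by simp
    moreover have ba: "b - a \<in> hval_ideal" using b(3) small_to_ac[of "b - a"] by simp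
    moreover have "b \<in> hval_ring"
      using ba a V_add[OF small_V[OF b(3)], of "to_ac a"] by (simp add: V_hahn)
    ultimately show "\<exists>b\<in>F \<inter> hval_ring. poly p b = 0 \<and> b - a \<in> hval_ideal" using b(1) by blast
  qed
qed

end

lemma rsquarefree_simple_root:
  assumes "rsquarefree p" "poly p a = 0" shows "poly (pderiv p) a \<noteq> 0"
proof -
  have p: "p \<noteq> 0" "order a p = 0 \<or> order a p = 1" using assms(1) by (auto simp: rsquarefree_def)
  then have "order a p = 1" using assms(2) order_root by blast
  then obtain q where q: "p = [:- a, 1:] * q" "\<not> [:- a, 1:] dvd q" using order_decomp[OF p(1), of a] by auto
  have "poly (pderiv p) a = poly q a" unfolding q(1) pderiv_mult by (simp add: pderiv_pCons)
  then show ?thesis using q(2) by (simp add: poly_eq_0_iff_dvd)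
qed

lemma of_nat_hahn: "of_nat n = monomial (of_nat n) 0"
  by (induction n) (simp_all flip: monomial_add monomial_one)

section \<open>Rigidity of the terms of a tame series\<close>

locale tame_series = hahn_val V
  for V :: "('g::linordered_ab_group_add, 'k::field) hahn_series alg_closure set" +
  fixes K :: "('g, 'k) hahn_series set" and z :: "('g, 'k) hahn_series"
    and c :: "nat \<Rightarrow> 'k" and \<gamma> :: "nat \<Rightarrow> 'g"
  assumes K: "subfld K" and hensel_K: "henselian K"
    and monomial_K: "\<And>d g. d \<in> residue_field K \<Longrightarrow> g \<in> value_group K \<Longrightarrow> monomial d g \<in> K"
    and \<gamma>: "strict_mono \<gamma>" and c: "\<And>i. c i \<noteq> 0"
    and z: "\<And>g. hcoeff z g = (\<Sum>i | \<gamma> i = g. c i)"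
    and sep_c: "\<And>i. separable_algebraic (residue_field K) (c i)"
    and tame: "\<And>i. \<exists>e::nat. e > 0 \<and> (CHAR('k) = 0 \<or> coprime e CHAR('k)) \<and> (\<Sum>j<e. \<gamma> i) \<in> value_group K"
begin

sublocale K: subfld K by (rule K)

abbreviation "B \<equiv> residue_field K"
abbreviation "vK \<equiv> value_group K"

lemma vK_0: "0 \<in> vK"
  unfolding value_group_def by (rule image_eqI[of _ _ 1]) auto

lemma B_iff: "d \<in> B \<longleftrightarrow> monomial d 0 \<in> K"
proof
  show "monomial d 0 \<in> K" if "d \<in> B" using monomial_K[OF that vK_0] .
  assume "monomial d 0 \<in> K"
  moreover have "monomial d (0::'g) \<in> hval_ring"
    using hval_monomial[of d "0::'g"] by (cases "d = 0") (simp_all add: hval_ring_def)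
  moreover have "hcoeff (monomial d (0::'g)) 0 = d" by (simp add: monomial.rep_eq)
  ultimately show "d \<in> B" unfolding residue_field_def by force
qed

lemma B: "subfld B"
proof
  show "1 \<in> B" unfolding B_iff by (simp add: monomial_one)
  fix x y assume *: "x \<in> B" "y \<in> B"
  then show "x - y \<in> B" unfolding B_iff by (metis K.diff monomial_diff)
  show "x * y \<in> B" using * K.mult[of "monomial x 0" "monomial y 0"] unfolding B_iff by (simp add: monomial_mult)
next
  show "inverse x \<in> B" if "x \<in> B" for x
    using K.inv[of "monomial x 0"] that unfolding B_iff by (simp add: monomial_inverse)
qed

sublocale B: subfld B by (rule B)

lemma vK_iff: "g \<in> vK \<longleftrightarrow> monomial 1 g \<in> K"
proof
  show "monomial 1 g \<in> K" if "g \<in> vK" using monomial_K[OF B.one that] .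
  show "g \<in> vK" if "monomial 1 g \<in> K"
    unfolding value_group_def by (rule image_eqI[of _ _ "monomial 1 g"]) (use that in \<open>simp_all add: hval_monomial\<close>)
qed

lemma vK_add: "g \<in> vK \<Longrightarrow> h \<in> vK \<Longrightarrow> g + h \<in> vK"
  using K.mult[of "monomial 1 g" "monomial 1 h"] by (simp add: vK_iff monomial_mult)

lemma vK_uminus: "g \<in> vK \<Longrightarrow> - g \<in> vK"
  using K.inv[of "monomial 1 g"] by (simp add: vK_iff monomial_inverse)

text \<open>Multiplication by \<open>t\<close> to the power \<open>- hval f\<close> moves the
  leading coefficient to exponent 0.\<close>

lemma hcoeff_hval_residue:
  assumes F: "subfld F" and f: "f \<in> F" "f \<noteq> 0" and g: "monomial 1 (hval f) \<in> F"
  shows "hcoeff f (hval f) \<in> residue_field F"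
proof -
  interpret F: subfld F by fact
  let ?h = "monomial 1 (- hval f) * f"
  have "monomial 1 (- hval f) \<in> F" using F.inv[OF g] by (simp add: monomial_inverse)
  then have "?h \<in> F" using f(1) by simp
  moreover have "?h \<in> hval_ring" using f(2) by (simp add: hval_ring_def hval_times hval_monomial)
  moreover have "hcoeff f (hval f) = hcoeff ?h 0" by (simp add: hcoeff_monomial_times)
  ultimately show ?thesis unfolding residue_field_def by blast
qed

lemma lt_K: "f \<in> K \<Longrightarrow> lt f \<in> K"
proof (cases "f = 0")
  case False
  assume f: "f \<in> K"
  then have g: "hval f \<in> vK" using False unfolding value_group_def by blast
  then have "hcoeff f (hval f) \<in> B" using hcoeff_hval_residue[OF K f False] vK_iff by blast
  then show ?thesis unfolding lt_def using monomial_K g by blast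
qed simp

lemma sum_const_neq_0: "(e::nat) > 0 \<Longrightarrow> g \<noteq> 0 \<Longrightarrow> (\<Sum>j<e. g) \<noteq> (0::'g)"
proof -
  assume e: "e > 0" "g \<noteq> 0"
  consider "g > 0" | "- g > 0" using e(2) by force
  then show ?thesis
  proof cases
    case 1
    then have "0 < (\<Sum>j<e. g)" using e(1) by (intro sum_pos) auto
    then show ?thesis by simp
  next
    case 2
    then have "0 < (\<Sum>j<e. - g)" using e(1) by (intro sum_pos) auto
    then show ?thesis by (simp add: sum_negf)
  qed
qed

text \<open>The passage from \<open>hens\<close> to \<open>uni\<close> needs a nonzero small
  element. A strictly increasing sequence has a nonzero \<open>\<gamma> i\<close>, a positive
  multiple of it lies in \<open>vK\<close>, and up to sign this is a positive value.\<close>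

lemma uni_above:
  assumes F: "subfld F" "henselian F" "K \<subseteq> F" shows "uni (to_ac ` F)"
proof -
  interpret F: subfld F by fact
  have "\<gamma> 0 \<noteq> 0 \<or> \<gamma> 1 \<noteq> 0" using \<gamma> by (metis strict_mono_eq zero_neq_one)
  then obtain i where i: "\<gamma> i \<noteq> 0" by blast
  obtain e :: nat where e: "e > 0" "(\<Sum>j<e. \<gamma> i) \<in> vK" using tame[of i] by blast
  define g where "g = (\<Sum>j<e. \<gamma> i)"
  have g: "g \<in> vK" "g \<noteq> 0" using e sum_const_neq_0[OF e(1) i] by (simp_all add: g_def)
  obtain h where h: "h \<in> vK" "0 < h"
    using g vK_uminus[OF g(1)] by (cases "g > 0") auto
  have "to_ac (monomial 1 h) \<in> to_ac ` F" "to_ac (monomial (1::'k) h) \<noteq> 0" "to_ac (monomial 1 h) \<prec> 1"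
    using h F(3) vK_iff[of h] hval_monomial[of "1::'k" h] by (auto simp: small_to_ac hval_ideal_def)
  then show ?thesis using F henselian_iff[OF F(1)] by (intro hens_imp_uni) auto
qed

text \<open>The constants as a copy of \<open>k\<close> inside the valuation ring. Nonzero constants
  are units, so a nonvanishing derivative over \<open>k\<close> is automatically not small.\<close>

definition \<phi> :: "'k \<Rightarrow> ('g, 'k) hahn_series alg_closure" where
  "\<phi> b = to_ac (monomial b 0)"

lemma \<phi>_hom: "\<phi> 0 = 0" "\<phi> 1 = 1" "\<phi> (a + b) = \<phi> a + \<phi> b" "\<phi> (a * b) = \<phi> a * \<phi> b" "\<phi> (a - b) = \<phi> a - \<phi> b"
  "\<phi> (inverse a) = inverse (\<phi> a)" "\<phi> a = \<phi> b \<longleftrightarrow> a = b" "\<phi> a = 0 \<longleftrightarrow> a = 0" "\<phi> (of_nat n) = of_nat n"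
  "\<phi> (a ^ n) = \<phi> a ^ n"
proof -
  show *: "\<phi> 0 = 0" "\<phi> 1 = 1" "\<phi> (a + b) = \<phi> a + \<phi> b" "\<phi> (a * b) = \<phi> a * \<phi> b" "\<phi> (a - b) = \<phi> a - \<phi> b"
    "\<phi> a = 0 \<longleftrightarrow> a = 0" for a b
    by (simp_all add: \<phi>_def monomial_one monomial_mult flip: to_ac_add to_ac_mult to_ac_diff monomial_add monomial_diff)
  show "\<phi> (inverse a) = inverse (\<phi> a)" by (simp add: \<phi>_def monomial_inverse flip: to_ac_inverse)
  show "\<phi> a = \<phi> b \<longleftrightarrow> a = b" using *(5)[of a b] *(6)[of "a - b"] by auto
  show "\<phi> (of_nat n) = of_nat n" by (simp add: \<phi>_def flip: of_nat_hahn)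
  show "\<phi> (a ^ n) = \<phi> a ^ n" by (induction n) (simp_all add: *)
qed

lemma \<phi>_unit: "a \<noteq> 0 \<Longrightarrow> \<not> \<phi> a \<prec> 1" and \<phi>_V: "\<phi> a \<in> V"
proof -
  show "a \<noteq> 0 \<Longrightarrow> \<not> \<phi> a \<prec> 1"
    using hval_monomial[of a "0::'g"] unfolding \<phi>_def small_to_ac by (simp add: hval_ideal_def)
  show "\<phi> a \<in> V"
    using hval_monomial[of a "0::'g"] unfolding \<phi>_def V_hahn by (cases "a = 0") (simp_all add: hval_ring_def)
qed

lemma \<phi>_subfld: "subfld F \<Longrightarrow> subfld (\<phi> ` F)"
proof -
  assume "subfld F"
  then interpret subfld F .
  show ?thesis by unfold_locales (auto simp flip: \<phi>_hom(2,4,5,6))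
qed

lemma \<phi>_poly: "poly (map_poly \<phi> p) (\<phi> a) = \<phi> (poly p a)"
  by (induction p) (simp_all add: map_poly_pCons \<phi>_hom)

lemma \<phi>_pderiv: "pderiv (map_poly \<phi> p) = map_poly \<phi> (pderiv p)"
  by (rule poly_eqI) (simp add: coeff_pderiv coeff_map_poly \<phi>_hom del: of_nat_Suc flip: \<phi>_hom(9))

lemma \<phi>_B: "\<phi> ` B \<subseteq> to_ac ` K"
  unfolding \<phi>_def using B_iff by blast

text \<open>Rigidity uses \<open>x^e = c^e * t^(e * \<gamma>)\<close>, so powers of \<open>c\<close>
  must be separable too. Let \<open>D\<close> be generated over the constants of \<open>K\<close> by
  the \<open>p\<close>-th power of \<open>c^n\<close>; as \<open>c\<close> is separable over
  \<open>D\<close>, the element \<open>c^n\<close> of \<open>D(c)\<close> already lies in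
  \<open>D\<close>.\<close>

lemma sep_c_power: "sep (\<phi> ` B) (\<phi> (c i) ^ n)"
proof -
  interpret \<phi>B: subfld "\<phi> ` B" by (rule \<phi>_subfld[OF B])
  obtain p where p: "lead_coeff p = 1" "\<forall>i. coeff p i \<in> B" "poly p (c i) = 0" "rsquarefree (map_poly to_ac p)"
    using sep_c[of i] unfolding separable_algebraic_def by blast
  have "poly (map_poly to_ac p) (to_ac (c i)) = 0" using p(3) by (simp add: map_poly_to_ac)
  then have "poly (pderiv p) (c i) \<noteq> 0"
    using rsquarefree_simple_root[OF p(4), of "to_ac (c i)"] by (simp add: map_poly_to_ac)
  then have "poly (pderiv (map_poly \<phi> p)) (\<phi> (c i)) \<noteq> 0" by (simp add: \<phi>_pderiv \<phi>_poly \<phi>_hom)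
  moreover have "map_poly \<phi> p \<in> polys (\<phi> ` B)" using p(2) by (auto intro!: polysI simp: coeff_map_poly \<phi>_hom)
  moreover have "poly (map_poly \<phi> p) (\<phi> (c i)) = 0" using p(3) by (simp add: \<phi>_poly \<phi>_hom)
  ultimately have s: "sep (\<phi> ` B) (\<phi> (c i))" unfolding sep_def by blast
  let ?d = "\<phi> (c i) ^ n" let ?P = "CHAR(('g, 'k) hahn_series alg_closure)"
  have alg: "alg (\<phi> ` B) ?d" using subfld.power[OF \<phi>B.algs_subfld] sep_alg[OF s] by simp
  show ?thesis
  proof (rule \<phi>B.sepI_pth_power[OF alg])
    assume P: "?P > 0"
    let ?D = "sext (\<phi> ` B) (?d ^ ?P)"
    have "alg (\<phi> ` B) (?d ^ ?P)" using subfld.power[OF \<phi>B.algs_subfld] alg by simp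
    then interpret D: subfld ?D by (rule \<phi>B.sext_subfld)
    have sD: "sep ?D (\<phi> (c i))" by (rule sep_mono[OF \<phi>B.sext_incl s])
    interpret Dc: subfld "sext ?D (\<phi> (c i))" by (rule D.sext_subfld[OF sep_alg[OF sD]])
    show "?d \<in> ?D"
      by (rule sep_pth_root[OF D.subfld_axioms sD Dc.power[OF D.sext_gen] \<phi>B.sext_gen P])
  qed
qed

abbreviation "xs i \<equiv> monomial (c i) (\<gamma> i)"

text \<open>The polynomial is \<open>G = q(X^e / \<kappa>)\<close> with
  \<open>\<kappa> = t^(e * \<gamma>)\<close> in \<open>K\<close> and \<open>q\<close> having the
  simple root \<open>d = c^e\<close>. A root \<open>u * w\<close> of \<open>G\<close> with
  \<open>u\<close> close to 1 makes \<open>u^e * d\<close> a root of \<open>q\<close> close to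
  \<open>d\<close>, hence equal to \<open>d\<close>; then \<open>u\<close> is a root of
  \<open>Y^e - 1\<close> close to 1, and \<open>e\<close> is a unit.\<close>

lemma rigid_xs: "rigid (to_ac ` K) (to_ac (xs i))"
proof -
  interpret K': subfld "to_ac ` K" by (rule to_ac_subfld[OF K])
  interpret \<phi>k: subfld "range \<phi>" by (rule \<phi>_subfld) (unfold_locales, auto)
  obtain e :: nat where e: "e > 0" "CHAR('k) = 0 \<or> coprime e CHAR('k)" "(\<Sum>j<e. \<gamma> i) \<in> vK" using tame[of i] by blast
  have "of_nat e \<noteq> (0::'k)"
    unfolding of_nat_eq_0_iff_char_dvd
  proof
    assume dvd: "CHAR('k) dvd e"
    from e(2) show False
    proof
      assume "CHAR('k) = 0"
      then show False using dvd e(1) by simp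
    next
      assume "coprime e CHAR('k)"
      then show False using coprime_common_divisor[OF _ dvd dvd_refl] CHAR_not_1'[where 'a = 'k] by simp
    qed
  qed
  then have e_unit: "\<not> of_nat e \<prec> (1 :: ('g, 'k) hahn_series alg_closure)" using \<phi>_unit[of "of_nat e"] by (simp only: \<phi>_hom not_False_eq_True)
  then have e0: "of_nat e \<noteq> (0 :: ('g, 'k) hahn_series alg_closure)" by auto
  define w where "w = to_ac (xs i)"
  define d where "d = \<phi> (c i) ^ e"
  define \<kappa> where "\<kappa> = to_ac (monomial (1::'k) (\<Sum>j<e. \<gamma> i))"
  have w0: "w \<noteq> 0" and \<kappa>: "\<kappa> \<in> to_ac ` K" "\<kappa> \<noteq> 0" using c e(3) vK_iff by (auto simp: w_def \<kappa>_def)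
  have we: "w ^ e = d * \<kappa>"
    unfolding w_def \<kappa>_def d_def \<phi>_hom(10)[symmetric] \<phi>_def
    by (simp add: monomial_power monomial_mult flip: to_ac_power to_ac_mult)
  have dV: "d \<in> V" unfolding d_def by (intro V_power \<phi>_V)
  obtain q where q: "q \<in> polys (\<phi> ` B)" "poly q d = 0" "poly (pderiv q) d \<noteq> 0"
    using sep_c_power[of i e] unfolding sep_def d_def by blast
  have qV: "q \<in> polys V" using q(1) \<phi>_V polys_mono[of "\<phi> ` B" V] by blast
  have q_simple: "\<not> poly (pderiv q) d \<prec> 1"
  proof -
    have "q \<in> polys (range \<phi>)" using q(1) polys_mono[of "\<phi> ` B" "range \<phi>"] by blast
    then have "poly (pderiv q) d \<in> range \<phi>" unfolding d_def by (intro \<phi>k.poly_closed \<phi>k.polys_pderiv \<phi>k.power) auto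
    then obtain a where "poly (pderiv q) d = \<phi> a" by auto
    then show ?thesis using q(3) \<phi>_unit[of a] \<phi>_hom(1) by metis
  qed
  define S where "S = Polynomial.smult (inverse \<kappa>) (Polynomial.monom 1 e)"
  have S: "poly S y = y ^ e / \<kappa>" "poly (pderiv S) y = of_nat e * y ^ (e - 1) / \<kappa>" for y
    by (simp_all add: S_def poly_monom pderiv_smult pderiv_monom field_simps)
  have Sw: "poly S w = d" using \<kappa>(2) by (simp add: S we)
  define G where "G = pcompose q S"
  have "q \<in> polys (to_ac ` K)" using q(1) polys_mono[OF \<phi>_B] by blast
  then have "G \<in> polys (to_ac ` K)" unfolding G_def S_def using \<kappa>(1) by (intro K'.polys_pcompose K'.polys_smult) auto
  moreover have "poly G w = 0" by (simp add: G_def poly_pcompose Sw q(2))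
  moreover have "poly (pderiv G) w \<noteq> 0"
    using q(3) w0 \<kappa>(2) e0 by (simp add: G_def pderiv_pcompose poly_pcompose Sw S(2))
  moreover have "x' = w" if x': "poly G x' = 0" "x' - w \<prec> w" for x'
  proof -
    define u where "u = x' / w"
    have ux: "x' = u * w" using w0 by (simp add: u_def)
    have u1: "u - 1 \<prec> 1" using x'(2) vlt_divide[OF w0, of "x' - w" 1] w0 by (simp add: u_def diff_divide_distrib)
    have uV: "u \<in> V" using V_add[OF small_V[OF u1] V_one] by simp
    define N :: "('g, 'k) hahn_series alg_closure poly" where "N = Polynomial.monom 1 e - 1"
    have NV: "N \<in> polys V" unfolding N_def
      by (rule polysI) (auto simp: one_pCons coeff_pCons intro!: V_diff V_uminus split: nat.splits)
    have N: "poly N y = y ^ e - 1" "poly (pderiv N) y = of_nat e * y ^ (e - 1)" for y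
      by (simp_all add: N_def poly_monom pderiv_diff pderiv_monom)
    have ue: "u ^ e - 1 \<prec> 1" using poly_V_cong[OF NV uV V_one u1] by (simp add: N)
    have Sx': "poly S x' = u ^ e * d" using \<kappa>(2) by (simp add: S ux power_mult_distrib we)
    have "u ^ e * d = d"
    proof (rule simple_root_unique[OF qV dV _ _ q(2) _ q_simple])
      show "u ^ e * d \<in> V" using uV dV by (intro V_mult V_power)
      show "u ^ e * d - d \<prec> 1" using small_mult(1)[OF ue dV] by (simp add: left_diff_distrib)
      show "poly q (u ^ e * d) = 0" using x'(1) by (simp add: G_def poly_pcompose Sx')
    qed
    moreover have "d \<noteq> 0" unfolding d_def using c \<phi>_hom(8) by simp
    ultimately have "u ^ e = 1" by simp
    then have "u = 1"
      using e_unit u1 by (intro simple_root_unique[OF NV V_one uV]) (auto simp: N)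
    then show ?thesis using ux by simp
  qed
  ultimately show ?thesis unfolding rigid_def w_def by blast
qed

lemma hcoeff_sum: "hcoeff (sum h J) g = (\<Sum>i\<in>J. hcoeff (h i) g)"
  by (induction J rule: infinite_finite_induct) (auto simp: hcoeff_simps)

sublocale tl: tame_limit V "to_ac ` K" "\<lambda>i. to_ac (xs i)" "to_ac z"
proof (intro tame_limit.intro tame_limit_axioms.intro)
  show "valued V" by (rule valued_axioms)
  show "subfld (to_ac ` K)" by (rule to_ac_subfld[OF K])
  show "uni (to_ac ` K)" by (rule uni_above[OF K hensel_K order_refl])
  show "rigid (to_ac ` K) (to_ac (xs i))" for i by (rule rigid_xs)
  show "to_ac (xs (Suc n)) \<prec> to_ac (xs n)" for n
    using c \<gamma> by (simp add: vlt_to_ac hval_monomial strict_mono_less)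
  show "to_ac z - (\<Sum>j<n. to_ac (xs j)) \<preceq> to_ac (xs n)" for n
  proof -
    have coeff: "hcoeff (z - (\<Sum>j<n. xs j)) g = 0" if "g < \<gamma> n" for g
    proof (cases "g \<in> range \<gamma>")
      case True
      then obtain m where m: "g = \<gamma> m" by blast
      have "m < n" using that \<gamma> unfolding m by (simp add: strict_mono_less)
      have "{i. \<gamma> i = g} = {m}" using \<gamma> by (auto simp: m strict_mono_eq)
      moreover have "(\<Sum>j<n. hcoeff (xs j) g) = (\<Sum>j<n. if j = m then c j else 0)"
        using \<gamma> by (intro sum.cong) (auto simp: monomial.rep_eq m strict_mono_eq)
      ultimately show ?thesis using \<open>m < n\<close> by (simp add: hcoeff_simps z hcoeff_sum)
    next
      case False
      then have "{i. \<gamma> i = g} = {}" "\<And>j. hcoeff (xs j) g = 0" by (auto simp: monomial.rep_eq)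
      then show ?thesis by (simp add: hcoeff_simps z hcoeff_sum)
    qed
    have "(\<Sum>j<n. to_ac (xs j)) = to_ac (\<Sum>j<n. xs j)"
      by (induction n) simp_all
    moreover have "to_ac (z - (\<Sum>j<n. xs j)) \<preceq> to_ac (xs n)"
      unfolding vle_to_ac using c coeff hval_geI[of "z - (\<Sum>j<n. xs j)" "\<gamma> n"] by (auto simp: hval_monomial)
    ultimately show ?thesis by simp
  qed
qed

end

section \<open>Finite dimension in terms of linear dependence\<close>

context subfld
begin

interpretation R: field "ring_of_type_algebra :: 'a ring" by (rule field_from_type_algebra)

lemma combine_eq_sum:
  "length Ks = length Us \<Longrightarrow> R.combine Ks Us = (\<Sum>i<length Us. Ks ! i * Us ! i)"
  by (induction Ks Us rule: list_induct2) (simp_all add: sum.lessThan_Suc_shift del: sum.lessThan_Suc)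

text \<open>Turns finite dimension into a bound on independent families, the form in which
  valuations can contradict it.\<close>

lemma finite_dimension_dependent:
  assumes "R.finite_dimension F E"
  shows "\<exists>N::nat. \<forall>f. (\<forall>i<N. f i \<in> E) \<longrightarrow>
    (\<exists>k. (\<forall>i<N. k i \<in> F) \<and> (\<exists>i<N. k i \<noteq> 0) \<and> (\<Sum>i<N. k i * f i) = 0)"
proof -
  obtain n where n: "R.dimension n F E" using assms unfolding R.finite_dimension_def by blast
  show ?thesis
  proof (intro exI[of _ "Suc n"] allI impI)
    fix f assume f: "\<forall>i<Suc n. f i \<in> E"
    define Us where "Us = map f [0..<Suc n]"
    have Us: "length Us = Suc n" "set Us \<subseteq> E" using f by (auto simp: Us_def simp del: upt_Suc)
    then have "\<not> R.independent F Us"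
      using R.independent_length_le_dimension[OF subfield n, of Us] by auto
    moreover have "set Us \<subseteq> carrier ring_of_type_algebra" by simp
    ultimately obtain Ks where Ks: "length Ks = length Us" "R.combine Ks Us = \<zero>\<^bsub>ring_of_type_algebra\<^esub>"
        "set Ks \<subseteq> F" "set Ks \<noteq> {\<zero>\<^bsub>ring_of_type_algebra\<^esub>}"
      using R.dependent_imp_non_trivial_combine[OF subfield] by metis
    have "(\<Sum>i<Suc n. Ks ! i * f i) = (\<Sum>i<length Us. Ks ! i * Us ! i)"
      unfolding Us(1) by (intro sum.cong) (auto simp: Us_def simp del: upt_Suc)
    also have "\<dots> = 0" using Ks(2) combine_eq_sum[OF Ks(1)] by simp
    finally have "(\<Sum>i<Suc n. Ks ! i * f i) = 0" .
    moreover have "\<exists>i<Suc n. Ks ! i \<noteq> 0"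
    proof (rule ccontr)
      assume "\<not> ?thesis"
      then have "set Ks \<subseteq> {0}" using Ks(1) Us(1) by (auto simp: in_set_conv_nth)
      moreover have "set Ks \<noteq> {}" using Ks(1) Us(1) by auto
      ultimately show False using Ks(4) subset_singletonD by force
    qed
    moreover have "\<forall>i<Suc n. Ks ! i \<in> F" using Ks(1,3) Us(1) by (metis nth_mem subsetD)
    ultimately show "\<exists>k. (\<forall>i<Suc n. k i \<in> F) \<and> (\<exists>i<Suc n. k i \<noteq> 0) \<and> (\<Sum>i<Suc n. k i * f i) = 0" by blast
  qed
qed

text \<open>Independent lists have bounded length, and a longest one spans \<open>E\<close>.\<close>

lemma finite_dimension_if_dependent:
  fixes N :: nat
  assumes E: "subfld E" "F \<subseteq> E"
    and dep: "\<And>f. (\<And>i. i < N \<Longrightarrow> f i \<in> E) \<Longrightarrow>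
      \<exists>k. (\<forall>i<N. k i \<in> F) \<and> (\<exists>i<N. k i \<noteq> 0) \<and> (\<Sum>i<N. k i * f i) = 0"
  shows "R.finite_dimension F E"
proof -
  interpret E: subfld E by fact
  let ?P = "\<lambda>Us. R.independent F Us \<and> set Us \<subseteq> E"
  have carrier: "set Us \<subseteq> carrier ring_of_type_algebra" for Us by simp
  have bound: "length Us < N" if "?P Us" for Us
  proof (rule ccontr)
    assume "\<not> length Us < N"
    then have len: "length (take N Us) = N" by simp
    have ind: "R.independent F (take N Us)"
      using R.independent_split(2)[OF subfield, of "take N Us" "drop N Us"] that by simp
    have UsE: "Us ! i \<in> E" if "i < N" for i using \<open>?P Us\<close> \<open>\<not> length Us < N\<close> that nth_mem[of i Us] by auto
    obtain k where k: "\<forall>i<N. k i \<in> F" "\<exists>i<N. k i \<noteq> 0" "(\<Sum>i<N. k i * Us ! i) = 0"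
      using dep[of "(!) Us"] UsE by blast
    define Ks where "Ks = map k [0..<N]"
    have Ks: "length Ks = length (take N Us)" "set Ks \<subseteq> F" using len k(1) by (auto simp: Ks_def)
    have "R.combine Ks (take N Us) = (\<Sum>i<N. k i * Us ! i)"
      unfolding combine_eq_sum[OF Ks(1)] len by (intro sum.cong) (auto simp: Ks_def)
    then have "set (take (length (take N Us)) Ks) \<subseteq> {\<zero>\<^bsub>ring_of_type_algebra\<^esub>}"
      using R.independent_imp_trivial_combine[OF subfield ind Ks(2)] k(3) by simp
    then have "set Ks \<subseteq> {0}" unfolding Ks(1)[symmetric] by simp
    then show False using k(2) by (auto simp: Ks_def image_subset_iff)
  qed
  have "?P []" by auto
  then obtain Us where Us: "?P Us" "\<And>Vs. ?P Vs \<Longrightarrow> length Vs \<le> length Us"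
    using ex_has_greatest_nat[of ?P "[]" length N] bound less_imp_le by metis
  have "R.Span F Us = E"
  proof
    show "R.Span F Us \<subseteq> E"
    proof
      fix a assume "a \<in> R.Span F Us"
      then obtain Ks where Ks: "set Ks \<subseteq> F" "length Ks = length Us" "a = R.combine Ks Us"
        using R.Span_mem_iff_length_version[OF subfield carrier] by blast
      have "set Ks \<subseteq> E" "set Us \<subseteq> E" using Ks(1) Us(1) E(2) by auto
      then have "Ks ! i \<in> E" "Us ! i \<in> E" if "i < length Us" for i
        using subsetD[OF _ nth_mem] that Ks(2) by metis+
      then show "a \<in> E" unfolding Ks(3) combine_eq_sum[OF Ks(2)] by (intro E.sum E.mult) auto
    qed
    show "E \<subseteq> R.Span F Us"
    proof (rule ccontr)
      assume "\<not> ?thesis"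
      then obtain u where u: "u \<in> E" "u \<notin> R.Span F Us" by blast
      then have "?P (u # Us)" using Us(1) by (auto intro: R.independent.intros)
      then show False using Us(2)[of "u # Us"] by simp
    qed
  qed
  then show ?thesis using R.dimensionI[OF subfield, of Us E] Us(1) unfolding R.finite_dimension_def by blast
qed

end

lemma (in valued) sum_dominant_nonzero:
  assumes "finite A" "j \<in> A" "f j \<noteq> 0" "\<And>i. i \<in> A - {j} \<Longrightarrow> f i \<prec> f j"
  shows "sum f A \<noteq> 0"
proof
  have small: "sum f I \<prec> f j" if "\<And>i. i \<in> I \<Longrightarrow> f i \<prec> f j" for I
    using that assms(3) by (induction I rule: infinite_finite_induct) (auto intro: vlt_add)
  assume "sum f A = 0"
  then have "sum f (A - {j}) = - f j" using assms(1,2) by (simp add: sum.remove eq_neg_iff_add_eq_0 add.commute)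
  then show False using small[of "A - {j}"] assms(4) by simp
qed

section \<open>Terms as leading terms, and finite extensions\<close>

context tame_series
begin

lemma to_ac_mem [simp]: "to_ac f \<in> to_ac ` F \<longleftrightarrow> f \<in> F"
  by auto

lemma xs_in_henselian:
  assumes F: "subfld F" "henselian F" "K \<subseteq> F" "z \<in> F" shows "xs i \<in> F"
proof -
  have "to_ac (xs i) \<in> to_ac ` F"
  proof (rule tl.approx_contains[of _ "to_ac z" "Suc i"])
    show "subfld (to_ac ` F)" by (rule to_ac_subfld[OF F(1)])
    show "uni (to_ac ` F)" by (rule uni_above[OF F(1-3)])
    show "to_ac z - tl.s (Suc j) \<prec> to_ac (xs j)" for j
      using tl.z_s(1)[of "Suc j"] tl.x_decr by (rule vle_vlt_trans)
  qed (use F in auto)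
  then show ?thesis by simp
qed

text \<open>Evaluate the minimal polynomial \<open>f\<close> of \<open>s n\<close> at
  \<open>z\<close>. The value lies in \<open>F\<close>, although \<open>s n\<close> need not, and
  its leading term is \<open>xs n\<close> times that of \<open>f'(s n)\<close>. By induction the
  earlier terms are leading terms of \<open>F\<close>, so \<open>f'(s n)\<close> lies in the field
  generated by these over \<open>K\<close>, whose leading terms are again leading terms of
  \<open>F\<close>.\<close>

lemma xs_leading_term:
  assumes F: "subfld F" "K \<subseteq> F" "z \<in> F" shows "xs n \<in> lt ` F"
proof (induction n rule: less_induct)
  case (less n)
  interpret F: subfld F by fact
  interpret gr: graded K "lt ` F" by (rule graded_lt_image[OF K lt_K F(1,2)])
  let ?E = "adjoin K (lt ` F)"
  interpret E: subfld ?E by (rule subfld_adjoin)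
  interpret E': subfld "to_ac ` ?E" by (rule to_ac_subfld[OF E.subfld_axioms])
  interpret F': subfld "to_ac ` F" by (rule to_ac_subfld[OF F(1)])
  obtain f where f: "minp (to_ac ` K) (tl.s n) f" using tl.K.minp_exists[OF tl.s_alg] .
  note close = tl.minp_s_at_z[OF f]
  have fF: "f \<in> polys (to_ac ` F)" using minpD(1)[OF f] polys_mono[OF image_mono[OF F(2)]] by blast
  then have "poly f (to_ac z) \<in> to_ac ` F" using F(3) by auto
  then obtain w where w: "w \<in> F" "poly f (to_ac z) = to_ac w" by auto
  have "K \<subseteq> ?E" "lt ` F \<subseteq> ?E" using adjoin_incl[of K "lt ` F"] by simp_all
  then have "f \<in> polys (to_ac ` ?E)" "to_ac (xs j) \<in> to_ac ` ?E" if "j < n" for j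
    using minpD(1)[OF f] polys_mono[OF image_mono[of K ?E]] less.IH[OF that] by auto
  moreover have "f \<in> polys (to_ac ` ?E)"
    using minpD(1)[OF f] polys_mono[OF image_mono[OF \<open>K \<subseteq> ?E\<close>]] by blast
  ultimately have "poly (pderiv f) (tl.s n) \<in> to_ac ` ?E"
    unfolding tl.s_def by (intro E'.poly_closed E'.polys_pderiv E'.sum) auto
  then obtain u where u: "u \<in> ?E" "poly (pderiv f) (tl.s n) = to_ac u" by auto
  have "to_ac w - to_ac (xs n * u) \<prec> to_ac (xs n * u)"
    using close unfolding w(2) u(2) tl.close_def by simp
  from lt_cong[OF this] have lw: "lt w = xs n * lt u" by (simp add: lt_mult lt_monomial)
  have "u \<noteq> 0" using tl.closeD(4)[OF close] unfolding u(2) by auto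
  then have "xs n = lt w * inverse (lt u)" using lw by (simp add: field_simps)
  moreover have "lt u \<in> lt ` F" by (rule gr.lt_adjoin[OF u(1)])
  ultimately show ?case using gr.mult[OF imageI[OF w(1)] gr.inv] by metis
qed

lemma \<gamma>_in_value_group:
  assumes F: "subfld F" "K \<subseteq> F" "z \<in> F"
  shows "\<gamma> n \<in> value_group F" "\<gamma> n \<in> vK \<Longrightarrow> c n \<in> residue_field F"
proof -
  obtain f where f: "f \<in> F" "xs n = lt f" using xs_leading_term[OF F] by blast
  have f0: "f \<noteq> 0" using f(2) c by (metis lt_eq_0_iff monomial_eq_0_iff)
  have hf: "hval f = \<gamma> n" using hval_lt[OF f0] hval_monomial[OF c, of n "\<gamma> n"] f(2) by simp
  then show "\<gamma> n \<in> value_group F" using f(1) f0 unfolding value_group_def by (intro image_eqI[of _ _ f]) auto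
  have "hcoeff f (\<gamma> n) = hcoeff (lt f) (\<gamma> n)" by (simp add: lt_def hf monomial.rep_eq)
  then have "hcoeff f (\<gamma> n) = c n" by (simp add: f(2)[symmetric] monomial.rep_eq)
  moreover assume "\<gamma> n \<in> vK"
  ultimately show "c n \<in> residue_field F" using hcoeff_hval_residue[OF F(1) f(1) f0] F(2) vK_iff hf by auto
qed

lemma group_closure_value_group:
  assumes F: "subfld F" "S \<subseteq> value_group F" shows "group_closure S \<subseteq> value_group F"
proof
  interpret F: subfld F by fact
  fix g assume "g \<in> group_closure S"
  then show "g \<in> value_group F"
  proof induction
    case (base s)
    have "0 \<in> value_group F" unfolding value_group_def by (rule image_eqI[of _ _ 1]) auto
    then show ?case using base F(2) by auto
  next
    case (diff s t)
    then obtain f h where "f \<in> F" "f \<noteq> 0" "hval f = s" "h \<in> F" "h \<noteq> 0" "hval h = t"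
      unfolding value_group_def by auto
    then show ?case unfolding value_group_def
      by (intro image_eqI[of _ _ "f * inverse h"]) (auto simp: hval_times hval_inverse)
  qed
qed

abbreviation "\<Gamma> \<equiv> group_closure (vK \<union> range \<gamma>)"

lemma coset_eqI: "g - g' \<in> vK \<Longrightarrow> g +o vK = g' +o vK"
proof -
  have *: "g +o vK \<subseteq> g' +o vK" if "g - g' \<in> vK" for g g'
  proof
    fix x assume "x \<in> g +o vK"
    then obtain a where "a \<in> vK" "x = g' + ((g - g') + a)" by (auto simp: elt_set_plus_def)
    then show "x \<in> g' +o vK" using vK_add[OF that, of a] unfolding elt_set_plus_def by blast
  qed
  assume "g - g' \<in> vK"
  then show ?thesis using *[of g g'] *[of g' g] vK_uminus[of "g - g'"] by auto
qed

lemma coset_eqD: "g +o vK = g' +o vK \<Longrightarrow> g - g' \<in> vK"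
proof -
  assume *: "g +o vK = g' +o vK"
  have "g + 0 \<in> g +o vK" using vK_0 unfolding elt_set_plus_def by blast
  then obtain a where "a \<in> vK" "g = g' + a" unfolding * by (auto simp: elt_set_plus_def)
  then show ?thesis by simp
qed

text \<open>Elements whose values lie in distinct cosets of \<open>vK\<close> are linearly independent.\<close>

lemma finite_cosets:
  assumes E: "subfld E" "to_ac ` K \<subseteq> E" "ring.finite_dimension ring_of_type_algebra (to_ac ` K) E"
    and x: "\<And>n. to_ac (xs n) \<in> E"
  shows "finite ((\<lambda>g. g +o vK) ` \<Gamma>)"
proof (rule ccontr)
  interpret E: subfld E by fact
  assume inf: "\<not> ?thesis"
  \<comment> \<open>The part of \<open>E\<close> inside \<open>k((G))\<close>, where
    \<open>hval\<close> makes sense.\<close>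
  define F where "F = {f :: ('g, 'k) hahn_series. to_ac f \<in> E}"
  have F: "subfld F" by unfold_locales (auto simp: F_def)
  have KF: "K \<subseteq> F" using E(2) by (auto simp: F_def)
  have "vK \<union> range \<gamma> \<subseteq> value_group F"
  proof -
    have "vK \<subseteq> value_group F" using KF unfolding value_group_def by blast
    moreover have "\<gamma> n \<in> value_group F" for n
      unfolding value_group_def by (rule image_eqI[of _ _ "xs n"]) (use x c in \<open>auto simp: F_def hval_monomial\<close>)
    ultimately show ?thesis by blast
  qed
  note \<Gamma> = group_closure_value_group[OF F this]
  obtain N :: nat where N: "\<forall>f. (\<forall>i<N. f i \<in> E) \<longrightarrow>
      (\<exists>k. (\<forall>i<N. k i \<in> to_ac ` K) \<and> (\<exists>i<N. k i \<noteq> 0) \<and> (\<Sum>i<N. k i * f i) = 0)"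
    using subfld.finite_dimension_dependent[OF to_ac_subfld[OF K] E(3)] by blast
  obtain C where C: "finite C" "card C = N" "C \<subseteq> (\<lambda>g. g +o vK) ` \<Gamma>"
    using infinite_arbitrarily_large[OF inf] by blast
  obtain b where b: "bij_betw b {0..<N} C" using ex_bij_betw_nat_finite[OF C(1)] C(2) by blast
  have "\<exists>f. f \<in> F \<and> f \<noteq> 0 \<and> b i = hval f +o vK" if "i < N" for i
  proof -
    have "b i \<in> C" using b that by (auto simp: bij_betw_def)
    then obtain g where "g \<in> \<Gamma>" "b i = g +o vK" using C(3) by blast
    then show ?thesis using \<Gamma> unfolding value_group_def by auto
  qed
  then obtain f where f: "\<And>i. i < N \<Longrightarrow> f i \<in> F" "\<And>i. i < N \<Longrightarrow> f i \<noteq> 0" "\<And>i. i < N \<Longrightarrow> b i = hval (f i) +o vK"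
    by metis
  obtain k where k: "\<forall>i<N. k i \<in> to_ac ` K" "\<exists>i<N. k i \<noteq> 0" "(\<Sum>i<N. k i * to_ac (f i)) = 0"
    using N[rule_format, of "\<lambda>i. to_ac (f i)"] f(1) by (auto simp: F_def)
  have "\<forall>i. \<exists>u. i < N \<longrightarrow> u \<in> K \<and> k i = to_ac u" using k(1) by blast
  then obtain \<kappa> where \<kappa>: "\<And>i. i < N \<Longrightarrow> \<kappa> i \<in> K" "\<And>i. i < N \<Longrightarrow> k i = to_ac (\<kappa> i)" by metis
  define I where "I = {i. i < N \<and> k i \<noteq> 0}"
  have I: "finite I" "I \<noteq> {}" using k(2) by (auto simp: I_def)
  define v where "v i = hval (\<kappa> i * f i)" for i
  have v: "v i = hval (\<kappa> i) + hval (f i)" "hval (\<kappa> i) \<in> vK" "\<kappa> i * f i \<noteq> 0" if "i \<in> I" for i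
    using that f \<kappa> unfolding v_def I_def value_group_def by (auto simp: hval_times)
  have inj: "i = j" if "i \<in> I" "j \<in> I" "v i = v j" for i j
  proof -
    have "hval (f i) - hval (f j) = hval (\<kappa> j) + - hval (\<kappa> i)"
      using that v(1)[of i] v(1)[of j] by (simp add: algebra_simps)
    also have "\<dots> \<in> vK" using v(2) that by (intro vK_add vK_uminus)
    finally have "b i = b j" using coset_eqI f(3) that by (auto simp: I_def)
    then show ?thesis using b that by (auto simp: I_def bij_betw_def dest: inj_onD)
  qed
  obtain j where j: "j \<in> I" "\<And>i. i \<in> I \<Longrightarrow> v j \<le> v i"
    using ex_is_arg_min_if_finite[OF I, of v] unfolding is_arg_min_linorder by blast
  have "(\<Sum>i\<in>I. to_ac (\<kappa> i * f i)) \<noteq> 0"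
  proof (rule sum_dominant_nonzero[OF I(1) j(1)])
    show "to_ac (\<kappa> j * f j) \<noteq> 0" using v(3)[OF j(1)] by simp
    fix i assume i: "i \<in> I - {j}"
    then have "v j < v i" using j(2)[of i] inj[OF j(1), of i] by (auto simp: order_le_less)
    then show "to_ac (\<kappa> i * f i) \<prec> to_ac (\<kappa> j * f j)"
      unfolding vlt_to_ac using v(3)[OF j(1)] by (auto simp: v_def)
  qed
  moreover have "(\<Sum>i<N. k i * to_ac (f i)) = (\<Sum>i\<in>I. to_ac (\<kappa> i * f i))"
    by (rule sum.mono_neutral_cong_right) (auto simp: I_def \<kappa>)
  ultimately show False using k(3) by simp
qed

text \<open>Constants that are linearly dependent over \<open>K\<close> are so over the residue field: compare the
  coefficients at the smallest exponent.\<close>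

lemma finite_dimension_constants:
  assumes E: "subfld E" "to_ac ` K \<subseteq> E" "ring.finite_dimension ring_of_type_algebra (to_ac ` K) E"
    and x: "\<And>n. \<phi> (c n) \<in> E"
  shows "ring.finite_dimension ring_of_type_algebra B (adjoin B (range c))"
proof -
  interpret E: subfld E by fact
  have "subfld {a. \<phi> a \<in> E}" by unfold_locales (auto simp: \<phi>_hom)
  moreover have "B \<subseteq> {a. \<phi> a \<in> E}" using \<phi>_B E(2) by blast
  ultimately have incl: "adjoin B (range c) \<subseteq> {a. \<phi> a \<in> E}" using x by (intro adjoin_minimal) auto
  obtain N :: nat where N: "\<forall>f. (\<forall>i<N. f i \<in> E) \<longrightarrow>
      (\<exists>k. (\<forall>i<N. k i \<in> to_ac ` K) \<and> (\<exists>i<N. k i \<noteq> 0) \<and> (\<Sum>i<N. k i * f i) = 0)"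
    using subfld.finite_dimension_dependent[OF to_ac_subfld[OF K] E(3)] by blast
  show ?thesis
  proof (rule subfld.finite_dimension_if_dependent[OF B])
    show "subfld (adjoin B (range c))" by (rule subfld_adjoin)
    show "B \<subseteq> adjoin B (range c)" using adjoin_incl[of B "range c"] by simp
    fix b assume "\<And>i. i < N \<Longrightarrow> b i \<in> adjoin B (range c)"
    then obtain k where k: "\<forall>i<N. k i \<in> to_ac ` K" "\<exists>i<N. k i \<noteq> 0" "(\<Sum>i<N. k i * \<phi> (b i)) = 0"
      using N[rule_format, of "\<lambda>i. \<phi> (b i)"] incl by blast
    have "\<forall>i. \<exists>u. i < N \<longrightarrow> u \<in> K \<and> k i = to_ac u" using k(1) by blast
    then obtain \<kappa> where \<kappa>: "\<And>i. i < N \<Longrightarrow> \<kappa> i \<in> K" "\<And>i. i < N \<Longrightarrow> k i = to_ac (\<kappa> i)" by metis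
    define I where "I = {i. i < N \<and> \<kappa> i \<noteq> 0}"
    have I: "finite I" "I \<noteq> {}" using k(2) \<kappa> by (auto simp: I_def)
    obtain j where j: "j \<in> I" "\<And>i. i \<in> I \<Longrightarrow> hval (\<kappa> j) \<le> hval (\<kappa> i)"
      using ex_is_arg_min_if_finite[OF I, of "\<lambda>i. hval (\<kappa> i)"] unfolding is_arg_min_linorder by blast
    define m where "m = hval (\<kappa> j)"
    have mK: "m \<in> vK" using j(1) \<kappa>(1) unfolding m_def I_def value_group_def by blast
    have "hcoeff (\<kappa> i) m \<in> B" if "i < N" for i
    proof (cases "\<kappa> i \<noteq> 0 \<and> hval (\<kappa> i) = m")
      case True
      then show ?thesis using hcoeff_hval_residue[OF K \<kappa>(1)[OF that]] mK vK_iff by auto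
    next
      case False
      then have "hcoeff (\<kappa> i) m = 0"
        using j(2)[of i] hcoeff_below_hval[of m "\<kappa> i"] that by (cases "\<kappa> i = 0") (auto simp: I_def m_def hcoeff_simps)
      then show ?thesis by simp
    qed
    moreover have "\<exists>i<N. hcoeff (\<kappa> i) m \<noteq> 0"
      using j(1) hval_props(1)[of "\<kappa> j"] by (auto simp: I_def m_def)
    moreover have "(\<Sum>i<N. hcoeff (\<kappa> i) m * b i) = 0"
    proof -
      have "to_ac (\<Sum>i<N. monomial (b i) 0 * \<kappa> i) = (\<Sum>i<N. k i * \<phi> (b i))"
      proof -
        have ts: "to_ac (sum h J) = (\<Sum>i\<in>J. to_ac (h i))" for h :: "nat \<Rightarrow> ('g, 'k) hahn_series" and J
          by (induction J rule: infinite_finite_induct) simp_all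
        show ?thesis unfolding ts by (intro sum.cong) (auto simp: \<kappa> \<phi>_def mult.commute)
      qed
      then have "(\<Sum>i<N. monomial (b i) 0 * \<kappa> i) = 0" using k(3) by simp
      then have "hcoeff (\<Sum>i<N. monomial (b i) 0 * \<kappa> i) m = 0" by (simp add: hcoeff_simps)
      then show ?thesis by (simp add: hcoeff_sum hcoeff_monomial_times mult.commute[of "hcoeff _ _"])
    qed
    ultimately show "\<exists>k. (\<forall>i<N. k i \<in> B) \<and> (\<exists>i<N. k i \<noteq> 0) \<and> (\<Sum>i<N. k i * b i) = 0"
      by (intro exI[of _ "\<lambda>i. hcoeff (\<kappa> i) m"] conjI allI impI)
  qed
qed

text \<open>In a finite extension containing all terms the cosets are finite in number, but the
  constants \<open>c n\<close> are not yet available separately. Adjoining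
  \<open>t^(\<gamma> j)\<close> for one \<open>j\<close> in each coset met by the sequence,
  algebraic since a multiple of \<open>\<gamma> j\<close> lies in \<open>vK\<close>, keeps the
  extension finite and isolates every \<open>c n\<close>.\<close>

lemma not_in_simple_extension:
  assumes inf: "infinite ((\<lambda>g. g +o vK) ` \<Gamma>) \<or>
      \<not> ring.finite_dimension ring_of_type_algebra B (adjoin B (range c))"
    and a: "alg (to_ac ` K) a"
  shows "\<exists>n. to_ac (xs n) \<notin> sext (to_ac ` K) a"
proof (rule ccontr)
  assume "\<not> ?thesis"
  then have all: "to_ac (xs n) \<in> sext (to_ac ` K) a" for n by blast
  have xsE: "to_ac (xs n) \<in> E" if "subfld E" "to_ac ` K \<subseteq> E" "a \<in> E" for E n
    using all tl.K.sext_minimal[OF that] by blast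
  obtain E where E: "subfld E" "to_ac ` K \<subseteq> E" "set [a] \<subseteq> E"
      "ring.finite_dimension ring_of_type_algebra (to_ac ` K) E"
    by (rule tl.K.finite_ext_exists[of "[a]"]) (use a in auto)
  have fin: "finite ((\<lambda>g. g +o vK) ` \<Gamma>)"
    using finite_cosets[OF E(1,2,4)] xsE[OF E(1,2)] E(3) by simp
  have "range (\<lambda>n. \<gamma> n +o vK) \<subseteq> (\<lambda>g. g +o vK) ` \<Gamma>" by (auto intro: group_closure.base)
  from finite_subset[OF this fin] obtain J where J: "finite J"
      "range (\<lambda>n. \<gamma> n +o vK) = (\<lambda>n. \<gamma> n +o vK) ` J"
    using finite_subset_image[of "range (\<lambda>n. \<gamma> n +o vK)" "\<lambda>n. \<gamma> n +o vK" UNIV] by auto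
  obtain js where js: "set js = J" using finite_list[OF J(1)] by blast
  have alg: "alg (to_ac ` K) y" if "y \<in> set (a # map (\<lambda>j. to_ac (monomial 1 (\<gamma> j))) js)" for y
  proof -
    have "alg (to_ac ` K) (to_ac (monomial 1 (\<gamma> j)))" for j
    proof -
      obtain e :: nat where e: "e > 0" "(\<Sum>i<e. \<gamma> j) \<in> vK" using tame[of j] by blast
      let ?k = "to_ac (monomial (1::'k) (\<Sum>i<e. \<gamma> j))" and ?t = "to_ac (monomial (1::'k) (\<gamma> j))"
      have "?t ^ e = ?k" by (simp add: monomial_power flip: to_ac_power)
      then have "poly (Polynomial.monom 1 e - [:?k:]) ?t = 0" by (simp add: poly_monom)
      moreover have "coeff (Polynomial.monom 1 e - [:?k:]) e = 1"
        using e(1) by (simp add: coeff_pCons split: nat.splits)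
      then have "Polynomial.monom 1 e - [:?k:] \<noteq> 0" by (metis coeff_0 zero_neq_one)
      moreover have "Polynomial.monom 1 e - [:?k:] \<in> polys (to_ac ` K)"
        using e(2) vK_iff by (intro tl.K.polys_diff tl.K.polys_monom tl.K.polys_pCons) auto
      ultimately show ?thesis unfolding alg_def by blast
    qed
    then show ?thesis using that a by auto
  qed
  obtain E2 where E2: "subfld E2" "to_ac ` K \<subseteq> E2" "set (a # map (\<lambda>j. to_ac (monomial 1 (\<gamma> j))) js) \<subseteq> E2"
      "ring.finite_dimension ring_of_type_algebra (to_ac ` K) E2"
    by (rule tl.K.finite_ext_exists[OF alg])
  interpret E2: subfld E2 by fact
  have "\<phi> (c n) \<in> E2" for n
  proof -
    obtain j where j: "j \<in> J" "\<gamma> n +o vK = \<gamma> j +o vK" using J(2) by blast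
    then have "\<gamma> n - \<gamma> j \<in> vK" by (intro coset_eqD)
    then have "to_ac (monomial 1 (\<gamma> n - \<gamma> j)) \<in> E2" using E2(2) vK_iff by blast
    moreover have "to_ac (monomial 1 (\<gamma> j)) \<in> E2" using E2(3) j(1) js by auto
    moreover have "to_ac (xs n) \<in> E2" using xsE[OF E2(1,2)] E2(3) by simp
    ultimately have "to_ac (xs n) * inverse (to_ac (monomial 1 (\<gamma> n - \<gamma> j)) * to_ac (monomial 1 (\<gamma> j))) \<in> E2"
      by (intro E2.mult E2.inv)
    moreover have "xs n * inverse (monomial 1 (\<gamma> n - \<gamma> j) * monomial 1 (\<gamma> j)) = monomial (c n) 0"
      by (simp add: monomial_mult monomial_inverse)
    ultimately show ?thesis by (simp add: \<phi>_def flip: to_ac_mult to_ac_inverse)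
  qed
  then show False using finite_dimension_constants[OF E2(1,2,4)] fin inf by blast
qed

end

lemma residue_field_subfld:
  assumes "subfld F" shows "subfld (residue_field F)"
proof -
  interpret F: subfld F by fact
  interpret O: subrng hval_ring by (rule hval_ring_subrng)
  show ?thesis
  proof
    show "1 \<in> residue_field F" unfolding residue_field_def by (rule image_eqI[of _ _ 1]) (auto simp: hcoeff_simps)
    fix x y assume "x \<in> residue_field F" "y \<in> residue_field F"
    then obtain f h where *: "f \<in> F" "f \<in> hval_ring" "x = hcoeff f 0" "h \<in> F" "h \<in> hval_ring" "y = hcoeff h 0"
      unfolding residue_field_def by auto
    then show "x - y \<in> residue_field F" unfolding residue_field_def
      by (intro image_eqI[of _ _ "f - h"]) (auto simp: hcoeff_simps intro: O.diff)
    show "x * y \<in> residue_field F" using * unfolding residue_field_def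
      by (intro image_eqI[of _ _ "f * h"]) (auto simp: hcoeff_0_mult intro: O.mult)
  next
    fix x assume "x \<in> residue_field F"
    then obtain f where f: "f \<in> F" "f \<in> hval_ring" "x = hcoeff f 0"
      unfolding residue_field_def by auto
    show "inverse x \<in> residue_field F"
    proof (cases "x = 0")
      case True
      then show ?thesis using \<open>x \<in> residue_field F\<close> by simp
    next
      case False
      then have f0: "f \<noteq> 0" using f(3) by (auto simp: hcoeff_simps)
      then have "hval f = 0" using f False hval_props(2)[of f 0] by (auto simp: hval_ring_def)
      then have inv: "inverse f \<in> hval_ring" using f0 by (simp add: hval_ring_def hval_inverse)
      then have "x * hcoeff (inverse f) 0 = 1"
        using hcoeff_0_mult[OF f(2) inv] f0 f(3) by (simp add: hcoeff_simps)
      then have "inverse x = hcoeff (inverse f) 0" by (rule inverse_unique)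
      then show ?thesis using f(1) inv unfolding residue_field_def by auto
    qed
  qed
qed

section \<open>Implicit constants, value group and residue field\<close>

context tame_series
begin

abbreviation "Kz \<equiv> adjoin K {z}"
abbreviation "L \<equiv> adjoin K (range xs)"
abbreviation "M \<equiv> adjoin B (range c)"

lemma Kz: "subfld Kz" "K \<subseteq> Kz" "z \<in> Kz"
  using subfld_adjoin[of K "{z}"] adjoin_incl[of K "{z}"] by auto

lemma L_incl: "L \<subseteq> henselization Kz"
proof -
  have "L \<subseteq> F" if "subfld F" "henselian F" "Kz \<subseteq> F" for F
    using xs_in_henselian[OF that(1,2)] Kz that by (intro adjoin_minimal) auto
  then show ?thesis unfolding henselization_def subfield_iff_subfld by blast
qed

lemma alg_to_ac: "alg (to_ac ` K) (to_ac u) \<longleftrightarrow> alg K u"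
proof
  assume "alg K u"
  then obtain p where p: "p \<in> polys K" "p \<noteq> 0" "poly p u = 0" by (auto simp: alg_def)
  moreover have "map_poly to_ac p \<in> polys (to_ac ` K)" using p(1) by (auto simp: polys_def coeff_map_poly)
  moreover have "map_poly to_ac p \<noteq> 0" using p(2) by (simp add: map_poly_eq_0_iff)
  ultimately show "alg (to_ac ` K) (to_ac u)" unfolding alg_def by (metis map_poly_to_ac(1) to_ac_0)
next
  assume "alg (to_ac ` K) (to_ac u)"
  then obtain P where P: "P \<in> polys (to_ac ` K)" "P \<noteq> 0" "poly P (to_ac u) = 0" by (auto simp: alg_def)
  obtain p where p: "P = map_poly to_ac p" "p \<in> polys K" by (rule polys_to_ac[OF K.zero P(1)])
  have "p \<noteq> 0" using P(2) unfolding p(1) by auto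
  moreover have "to_ac (poly p u) = 0" using P(3) unfolding p(1) map_poly_to_ac .
  ultimately show "alg K u" unfolding alg_def using p(2) by auto
qed

lemma L_alg: "u \<in> L \<Longrightarrow> alg K u"
  using adjoin_minimal[OF K.algs_subfld, of K "range xs"] K.alg_mem tl.x_alg alg_to_ac by blast

definition monomials :: "'k set \<Rightarrow> 'g set \<Rightarrow> ('g, 'k) hahn_series set" where
  "monomials A D = {monomial d g |d g. d \<in> A \<and> g \<in> D}"

lemma monomialsI: "d \<in> A \<Longrightarrow> g \<in> D \<Longrightarrow> monomial d g \<in> monomials A D"
  unfolding monomials_def by blast

lemma monomialsD:
  assumes "monomial d g \<in> monomials A D" "d \<noteq> 0" shows "d \<in> A" "g \<in> D"
proof -
  obtain d' g' where *: "monomial d g = monomial d' g'" "d' \<in> A" "g' \<in> D"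
    using assms(1) unfolding monomials_def by blast
  have "hcoeff (monomial d g) g = hcoeff (monomial d' g') g" using *(1) by simp
  then have "g = g'" "d = d'" using assms(2) by (auto simp: monomial.rep_eq split: if_splits)
  then show "d \<in> A" "g \<in> D" using * by auto
qed

text \<open>Used twice: all coefficients with exponents in \<open>\<Gamma>\<close> to determine
  values, and coefficients in \<open>M\<close> with exponents in \<open>vK\<close> to determine
  residues.\<close>

lemma graded_monomials:
  assumes A: "subfld A" "B \<subseteq> A"
    and D: "vK \<subseteq> D" "\<And>g h. g \<in> D \<Longrightarrow> h \<in> D \<Longrightarrow> g + h \<in> D" "\<And>g. g \<in> D \<Longrightarrow> - g \<in> D"
  shows "graded K (monomials A D)"
proof (intro graded.intro K lt_K)
  interpret A: subfld A by fact
  fix f assume f: "f \<in> K"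
  show "lt f \<in> monomials A D"
  proof (cases "f = 0")
    case True
    then show ?thesis using vK_0 D(1) monomialsI[OF A.zero, of 0 D] by auto
  next
    case False
    then have "hval f \<in> vK" using f by (auto simp: value_group_def)
    moreover have "hcoeff f (hval f) \<in> A"
      using hcoeff_hval_residue[OF K f False] vK_iff calculation A(2) by blast
    ultimately show ?thesis using D(1) unfolding lt_def by (intro monomialsI) auto
  qed
next
  interpret A: subfld A by fact
  fix r assume "r \<in> monomials A D"
  then obtain d g where r: "d \<in> A" "g \<in> D" "r = monomial d g" unfolding monomials_def by blast
  show "lt r = r" by (simp add: r(3) lt_monomial)
  show "inverse r \<in> monomials A D" unfolding r(3) monomial_inverse using r(1,2) D(3) by (intro monomialsI) auto
  fix r' assume "r' \<in> monomials A D"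
  then obtain d' g' where r': "d' \<in> A" "g' \<in> D" "r' = monomial d' g'" unfolding monomials_def by blast
  show "r * r' \<in> monomials A D"
    unfolding r(3) r'(3) monomial_mult using r(1,2) r'(1,2) D(2) by (intro monomialsI) auto
next
  interpret A: subfld A by fact
  fix a b g assume ab: "monomial a g \<in> monomials A D" "monomial b g \<in> monomials A D"
  have mem: "d \<in> A" if "monomial d g \<in> monomials A D" for d
    using monomialsD(1)[OF that] A.zero by (cases "d = 0") auto
  show "monomial (a + b) g \<in> monomials A D"
  proof (cases "a = 0 \<and> b = 0")
    case False
    then have "g \<in> D" using monomialsD(2) ab by blast
    then show ?thesis using mem ab by (intro monomialsI A.add)
  qed (use ab in simp)
qed

context
  assumes inf: "\<And>a. alg (to_ac ` K) a \<Longrightarrow> \<exists>n. to_ac (xs n) \<notin> sext (to_ac ` K) a"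
begin

lemma z_transc: "ring.transcendental ring_of_type_algebra K z"
  using tl.z_transcendental[OF inf] K.transcendental_iff alg_to_ac by blast

text \<open>A henselian field containing \<open>L\<close> and \<open>z\<close> inside the image of
  \<open>k((G))\<close> pulls back to a henselian subfield of \<open>k((G))\<close> containing
  \<open>K(z)\<close>, so every element of the henselization lies in it.\<close>

lemma implicit_constants: "implicit_constant_field K z = L"
proof
  show "L \<subseteq> implicit_constant_field K z"
    using L_incl L_alg unfolding implicit_constant_field_def K.transcendental_iff by blast
  show "implicit_constant_field K z \<subseteq> L"
  proof
    fix u assume "u \<in> implicit_constant_field K z"
    then have u: "u \<in> henselization Kz" "alg K u"
      unfolding implicit_constant_field_def K.transcendental_iff by auto
    have L: "subfld L" "K \<subseteq> L" "range xs \<subseteq> L"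
      using subfld_adjoin[of K "range xs"] adjoin_incl[of K "range xs"] by auto
    have "to_ac u \<in> to_ac ` L"
    proof (rule tl.algebraic_in_henselization[OF inf _ _ _ _ hahn_hens])
      show "subfld (to_ac ` L)" by (rule to_ac_subfld[OF L(1)])
      show "alg (to_ac ` K) v" if "v \<in> to_ac ` L" for v using that L_alg alg_to_ac by auto
      show "alg (to_ac ` K) (to_ac u)" using u(2) alg_to_ac by simp
      fix F assume F: "hens F" "to_ac ` L \<subseteq> F" "to_ac z \<in> F" "F \<subseteq> range to_ac"
      interpret F: subfld F using F(1) unfolding hens_def by blast
      define F0 where "F0 = {f :: ('g, 'k) hahn_series. to_ac f \<in> F}"
      have F0: "subfld F0" by unfold_locales (auto simp: F0_def)
      have "to_ac ` F0 = F" using F(4) by (auto simp: F0_def)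
      then have "henselian F0" using henselian_iff[OF F0] F(1) by simp
      moreover have "Kz \<subseteq> F0" using F(2,3) L(2) F0 by (intro adjoin_minimal) (auto simp: F0_def)
      ultimately have "u \<in> F0" using u(1) F0 unfolding henselization_def subfield_iff_subfld by blast
      then show "to_ac u \<in> F" by (simp add: F0_def)
    qed (use L in auto)
    then show "u \<in> L" by simp
  qed
qed

text \<open>For large \<open>n\<close> the leading term of a nonzero polynomial at \<open>z\<close>
  is that at the partial sum, an element of the field generated by \<open>K\<close> and
  \<open>R\<close>. Quotients of such values exhaust \<open>K(z)\<close>.\<close>

lemma lt_Kz:
  assumes R: "graded K R" "\<And>n. xs n \<in> R" and f: "f \<in> Kz" shows "lt f \<in> R"
proof -
  interpret R: graded K R by fact
  let ?E = "adjoin K R"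
  interpret E: subfld ?E by (rule subfld_adjoin)
  have E: "K \<subseteq> ?E" "R \<subseteq> ?E" using adjoin_incl[of K R] by simp_all
  have poly: "lt (poly p z) \<in> R" if p: "p \<in> polys K" for p
  proof (cases "p = 0")
    case False
    have P: "map_poly to_ac p \<in> polys {a. alg (to_ac ` K) a}"
      using p tl.K.alg_mem by (auto simp: polys_def coeff_map_poly)
    have "map_poly to_ac p \<noteq> 0" using False by (simp add: map_poly_eq_0_iff)
    then obtain n where "tl.close (poly (map_poly to_ac p) (to_ac z)) (poly (map_poly to_ac p) (tl.s n))"
      using tl.stable_poly[OF inf P] by blast
    moreover have "tl.s n = to_ac (\<Sum>j<n. xs j)" unfolding tl.s_def by (induction n) simp_all
    ultimately have "to_ac (poly p z) - to_ac (poly p (\<Sum>j<n. xs j)) \<prec> to_ac (poly p (\<Sum>j<n. xs j))"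
      by (simp add: map_poly_to_ac tl.close_def del: to_ac_diff)
    then have "lt (poly p z) = lt (poly p (\<Sum>j<n. xs j))" by (rule lt_cong)
    moreover have "poly p (\<Sum>j<n. xs j) \<in> ?E"
      using p polys_mono[OF E(1)] R(2) E(2) by (intro E.poly_closed E.sum) auto
    ultimately show ?thesis using R.lt_adjoin by simp
  qed (simp add: R.zero_R)
  have "Kz \<subseteq> fracs K z" using K.fracs_subfld K.fracs_incl by (intro adjoin_minimal) auto
  then obtain p q where pq: "p \<in> polys K" "q \<in> polys K" "f = poly p z / poly q z"
    using f unfolding fracs_def by blast
  have "lt f = lt (poly p z) * inverse (lt (poly q z))"
    by (simp add: pq(3) field_class.field_divide_inverse lt_mult lt_inverse)
  then show ?thesis using poly pq(1,2) R.mult R.inv by simp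
qed

lemma value_group_Kz: "value_group Kz = \<Gamma>"
proof
  have "vK \<subseteq> value_group Kz" using Kz(2) unfolding value_group_def by blast
  then show "\<Gamma> \<subseteq> value_group Kz"
    using \<gamma>_in_value_group(1)[OF Kz] by (intro group_closure_value_group Kz(1)) auto
  have incl: "vK \<union> range \<gamma> \<subseteq> \<Gamma>" by (auto intro: group_closure.base)
  have R: "graded K (monomials UNIV \<Gamma>)"
    by (intro graded_monomials) (use incl in \<open>auto simp: group_closure_add intro!: subfld.intro\<close>)
  have xsR: "xs n \<in> monomials UNIV \<Gamma>" for n using incl by (intro monomialsI) auto
  show "value_group Kz \<subseteq> \<Gamma>"
  proof
    fix g assume "g \<in> value_group Kz"
    then obtain f where f: "f \<in> Kz" "f \<noteq> 0" "g = hval f" unfolding value_group_def by auto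
    then show "g \<in> \<Gamma>" using lt_Kz[OF R xsR f(1)] monomialsD hval_props(1)[OF f(2)] unfolding lt_def by blast
  qed
qed

lemma residue_field_Kz:
  assumes \<gamma>K: "\<And>i. \<gamma> i \<in> vK" shows "residue_field Kz = M"
proof
  have "B \<subseteq> residue_field Kz" using Kz(2) unfolding residue_field_def by blast
  then show "M \<subseteq> residue_field Kz"
    using \<gamma>_in_value_group(2)[OF Kz \<gamma>K] by (intro adjoin_minimal residue_field_subfld Kz(1)) auto
  interpret M: subfld M by (rule subfld_adjoin)
  have M: "B \<subseteq> M" "range c \<subseteq> M" using adjoin_incl[of B "range c"] by simp_all
  have R: "graded K (monomials M vK)"
    by (intro graded_monomials M.subfld_axioms M(1) order_refl vK_add vK_uminus)
  have xsR: "xs n \<in> monomials M vK" for n using \<gamma>K M(2) by (intro monomialsI) auto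
  show "residue_field Kz \<subseteq> M"
  proof
    fix d assume "d \<in> residue_field Kz"
    then obtain f where f: "f \<in> Kz" "f \<in> hval_ring" "d = hcoeff f 0" unfolding residue_field_def by auto
    show "d \<in> M"
    proof (cases "d = 0")
      case False
      then have f0: "f \<noteq> 0" using f(3) by (auto simp: hcoeff_simps)
      then have "hval f = 0" using f False hval_props(2)[of f 0] by (auto simp: hval_ring_def)
      then have "lt f = monomial d 0" using f(3) by (simp add: lt_def)
      then show ?thesis using lt_Kz[OF R xsR f(1)] monomialsD(1) False by metis
    qed simp
  qed
qed

end

lemma tame_series_conclusions:
  "L \<subseteq> henselization Kz \<and> (\<forall>i. \<gamma> i \<in> value_group Kz) \<and>
    ((\<forall>i. \<gamma> i \<in> vK) \<longrightarrow> (\<forall>i. c i \<in> residue_field Kz)) \<and>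
    (infinite ((\<lambda>g. g +o vK) ` \<Gamma>) \<or> \<not> ring.finite_dimension ring_of_type_algebra B M \<longrightarrow>
      ring.transcendental ring_of_type_algebra K z \<and> implicit_constant_field K z = L \<and> value_group Kz = \<Gamma> \<and>
      ((\<forall>i. \<gamma> i \<in> vK) \<longrightarrow> residue_field Kz = M))"
  using L_incl \<gamma>_in_value_group[OF Kz] z_transc implicit_constants value_group_Kz residue_field_Kz
    not_in_simple_extension by simp

end

theorem theorem6p1:
  fixes K :: "('g::linordered_ab_group_add, 'k::field) hahn_series set"
    and z :: "('g, 'k) hahn_series"
    and c :: "nat \<Rightarrow> 'k"
    and \<gamma> :: "nat \<Rightarrow> 'g"
  assumes "subfield K ring_of_type_algebra"
    and "henselian K"
    and "\<And>d g. d \<in> residue_field K \<Longrightarrow> g \<in> value_group K \<Longrightarrow> monomial d g \<in> K"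
    and "strict_mono \<gamma>"
    and "\<And>i. c i \<noteq> 0"
    and "\<And>g. hcoeff z g = (\<Sum>i | \<gamma> i = g. c i)"
    and "\<And>i. separable_algebraic (residue_field K) (c i)"
    and "\<And>i. \<exists>e::nat. e > 0 \<and> (CHAR('k) = 0 \<or> coprime e CHAR('k)) \<and>
      (\<Sum>j<e. \<gamma> i) \<in> value_group K"
  shows "adjoin K (range (\<lambda>i. monomial (c i) (\<gamma> i))) \<subseteq> henselization (adjoin K {z}) \<and>
    (\<forall>i. \<gamma> i \<in> value_group (adjoin K {z})) \<and>
    ((\<forall>i. \<gamma> i \<in> value_group K) \<longrightarrow> (\<forall>i. c i \<in> residue_field (adjoin K {z}))) \<and>
    (infinite ((\<lambda>g. g +o value_group K) ` group_closure (value_group K \<union> range \<gamma>)) \<or>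
      \<not> ring.finite_dimension ring_of_type_algebra (residue_field K)
        (adjoin (residue_field K) (range c)) \<longrightarrow>
      ring.transcendental ring_of_type_algebra K z \<and>
      implicit_constant_field K z = adjoin K (range (\<lambda>i. monomial (c i) (\<gamma> i))) \<and>
      value_group (adjoin K {z}) = group_closure (value_group K \<union> range \<gamma>) \<and>
      ((\<forall>i. \<gamma> i \<in> value_group K) \<longrightarrow>
        residue_field (adjoin K {z}) = adjoin (residue_field K) (range c)))"
proof -
  \<comment> \<open>The valuation ring of the closure is an auxiliary choice; no conclusion mentions
    it.\<close>
  obtain V :: "('g, 'k) hahn_series alg_closure set" where "hahn_val V" using hahn_val_exists by blast
  then have "tame_series V K z c \<gamma>"
    using assms by (intro tame_series.intro tame_series_axioms.intro) (auto simp: subfield_iff_subfld)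
  then show ?thesis by (rule tame_series.tame_series_conclusions)
qed

end
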